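(* For every complex-valued Borel simple function $\phi$ on $(-1,1)$, $$\left(\int_0^\infty\frac{4\lambda}{e^{\pi\lambda}+1}\,d\lambda\right)^{1/2}\|\phi\|_2\le\sup_{|\theta|=1}\|T_2(\theta\phi)\|_2,$$ where the supremum is over all $\theta\in L^\infty(-1,1)$ with $|\theta|=1$ a.e.
   Context: $\|\cdot\|_2$ is the norm of $L^2(-1,1)$ with Lebesgue measure. The finite Hilbert transform of $f\in L^1(-1,1)$ is $(Tf)(t)=\lim_{\varepsilon\to0^+}\frac1\pi\big(\int_{-1}^{t-\varepsilon}+\int_{t+\varepsilon}^1\big)\frac{f(x)}{x-t}\,dx$ (exists a.e.); it maps $L^2(-1,1)$ boundedly into itself, and this operator is denoted $T_2$. *)

theory Defs
  imports "HOL-Analysis.Analysis"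
begin

definition finite_hilbert :: "(real \<Rightarrow> complex) \<Rightarrow> real \<Rightarrow> complex" where
  "finite_hilbert f t = Lim (at_right 0)
     (\<lambda>\<epsilon>::real. complex_of_real (1 / pi) *
        (LINT x:({-1<..<t-\<epsilon>} \<union> {t+\<epsilon><..<1})|lborel. f x / complex_of_real (x - t)))"

definition L2norm :: "(real \<Rightarrow> complex) \<Rightarrow> real" where
  "L2norm f = sqrt (LINT x:{-1<..<1}|lborel. (cmod (f x))\<^sup>2)"

definition unimodular :: "(real \<Rightarrow> complex) set" where
  "unimodular = {\<theta>. \<theta> \<in> borel_measurable borel \<and>
      (AE x in lborel. x \<in> {-1<..<1} \<longrightarrow> cmod (\<theta> x) = 1)}"

end

(* In fact the supremum S dominates the full norm of phi; the constant is at most 1.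

   Write f(+) and f(-) for phi modulated by exp(inx) and exp(-inx).  Then
   exp(-int) T f(+) - exp(int) T f(-) is 2i times the convolution of phi with the Dirichlet kernel
   sin(ns)/(pi s), so the real part of the pairing of that convolution with phi is at most
   (S^2 + |phi|^2)/2.  Averaging over n against eps exp(-eps n) turns the Dirichlet kernel into the
   Poisson kernel pk, and eps -> 0 gives |phi|^2 <= (S^2 + |phi|^2)/2.

   The supremum is meaningful because T is bounded on L^2: the conjugate Poisson kernel qk satisfies
   qk_e * qk_e = - pk_(2e), so it acts as a contraction, and the truncated Hilbert kernel hk_e differs
   from qk_e by at most pk_e.  The identity pk_e * qk_d = qk_(e+d) reduces the maximal function of the
   qk_e to that of the Poisson kernel, which is controlled by Vitali's covering lemma; this maximal
   inequality yields the almost everywhere convergence of the truncated integrals. *)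

theory Submission
  imports Defs
begin

section \<open>Poisson and conjugate Poisson kernels\<close>

text \<open>Heuristic for the modulations: on the whole line the Hilbert transform is a Fourier
  multiplier, equal to a constant of modulus 1 on each half line of frequencies. A large modulation
  pushes the spectrum of phi to one side, so that T acts almost as multiplication by i or -i and
  almost no mass leaves the interval. The kernel identities make this exact without Fourier
  analysis. The obstacle is that \<open>Lim\<close> is a total function: T can be treated as linear
  only where the truncated integrals converge. So a.e. convergence must be proved for phi before two
  modulated transforms can be subtracted. For an arbitrary measurable factor \<theta> convergence is
  not proved; instead the bound that makes the supremum finite tolerates the default value of
  \<open>Lim\<close>. The Fermi integral equals 1/3. Only the bound 1 is used, by comparison with 4
  l exp(-pi l), whose integral is 4/pi^2.\<close>

lemma integral_FTC_UNIV:
  fixes F f :: "real \<Rightarrow> 'a::euclidean_space"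
  assumes "\<And>x. (F has_vector_derivative f x) (at x)" "\<And>x. isCont f x" "integrable lborel f"
    and "(F \<longlongrightarrow> A) at_bot" "(F \<longlongrightarrow> B) at_top"
  shows "(\<integral>x. f x \<partial>lborel) = B - A"
proof -
  have "(LBINT x=-\<infinity>..\<infinity>. f x) = B - A"
    by (rule interval_integral_FTC_integrable[where F=F])
       (use assms in \<open>auto simp: ereal_tendsto_simps1 set_integrable_def\<close>)
  then show ?thesis
    by (simp add: interval_lebesgue_integral_def set_lebesgue_integral_def)
qed

lemma integral_FTC_UNIV_nonneg:
  fixes F f :: "real \<Rightarrow> real"
  assumes "\<And>x. DERIV F x :> f x" "\<And>x. isCont f x" "\<And>x. 0 \<le> f x"
    and "(F \<longlongrightarrow> A) at_bot" "(F \<longlongrightarrow> B) at_top"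
  shows "integrable lborel f" "(\<integral>x. f x \<partial>lborel) = B - A"
proof -
  have "set_integrable lborel (einterval (-\<infinity>) \<infinity>) f" "(LBINT x=-\<infinity>..\<infinity>. f x) = B - A"
    using interval_integral_FTC_nonneg[where F=F and f=f and a="-\<infinity>" and b=\<infinity> and A=A and B=B] assms
    by (auto simp: ereal_tendsto_simps1)
  then show "integrable lborel f" "(\<integral>x. f x \<partial>lborel) = B - A"
    by (auto simp add: interval_lebesgue_integral_def set_lebesgue_integral_def set_integrable_def)
qed

definition pk :: "real \<Rightarrow> real \<Rightarrow> real" where
  "pk e s = e / (pi * (s\<^sup>2 + e\<^sup>2))"

definition qk :: "real \<Rightarrow> real \<Rightarrow> real" where
  "qk e s = s / (pi * (s\<^sup>2 + e\<^sup>2))"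

lemma pk_measurable [measurable]: "pk e \<in> borel_measurable borel"
  and qk_measurable [measurable]: "qk e \<in> borel_measurable borel"
  unfolding pk_def qk_def by measurable

lemma sum_squares_pos: "(e::real) > 0 \<Longrightarrow> s\<^sup>2 + e\<^sup>2 > 0"
  by (simp add: add_nonneg_pos)

lemma pk_nonneg: "e > 0 \<Longrightarrow> 0 \<le> pk e s"
  by (simp add: pk_def)

lemma pk_integral:
  assumes "e > 0"
  shows "integrable lborel (pk e)" "(\<integral>s. pk e s \<partial>lborel) = 1"
proof -
  have d: "DERIV (\<lambda>s. arctan (s / e) / pi) s :> pk e s" for s
  proof -
    have "(1 / e) / (1 + (s / e)\<^sup>2) / pi = pk e s"
      using assms sum_squares_pos[OF assms, of s]
      by (simp add: pk_def divide_simps power2_eq_square)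
    moreover have "DERIV (\<lambda>s. arctan (s / e) / pi) s :> (1 / e) / (1 + (s / e)\<^sup>2) / pi"
      using assms by (auto intro!: derivative_eq_intros simp: divide_inverse)
    ultimately show ?thesis by simp
  qed
  have c: "isCont (pk e) s" for s
    unfolding pk_def using sum_squares_pos[OF assms, of s] by (intro continuous_intros) auto
  have "filterlim (\<lambda>s::real. s / e) at_top at_top"
    using assms filterlim_tendsto_pos_mult_at_top[OF tendsto_const[of "1/e"] _ filterlim_ident] by auto
  then have t: "((\<lambda>s. arctan (s / e) / pi) \<longlongrightarrow> pi / 2 / pi) at_top"
    using assms by (intro tendsto_intros filterlim_compose[OF tendsto_arctan_at_top]) auto
  have "filterlim (\<lambda>s::real. s / e) at_bot at_bot"
    using assms filterlim_tendsto_pos_mult_at_bot[OF tendsto_const[of "1/e"] _ filterlim_ident] by auto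
  then have b: "((\<lambda>s. arctan (s / e) / pi) \<longlongrightarrow> - (pi / 2) / pi) at_bot"
    using assms by (intro tendsto_intros filterlim_compose[OF tendsto_arctan_at_bot]) auto
  note * = integral_FTC_UNIV_nonneg[OF d c pk_nonneg[OF assms] b t]
  show "integrable lborel (pk e)" "(\<integral>s. pk e s \<partial>lborel) = 1"
    using * by auto
qed

lemma pk_minus [simp]: "pk e (- s) = pk e s" and qk_minus [simp]: "qk e (- s) = - qk e s"
  by (auto simp: pk_def qk_def)

lemma pk_sub_commute: "pk e (x - y) = pk e (y - x)"
  by (metis minus_diff_eq pk_minus)

lemma pk_shift_integral:
  assumes "e > 0"
  shows "integrable lborel (\<lambda>s. pk e (s - t))" "(\<integral>s. pk e (s - t) \<partial>lborel) = 1"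
    "integrable lborel (\<lambda>s. pk e (t - s))" "(\<integral>s. pk e (t - s) \<partial>lborel) = 1"
proof -
  show *: "integrable lborel (\<lambda>s. pk e (s - t))" "(\<integral>s. pk e (s - t) \<partial>lborel) = 1"
    using lborel_integrable_real_affine[OF pk_integral(1)[OF assms], of 1 "-t"]
      lborel_integral_real_affine[of 1 "pk e" "-t"] pk_integral[OF assms] by auto
  then show "integrable lborel (\<lambda>s. pk e (t - s))" "(\<integral>s. pk e (t - s) \<partial>lborel) = 1"
    by (auto simp: pk_sub_commute[of e t])
qed

lemma pk_le: assumes "e > 0" shows "pk e s \<le> 1 / (pi * e)"
proof -
  have "e * e \<le> s\<^sup>2 + e\<^sup>2" by (simp add: power2_eq_square)
  then have "e / (s\<^sup>2 + e\<^sup>2) \<le> 1 / e"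
    using assms sum_squares_pos[OF assms, of s] by (simp add: divide_simps mult.commute)
  then show ?thesis
    using divide_right_mono[of _ _ pi] by (fastforce simp: pk_def mult.commute)
qed

lemma qk_le: assumes "e > 0" shows "\<bar>qk e s\<bar> \<le> 1 / (pi * e)"
proof -
  have "0 \<le> (\<bar>s\<bar> - e)\<^sup>2" by simp
  then have "2 * (\<bar>s\<bar> * e) \<le> s\<^sup>2 + e\<^sup>2" by (simp add: power2_diff)
  moreover have "0 \<le> \<bar>s\<bar> * e" using assms by simp
  ultimately have "\<bar>s\<bar> * e \<le> s\<^sup>2 + e\<^sup>2" by linarith
  then have "\<bar>s\<bar> / (s\<^sup>2 + e\<^sup>2) \<le> 1 / e"
    using assms sum_squares_pos[OF assms, of s] by (simp add: divide_simps mult.commute)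
  then show ?thesis
    using divide_right_mono[of _ _ pi] sum_squares_pos[OF assms, of s]
    by (fastforce simp: qk_def mult.commute abs_mult)
qed

text \<open>Up to sign and the factor pi, both real kernels are parts of one Cauchy kernel. Their
  convolutions can therefore be read off from two complex integrals, one with poles on opposite
  sides of the real line and one with poles on the same side.\<close>

lemma cauchy_kernel:
  assumes "e > 0"
  shows "1 / (complex_of_real s + \<i> * e) = pi * (qk e s - \<i> * pk e s)"
    "1 / (complex_of_real s - \<i> * e) = pi * (qk e s + \<i> * pk e s)"
proof -
  have p: "s * s + e * e \<noteq> 0" "e * e + s * s \<noteq> 0" "e \<noteq> 0"
    using sum_squares_pos[OF assms, of s] assms by (auto simp: power2_eq_square simp del: sum_squares_eq_zero_iff)
  have n: "complex_of_real s + \<i> * e \<noteq> 0" "complex_of_real s - \<i> * e \<noteq> 0"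
    using assms by (auto simp: complex_eq_iff)
  show "1 / (complex_of_real s + \<i> * e) = pi * (qk e s - \<i> * pk e s)"
    "1 / (complex_of_real s - \<i> * e) = pi * (qk e s + \<i> * pk e s)"
    using assms p
    by (auto simp: complex_eq_iff qk_def pk_def Re_divide Im_divide power2_eq_square)
qed

text \<open>\<open>qk e\<close> decays only like 1/s and is not integrable. Its square is dominated
  by an integrable kernel, and this is what makes products of two kernels integrable.\<close>

lemma qk_square_le: assumes "e > 0" shows "(qk e s)\<^sup>2 \<le> pk e s / (pi * e)"
proof -
  have p: "s\<^sup>2 + e\<^sup>2 > 0" using sum_squares_pos[OF assms] .
  have "(qk e s)\<^sup>2 = s\<^sup>2 / (s\<^sup>2 + e\<^sup>2) / (pi\<^sup>2 * (s\<^sup>2 + e\<^sup>2))"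
    by (simp add: qk_def power2_eq_square)
  also have "\<dots> \<le> 1 / (pi\<^sup>2 * (s\<^sup>2 + e\<^sup>2))"
    using p by (intro divide_right_mono) auto
  also have "\<dots> = pk e s / (pi * e)" using assms by (simp add: pk_def power2_eq_square)
  finally show ?thesis .
qed

lemma pk_square_le: assumes "e > 0" shows "(pk e s)\<^sup>2 \<le> pk e s / (pi * e)"
  using mult_left_mono[OF pk_le[OF assms, of s] pk_nonneg[OF assms, of s]] by (simp add: power2_eq_square)

lemma abs_mult_le_squares: "\<bar>a * b\<bar> \<le> a\<^sup>2 + (b::real)\<^sup>2"
proof -
  have "0 \<le> (\<bar>a\<bar> - \<bar>b\<bar>)\<^sup>2" "0 \<le> a\<^sup>2" "0 \<le> b\<^sup>2" by simp_all
  then have "2 * (\<bar>a\<bar> * \<bar>b\<bar>) \<le> a\<^sup>2 + b\<^sup>2" by (simp add: power2_diff)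
  moreover have "0 \<le> \<bar>a\<bar> * \<bar>b\<bar>" by simp
  ultimately show ?thesis by (simp only: abs_mult)
qed

lemma kernel_product_integrable:
  assumes "e > 0" "d > 0" and "f \<in> {pk e, qk e}" "g \<in> {pk d, qk d}"
  shows "integrable lborel (\<lambda>s. f (s - b) * g (a - s))"
proof (rule Bochner_Integration.integrable_bound)
  show "integrable lborel (\<lambda>s. pk e (s - b) / (pi * e) + pk d (a - s) / (pi * d))"
    using pk_shift_integral[OF assms(1)] pk_shift_integral[OF assms(2)] by simp
  have [measurable]: "f \<in> borel_measurable borel" "g \<in> borel_measurable borel"
    using assms(3,4) by auto
  show "(\<lambda>s. f (s - b) * g (a - s)) \<in> borel_measurable lborel" by measurable
  show "AE s in lborel. norm (f (s - b) * g (a - s)) \<le> norm (pk e (s - b) / (pi * e) + pk d (a - s) / (pi * d))"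
  proof (rule AE_I2)
    fix s
    have "(f (s - b))\<^sup>2 \<le> pk e (s - b) / (pi * e)" "(g (a - s))\<^sup>2 \<le> pk d (a - s) / (pi * d)"
      using assms qk_square_le pk_square_le by auto
    then show "norm (f (s - b) * g (a - s)) \<le> norm (pk e (s - b) / (pi * e) + pk d (a - s) / (pi * d))"
      using abs_mult_le_squares[of "f (s - b)" "g (a - s)"] unfolding real_norm_def by linarith
  qed
qed

section \<open>Convolutions of the kernels by explicit antiderivatives\<close>

lemma Ln_diff_at_top:
  fixes z w :: complex
  shows "((\<lambda>r::real. Ln (r + z) - Ln (r + w)) \<longlongrightarrow> 0) at_top"
proof -
  have inv: "((\<lambda>r::real. v / of_real r) \<longlongrightarrow> 0) at_top" for v :: complex
    by (intro tendsto_divide_0[OF tendsto_const] filterlim_of_real_at_infinity)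
  have "((\<lambda>r::real. 1 + v / of_real r) \<longlongrightarrow> 1) at_top" for v :: complex
    using tendsto_add[OF tendsto_const inv, of 1 v] by simp
  then have l: "((\<lambda>r::real. Ln (1 + v / of_real r)) \<longlongrightarrow> Ln 1) at_top" for v :: complex
    by (rule tendsto_Ln) auto
  \<comment> \<open>The divergent term ln r is the same for every shift v; it cancels in the
    difference and leaves logarithms of quantities tending to 1.\<close>
  have eq: "\<forall>\<^sub>F r::real in at_top. Ln (r + v) = ln r + Ln (1 + v / of_real r)" for v :: complex
    using eventually_gt_at_top[of "norm v"]
  proof eventually_elim
    case (elim r)
    have r: "r > 0" using elim norm_ge_zero[of v] by linarith
    have n: "of_real r + v \<noteq> 0"
      using elim r by (metis add.inverse_inverse add_eq_0_iff abs_of_pos norm_minus_cancel norm_of_real order_less_irrefl)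
    then have "1 + v / of_real r \<noteq> 0" using r by (simp add: field_simps)
    then have "Ln (of_real r * (1 + v / of_real r)) = ln r + Ln (1 + v / of_real r)"
      using r by (simp add: Ln_times_of_real Ln_of_real)
    moreover have "of_real r * (1 + v / of_real r) = of_real r + v" using r by (simp add: distrib_left)
    ultimately show ?case by simp
  qed
  have "((\<lambda>r::real. Ln (1 + z / of_real r) - Ln (1 + w / of_real r)) \<longlongrightarrow> 0) at_top"
    using tendsto_diff[OF l l, of z w] by simp
  moreover have "\<forall>\<^sub>F r::real in at_top. Ln (1 + z / of_real r) - Ln (1 + w / of_real r) = Ln (r + z) - Ln (r + w)"
    using eq[of z] eq[of w] by eventually_elim simp
  ultimately show ?thesis by (rule Lim_transform_eventually)
qed

lemma cauchy_kernel_product: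
  fixes e d a :: real
  assumes "e > 0" "d > 0"
  shows "1 / (complex_of_real s + \<i> * e) * (1 / (complex_of_real (a - s) + \<i> * d))
      = pi\<^sup>2 * (complex_of_real (qk e s * qk d (a - s)) - complex_of_real (pk e s * pk d (a - s))
         - \<i> * (complex_of_real (qk e s * pk d (a - s)) + complex_of_real (pk e s * qk d (a - s))))"
    "1 / (complex_of_real s + \<i> * e) * (1 / (complex_of_real (a - s) - \<i> * d))
      = pi\<^sup>2 * (complex_of_real (qk e s * qk d (a - s)) + complex_of_real (pk e s * pk d (a - s))
         + \<i> * (complex_of_real (qk e s * pk d (a - s)) - complex_of_real (pk e s * qk d (a - s))))"
  unfolding cauchy_kernel[OF assms(1)] cauchy_kernel[OF assms(2)]
  by (simp_all add: algebra_simps power2_eq_square)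

lemmas kernel_product_integrable0 = kernel_product_integrable[where b=0, simplified]

lemma cauchy_convolution_integrable:
  fixes e d a :: real
  assumes "e > 0" "d > 0"
  shows "integrable lborel (\<lambda>s. 1 / (complex_of_real s + \<i> * e) * (1 / (complex_of_real (a - s) + \<i> * d)))"
    "integrable lborel (\<lambda>s. 1 / (complex_of_real s + \<i> * e) * (1 / (complex_of_real (a - s) - \<i> * d)))"
  unfolding cauchy_kernel_product[OF assms]
  by (intro integrable_mult_right Bochner_Integration.integrable_add Bochner_Integration.integrable_diff
        integrable_of_real kernel_product_integrable0[OF assms]; simp)+

lemma cauchy_shift_nonzero: "e \<noteq> 0 \<Longrightarrow> complex_of_real s + \<i> * complex_of_real e \<noteq> 0"
  by (auto simp: complex_eq_iff)

text \<open>The poles -ie and a + id lie on opposite sides of the real line. Instead of residues,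
  the partial fractions are integrated by principal logarithms: s + ie stays in the upper and s - (a
  + id) in the lower half plane, so neither argument meets the branch cut.\<close>

lemma cauchy_convolution:
  fixes e d a :: real
  assumes e: "e > 0" and d: "d > 0"
  shows "(\<integral>s. 1 / (complex_of_real s + \<i> * e) * (1 / (complex_of_real (a - s) + \<i> * d)) \<partial>lborel)
      = - 2 * pi * \<i> / (a + \<i> * (e + d))"
proof -
  define c where "c = complex_of_real a + \<i> * of_real (e + d)"
  have c0: "c \<noteq> 0" using assms cauchy_shift_nonzero[of "e + d" a] by (simp add: c_def)
  define F where "F = (\<lambda>s::real. (Ln (s + \<i> * e) - Ln (s - (a + \<i> * d))) / c)"
  have "(\<integral>s. 1 / (complex_of_real s + \<i> * e) * (1 / (complex_of_real (a - s) + \<i> * d)) \<partial>lborel) = 0 - (2 * pi * \<i> / c)"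
  proof (rule integral_FTC_UNIV[where F=F])
    fix s :: real
    have n1: "complex_of_real s + \<i> * e \<noteq> 0" and n2: "complex_of_real (a - s) + \<i> * d \<noteq> 0"
      and n3: "complex_of_real s - (a + \<i> * d) \<noteq> 0"
      using assms by (auto simp: complex_eq_iff)
    have "(F has_vector_derivative (1 / (complex_of_real s + \<i> * e) - 1 / (s - (a + \<i> * d))) / c) (at s)"
      unfolding F_def
    proof (rule has_vector_derivative_real_field)
      show "((\<lambda>z. (Ln (z + \<i> * e) - Ln (z - (a + \<i> * d))) / c) has_field_derivative
         (1 / (complex_of_real s + \<i> * e) - 1 / (s - (a + \<i> * d))) / c) (at (of_real s))"
        using assms n1 n3 c0
        by (auto intro!: derivative_eq_intros simp: complex_nonpos_Reals_iff divide_inverse)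
    qed
    moreover have "(1 / (complex_of_real s + \<i> * e) - 1 / (s - (a + \<i> * d))) / c
        = 1 / (complex_of_real s + \<i> * e) * (1 / (complex_of_real (a - s) + \<i> * d))"
      using n1 n2 n3 c0 by (simp add: divide_simps) (simp add: c_def algebra_simps)
    ultimately show "(F has_vector_derivative 1 / (complex_of_real s + \<i> * e) * (1 / (complex_of_real (a - s) + \<i> * d))) (at s)"
      by simp
    show "isCont (\<lambda>s. 1 / (complex_of_real s + \<i> * e) * (1 / (complex_of_real (a - s) + \<i> * d))) s"
      using n1 n2 by (intro continuous_intros) auto
  next
    show "(F \<longlongrightarrow> 0) at_top"
      using tendsto_divide[OF Ln_diff_at_top[of "\<i> * e" "- (a + \<i> * d)"] tendsto_const c0]
      by (simp add: F_def algebra_simps)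
    have "((\<lambda>r::real. (Ln (r - \<i> * e) - Ln (r + (a + \<i> * d)) + 2 * pi * \<i>) / c) \<longlongrightarrow> (0 + 2 * pi * \<i>) / c) at_top"
      using Ln_diff_at_top[of "- (\<i> * e)" "a + \<i> * d"] c0 by (intro tendsto_intros) auto
    moreover have "F (- r) = (Ln (r - \<i> * e) - Ln (r + (a + \<i> * d)) + 2 * pi * \<i>) / c" for r :: real
    proof -
      \<comment> \<open>At the left end the arguments of the two logarithms tend to pi and -pi, so
        the logarithms differ by 2 pi i. The whole value of the integral is this boundary
        term.\<close>
      have "Ln (- (r - \<i> * e)) = Ln (r - \<i> * e) + \<i> * pi"
        using e by (subst Ln_minus) (auto simp: complex_eq_iff)
      moreover have "Ln (- (r + (a + \<i> * d))) = Ln (r + (a + \<i> * d)) - \<i> * pi"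
        using d by (subst Ln_minus) (auto simp: complex_eq_iff)
      moreover have "complex_of_real (- r) - (a + \<i> * d) = - (r + (a + \<i> * d))" "complex_of_real (- r) + \<i> * e = - (r - \<i> * e)"
        by simp_all
      ultimately have "F (- r) = (Ln (r - \<i> * e) + \<i> * pi - (Ln (r + (a + \<i> * d)) - \<i> * pi)) / c"
        unfolding F_def by (simp only:)
      then show ?thesis by (simp add: algebra_simps)
    qed
    ultimately show "(F \<longlongrightarrow> 2 * pi * \<i> / c) at_bot"
      by (simp add: filterlim_at_bot_mirror)
  qed (rule cauchy_convolution_integrable[OF assms])
  then show ?thesis by (simp add: c_def)
qed

text \<open>Both poles, -ie and a - id, lie in the lower half plane. The two logarithms now have the
  same limiting argument at the left end, so the boundary terms cancel.\<close>

lemma cauchy_conjugate_convolution: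
  fixes e d a :: real
  assumes e: "e > 0" and d: "d > 0"
  shows "(\<integral>s. 1 / (complex_of_real s + \<i> * e) * (1 / (complex_of_real (a - s) - \<i> * d)) \<partial>lborel) = 0"
proof -
  define c where "c = complex_of_real a + \<i> * of_real (e - d)"
  \<comment> \<open>Partial fractions degenerate exactly when the poles coincide, that is for a = 0
    and d = e. The integrand is then -1/(s + ie)^2, with a rational antiderivative.\<close>
  define F where "F = (\<lambda>s::real. if c = 0 then 1 / (s + \<i> * e) else (Ln (s + \<i> * e) - Ln (s + (\<i> * d - a))) / c)"
  have "(\<integral>s. 1 / (complex_of_real s + \<i> * e) * (1 / (complex_of_real (a - s) - \<i> * d)) \<partial>lborel) = 0 - 0"
  proof (rule integral_FTC_UNIV[where F=F])
    fix s :: real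
    have n1: "complex_of_real s + \<i> * e \<noteq> 0" and n2: "complex_of_real (a - s) - \<i> * d \<noteq> 0"
      and n3: "complex_of_real s + (\<i> * d - a) \<noteq> 0"
      using assms by (auto simp: complex_eq_iff)
    show "(F has_vector_derivative 1 / (complex_of_real s + \<i> * e) * (1 / (complex_of_real (a - s) - \<i> * d))) (at s)"
    proof (cases "c = 0")
      case True
      then have ad: "a = 0" "d = e" by (auto simp: c_def complex_eq_iff)
      have "((\<lambda>s::real. 1 / (s + \<i> * e)) has_vector_derivative - (1 / (s + \<i> * e)^2)) (at s)"
      proof (rule has_vector_derivative_real_field)
        show "((\<lambda>z. 1 / (z + \<i> * e)) has_field_derivative - (1 / (s + \<i> * e)^2)) (at (complex_of_real s))"
          using n1 by (auto intro!: derivative_eq_intros simp: power2_eq_square)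
      qed
      moreover have "- (1 / (s + \<i> * e)^2) = 1 / (complex_of_real s + \<i> * e) * (1 / (complex_of_real (a - s) - \<i> * d))"
        using n1 n2 ad by (simp add: divide_simps) (simp add: algebra_simps power2_eq_square)
      ultimately show ?thesis using True by (simp add: F_def)
    next
      case False
      have "(F has_vector_derivative (1 / (complex_of_real s + \<i> * e) - 1 / (s + (\<i> * d - a))) / c) (at s)"
        unfolding F_def if_not_P[OF False]
      proof (rule has_vector_derivative_real_field)
        show "((\<lambda>z. (Ln (z + \<i> * e) - Ln (z + (\<i> * d - a))) / c) has_field_derivative
           (1 / (complex_of_real s + \<i> * e) - 1 / (s + (\<i> * d - a))) / c) (at (of_real s))"
          using assms n1 n3 False
          by (auto intro!: derivative_eq_intros simp: complex_nonpos_Reals_iff divide_inverse)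
      qed
      moreover have "(1 / (complex_of_real s + \<i> * e) - 1 / (s + (\<i> * d - a))) / c
          = 1 / (complex_of_real s + \<i> * e) * (1 / (complex_of_real (a - s) - \<i> * d))"
        using n1 n2 n3 False by (simp add: divide_simps) (simp add: c_def algebra_simps)
      ultimately show ?thesis by simp
    qed
    show "isCont (\<lambda>s. 1 / (complex_of_real s + \<i> * e) * (1 / (complex_of_real (a - s) - \<i> * d))) s"
      using n1 n2 by (intro continuous_intros) auto
  next
    have inv: "((\<lambda>s::real. 1 / (complex_of_real s + v)) \<longlongrightarrow> 0) at_top" for v
      by (intro tendsto_divide_0[OF tendsto_const] tendsto_add_filterlim_at_infinity'[OF _ tendsto_const]
           filterlim_of_real_at_infinity)
    show "(F \<longlongrightarrow> 0) at_top"
      using tendsto_divide[OF Ln_diff_at_top[of "\<i> * e" "\<i> * d - a"] tendsto_const, of c] inv[of "\<i> * e"]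
      by (cases "c = 0") (simp_all add: F_def)
    have "F (- r) = (if c = 0 then - (1 / (r + (- (\<i> * e)))) else (Ln (r + (- (\<i> * e))) - Ln (r + (a - \<i> * d))) / c)" for r :: real
    proof -
      have "Ln (- (r - \<i> * e)) = Ln (r - \<i> * e) + \<i> * pi"
        using e by (subst Ln_minus) (auto simp: complex_eq_iff)
      moreover have "Ln (- (r + (a - \<i> * d))) = Ln (r + (a - \<i> * d)) + \<i> * pi"
        using d by (subst Ln_minus) (auto simp: complex_eq_iff)
      moreover have "1 / (- complex_of_real r + \<i> * e) = - (1 / (r - \<i> * e))"
        by (metis minus_diff_eq minus_divide_right uminus_add_conv_diff)
      ultimately show ?thesis by (simp add: F_def algebra_simps)
    qed
    then show "(F \<longlongrightarrow> 0) at_bot"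
      unfolding filterlim_at_bot_mirror
      using tendsto_divide[OF Ln_diff_at_top[of "- (\<i> * e)" "a - \<i> * d"] tendsto_const, of c]
        tendsto_minus[OF inv[of "- (\<i> * e)"]]
      by (cases "c = 0") simp_all
  qed (rule cauchy_convolution_integrable[OF assms])
  then show ?thesis by simp
qed

text \<open>The vanishing Cauchy integral gives qq = -pp and qp = pq; the other one gives the values
  of qq - pp and qp + pq. The second identity is the form that "the Hilbert transform squares to
  minus the identity" takes at positive scales.\<close>

lemma pk_qk_convolution:
  fixes e d a :: real
  assumes e: "e > 0" and d: "d > 0"
  shows "(\<integral>s. pk e s * qk d (a - s) \<partial>lborel) = qk (e + d) a"
    and "(\<integral>s. qk e s * qk d (a - s) \<partial>lborel) = - pk (e + d) a"
proof -
  define qq pp qp pq where "qq = (\<integral>s. qk e s * qk d (a - s) \<partial>lborel)"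
    and "pp = (\<integral>s. pk e s * pk d (a - s) \<partial>lborel)" and "qp = (\<integral>s. qk e s * pk d (a - s) \<partial>lborel)"
    and "pq = (\<integral>s. pk e s * qk d (a - s) \<partial>lborel)"
  note defs = qq_def pp_def qp_def pq_def
  have 1: "pi\<^sup>2 * (complex_of_real qq - pp - \<i> * (of_real qp + of_real pq)) = - 2 * pi * \<i> / (a + \<i> * (e + d))"
    unfolding cauchy_convolution[OF assms, of a, symmetric] cauchy_kernel_product[OF assms] defs
    by (simp add: kernel_product_integrable0[OF assms] del: of_real_mult)
  have 2: "pi\<^sup>2 * (complex_of_real qq + pp + \<i> * (of_real qp - of_real pq)) = 0"
    unfolding cauchy_conjugate_convolution[OF assms, of a, symmetric] cauchy_kernel_product[OF assms] defs
    by (simp add: kernel_product_integrable0[OF assms] del: of_real_mult)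
  have "complex_of_real qq + pp + \<i> * (of_real qp - of_real pq) = 0" using 2 by simp
  then have 3: "qq + pp = 0" "qp = pq" by (auto simp: complex_eq_iff)
  have "- 2 * pi * \<i> / (a + \<i> * (e + d)) = (- 2 * pi * \<i>) * (1 / (a + \<i> * complex_of_real (e + d)))"
    by simp
  also have "\<dots> = pi\<^sup>2 * (of_real (- 2 * pk (e + d) a) - \<i> * of_real (2 * qk (e + d) a))"
    using assms by (subst cauchy_kernel) (auto simp: algebra_simps power2_eq_square)
  finally have "complex_of_real qq - pp - \<i> * (of_real qp + of_real pq)
      = of_real (- 2 * pk (e + d) a) - \<i> * of_real (2 * qk (e + d) a)"
    using 1 by simp
  then have "qq - pp = - 2 * pk (e + d) a" "qp + pq = 2 * qk (e + d) a"
    by (auto simp: complex_eq_iff)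
  with 3 show "pq = qk (e + d) a" "qq = - pk (e + d) a" by auto
qed

section \<open>Convolution with the kernels on square-integrable functions\<close>

lemma (in pair_sigma_finite) integrable_pair_mult:
  fixes f :: "'a \<Rightarrow> real" and g :: "'b \<Rightarrow> real"
  assumes f: "integrable M1 f" and g: "integrable M2 g"
  shows "integrable (M1 \<Otimes>\<^sub>M M2) (\<lambda>p. f (fst p) * g (snd p))"
proof -
  have [measurable]: "f \<in> borel_measurable M1" "g \<in> borel_measurable M2" using assms by auto
  show ?thesis
    by (rule Fubini_integrable) (use assms in \<open>auto simp: abs_mult\<close>)
qed

lemma cnj_measurable [measurable]: "cnj \<in> borel_measurable borel"
  by (intro borel_measurable_continuous_onI continuous_intros)

definition Pop :: "real \<Rightarrow> (real \<Rightarrow> real) \<Rightarrow> real \<Rightarrow> real" where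
  "Pop e w t = (\<integral>x. pk e (x - t) * w x \<partial>lborel)"

text \<open>The kernel is taken at x - t, as in T. Since \<open>qk e\<close> is odd, this is minus
  the usual convolution.\<close>

definition Qop :: "real \<Rightarrow> (real \<Rightarrow> complex) \<Rightarrow> real \<Rightarrow> complex" where
  "Qop e u t = (\<integral>x. of_real (qk e (x - t)) * u x \<partial>lborel)"

lemma Pop_measurable [measurable]:
  assumes [measurable]: "w \<in> borel_measurable borel"
  shows "Pop e w \<in> borel_measurable borel"
  unfolding Pop_def by measurable

lemma Qop_measurable [measurable]:
  assumes [measurable]: "u \<in> borel_measurable borel"
  shows "Qop e u \<in> borel_measurable borel"
  unfolding Qop_def by measurable

lemma pk_mult_integrable:
  assumes "e > 0" "integrable lborel w"
  shows "integrable lborel (\<lambda>x. pk e (x - t) * w x)"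
proof (rule Bochner_Integration.integrable_bound)
  show "integrable lborel (\<lambda>x. 1 / (pi * e) * w x)" using assms by simp
  show "(\<lambda>x. pk e (x - t) * w x) \<in> borel_measurable lborel" using assms(2) by measurable
  show "AE x in lborel. norm (pk e (x - t) * w x) \<le> norm (1 / (pi * e) * w x)"
    using pk_le[OF assms(1)] pk_nonneg[OF assms(1)] assms(1)
    by (intro AE_I2) (auto simp: abs_mult intro!: mult_right_mono simp del: times_divide_eq_left)
qed

lemma qk_mult_integrable:
  fixes u :: "real \<Rightarrow> complex"
  assumes "e > 0" "integrable lborel u"
  shows "integrable lborel (\<lambda>x. of_real (qk e (x - t)) * u x)"
proof (rule Bochner_Integration.integrable_bound)
  show "integrable lborel (\<lambda>x. 1 / (pi * e) * norm (u x))" using assms by simp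
  show "(\<lambda>x. of_real (qk e (x - t)) * u x) \<in> borel_measurable lborel" using assms(2) by measurable
  show "AE x in lborel. norm (of_real (qk e (x - t)) * u x) \<le> norm (1 / (pi * e) * norm (u x))"
    using qk_le[OF assms(1)] assms(1)
    by (intro AE_I2) (auto simp: abs_mult norm_mult intro!: mult_right_mono simp del: times_divide_eq_left)
qed

text \<open>This version serves functions known only to be square integrable, such as
  \<open>Qop d u\<close>. It rests on |w| <= 1 + w^2 under a probability density.\<close>

lemma pk_mult_integrable_L2:
  assumes "e > 0" and [measurable]: "w \<in> borel_measurable borel" and "integrable lborel (\<lambda>x. (w x)\<^sup>2)"
  shows "integrable lborel (\<lambda>x. pk e (x - t) * w x)"
proof (rule Bochner_Integration.integrable_bound)
  show "integrable lborel (\<lambda>x. pk e (x - t) + pk e (x - t) * (w x)\<^sup>2)"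
    using pk_shift_integral[OF assms(1)] pk_mult_integrable[OF assms(1,3)] by simp
  show "AE x in lborel. norm (pk e (x - t) * w x) \<le> norm (pk e (x - t) + pk e (x - t) * (w x)\<^sup>2)"
  proof (rule AE_I2)
    fix x
    have "pk e (x - t) * \<bar>w x\<bar> \<le> pk e (x - t) * (1 + (w x)\<^sup>2)"
      using abs_mult_le_squares[of 1 "w x"] pk_nonneg[OF assms(1)] by (intro mult_left_mono) auto
    then show "norm (pk e (x - t) * w x) \<le> norm (pk e (x - t) + pk e (x - t) * (w x)\<^sup>2)"
      using pk_nonneg[OF assms(1), of "x - t"] by (simp add: abs_mult algebra_simps)
  qed
qed simp

lemma Pop_nonneg: "e > 0 \<Longrightarrow> (\<And>x. 0 \<le> w x) \<Longrightarrow> 0 \<le> Pop e w t"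
  unfolding Pop_def by (intro integral_nonneg_AE AE_I2) (auto simp: pk_nonneg)

text \<open>Jensen's inequality for the probability density \<open>pk e (x - t)\<close>, obtained
  from the nonnegativity of the variance of w about its mean c.\<close>

lemma Pop_square_le:
  assumes "e > 0" and [measurable]: "w \<in> borel_measurable borel" and "integrable lborel (\<lambda>x. (w x)\<^sup>2)"
  shows "(Pop e w t)\<^sup>2 \<le> Pop e (\<lambda>x. (w x)\<^sup>2) t"
proof -
  define c where "c = Pop e w t"
  note i = pk_mult_integrable_L2[OF assms, of t] pk_mult_integrable[OF assms(1,3), of t]
    pk_shift_integral[OF assms(1), of t]
  have "0 \<le> (\<integral>x. pk e (x - t) * (w x - c)\<^sup>2 \<partial>lborel)"
    using pk_nonneg[OF assms(1)] by (intro integral_nonneg_AE AE_I2) auto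
  also have "\<dots> = (\<integral>x. pk e (x - t) * (w x)\<^sup>2 - 2 * c * (pk e (x - t) * w x) + c\<^sup>2 * pk e (x - t) \<partial>lborel)"
    by (simp add: power2_diff algebra_simps)
  also have "\<dots> = Pop e (\<lambda>x. (w x)\<^sup>2) t - 2 * c * c + c\<^sup>2"
    using i by (simp add: Pop_def c_def)
  finally show ?thesis by (simp add: c_def power2_eq_square)
qed

lemma pk_pair_integrable:
  assumes "e > 0" "integrable lborel w"
  shows "integrable (lborel \<Otimes>\<^sub>M lborel) (\<lambda>p. pk e (snd p - fst p) * w (fst p))"
    "integrable (lborel \<Otimes>\<^sub>M lborel) (\<lambda>p. pk e (snd p - fst p) * w (snd p))"
proof -
  have [measurable]: "w \<in> borel_measurable borel" using assms(2) by auto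
  have swap_eq: "(\<lambda>(x, y). (\<lambda>p. pk e (snd p - fst p) * w (fst p)) (y, x)) = (\<lambda>p. pk e (snd p - fst p) * w (snd p))"
    by (auto simp: fun_eq_iff pk_sub_commute)
  show *: "integrable (lborel \<Otimes>\<^sub>M lborel) (\<lambda>p. pk e (snd p - fst p) * w (fst p))"
    by (rule lborel_pair.Fubini_integrable)
       (use assms pk_shift_integral[OF assms(1)] pk_nonneg[OF assms(1)] in \<open>auto simp: abs_mult\<close>)
  show "integrable (lborel \<Otimes>\<^sub>M lborel) (\<lambda>p. pk e (snd p - fst p) * w (snd p))"
    unfolding swap_eq[symmetric] by (rule lborel_pair.integrable_product_swap[OF *])
qed

lemma pk_pair_integral:
  assumes "e > 0" "integrable lborel w"
  shows "(\<integral>p. pk e (snd p - fst p) * w (fst p) \<partial>(lborel \<Otimes>\<^sub>M lborel)) = (\<integral>x. w x \<partial>lborel)"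
    "(\<integral>p. pk e (snd p - fst p) * w (snd p) \<partial>(lborel \<Otimes>\<^sub>M lborel)) = (\<integral>x. w x \<partial>lborel)"
proof -
  note i = pk_pair_integrable[OF assms]
  have [measurable]: "w \<in> borel_measurable borel" using assms(2) by auto
  have swap_eq: "(\<lambda>(x, y). (\<lambda>p. pk e (snd p - fst p) * w (fst p)) (y, x)) = (\<lambda>p. pk e (snd p - fst p) * w (snd p))"
    by (auto simp: fun_eq_iff pk_sub_commute)
  show *: "(\<integral>p. pk e (snd p - fst p) * w (fst p) \<partial>(lborel \<Otimes>\<^sub>M lborel)) = (\<integral>x. w x \<partial>lborel)"
    using lborel_pair.integral_fst'[OF i(1)] pk_shift_integral[OF assms(1)] by simp
  show "(\<integral>p. pk e (snd p - fst p) * w (snd p) \<partial>(lborel \<Otimes>\<^sub>M lborel)) = (\<integral>x. w x \<partial>lborel)"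
    unfolding *[symmetric] swap_eq[symmetric] by (rule lborel_pair.integral_product_swap) measurable
qed

lemma Pop_integral:
  assumes "e > 0" "integrable lborel w"
  shows "integrable lborel (Pop e w)" "(\<integral>t. Pop e w t \<partial>lborel) = (\<integral>x. w x \<partial>lborel)"
proof -
  note i = pk_pair_integrable(2)[OF assms]
  show "integrable lborel (Pop e w)"
    using lborel_pair.integrable_fst'[OF i] by (simp add: Pop_def[abs_def])
  show "(\<integral>t. Pop e w t \<partial>lborel) = (\<integral>x. w x \<partial>lborel)"
    using lborel_pair.integral_fst'[OF i] pk_pair_integral(2)[OF assms] by (simp add: Pop_def)
qed

lemma Qop_semigroup:
  assumes e: "e > 0" and d: "d > 0" and u: "integrable lborel u"
  shows "Qop (e + d) u t = (\<integral>y. of_real (pk e (y - t)) * Qop d u y \<partial>lborel)"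
proof -
  have [measurable]: "u \<in> borel_measurable borel" using u by auto
  define f where "f y x = of_real (pk e (y - t) * qk d (x - y)) * u x" for y x
  have [measurable]: "case_prod f \<in> borel_measurable (lborel \<Otimes>\<^sub>M lborel)"
    unfolding f_def by measurable
  have "integrable (lborel \<Otimes>\<^sub>M lborel) (case_prod f)"
  proof (rule Bochner_Integration.integrable_bound)
    have "integrable (lborel \<Otimes>\<^sub>M lborel) (\<lambda>p. pk e (fst p - t) * norm (u (snd p)))"
      by (rule lborel_pair.integrable_pair_mult) (use pk_shift_integral[OF e] u in auto)
    then show "integrable (lborel \<Otimes>\<^sub>M lborel) (\<lambda>p. 1 / (pi * d) * (pk e (fst p - t) * norm (u (snd p))))"
      by (rule integrable_mult_right)
    have "norm (f y x) \<le> norm (1 / (pi * d) * (pk e (y - t) * norm (u x)))" for y x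
    proof -
      have "norm (f y x) = \<bar>qk d (x - y)\<bar> * (pk e (y - t) * norm (u x))"
        using pk_nonneg[OF e, of "y - t"] by (simp add: f_def norm_mult abs_mult)
      also have "\<dots> \<le> 1 / (pi * d) * (pk e (y - t) * norm (u x))"
        using qk_le[OF d, of "x - y"] pk_nonneg[OF e, of "y - t"] by (intro mult_right_mono) auto
      finally show ?thesis unfolding real_norm_def by linarith
    qed
    then show "AE p in lborel \<Otimes>\<^sub>M lborel. norm (case_prod f p) \<le> norm (1 / (pi * d) * (pk e (fst p - t) * norm (u (snd p))))"
      by (simp add: case_prod_beta)
  qed measurable
  then have "(\<integral>x. (\<integral>y. f y x \<partial>lborel) \<partial>lborel) = (\<integral>y. (\<integral>x. f y x \<partial>lborel) \<partial>lborel)"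
    by (rule lborel_pair.Fubini_integral)
  moreover have "(\<integral>x. f y x \<partial>lborel) = of_real (pk e (y - t)) * Qop d u y" for y
    by (simp add: f_def Qop_def mult.assoc)
  moreover have "(\<integral>y. f y x \<partial>lborel) = of_real (qk (e + d) (x - t)) * u x" for x
  proof -
    have "(\<integral>y. pk e (y - t) * qk d (x - y) \<partial>lborel) = (\<integral>s. pk e s * qk d ((x - t) - s) \<partial>lborel)"
      using lborel_integral_real_affine[of 1 "\<lambda>y. pk e (y - t) * qk d (x - y)" t] by (simp add: algebra_simps)
    then have "(\<integral>y. complex_of_real (pk e (y - t) * qk d (x - y)) \<partial>lborel) = of_real (qk (e + d) (x - t))"
      unfolding integral_of_real pk_qk_convolution(1)[OF e d, symmetric] by (simp del: of_real_mult)
    then show ?thesis unfolding f_def by (simp add: integral_mult_left_zero)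
  qed
  ultimately show ?thesis by (simp add: Qop_def)
qed

lemma Qop_norm_le_Pop:
  assumes "e > 0" "d > 0" "integrable lborel u"
  shows "norm (Qop (e + d) u t) \<le> Pop e (\<lambda>y. norm (Qop d u y)) t"
proof -
  have "norm (Qop (e + d) u t) \<le> (\<integral>y. norm (of_real (pk e (y - t)) * Qop d u y) \<partial>lborel)"
    unfolding Qop_semigroup[OF assms] by (rule integral_norm_bound)
  then show ?thesis using pk_nonneg[OF assms(1)] by (simp add: Pop_def norm_mult)
qed

text \<open>Oddness of \<open>qk d\<close> turns the negative convolution square into a positive
  kernel. The last bound is uniform in x and z; it justifies Fubini although \<open>qk d\<close>
  itself is not integrable.\<close>

lemma qk_square_integral:
  assumes d: "d > 0"
  shows "(\<integral>y. qk d (x - y) * qk d (z - y) \<partial>lborel) = pk (2 * d) (z - x)"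
    "integrable lborel (\<lambda>y. qk d (x - y) * qk d (z - y))"
    "(\<integral>y. \<bar>qk d (x - y) * qk d (z - y)\<bar> \<partial>lborel) \<le> 2 / (pi * d)"
proof -
  have m: "qk d (x - y) = - qk d (y - x)" for y by (metis minus_diff_eq qk_minus)
  have "(\<integral>y. qk d (x - y) * qk d (z - y) \<partial>lborel) = - (\<integral>s. qk d s * qk d ((z - x) - s) \<partial>lborel)"
    using lborel_integral_real_affine[of 1 "\<lambda>y. qk d (x - y) * qk d (z - y)" x] by (simp add: algebra_simps)
  then show "(\<integral>y. qk d (x - y) * qk d (z - y) \<partial>lborel) = pk (2 * d) (z - x)"
    using pk_qk_convolution(2)[OF d d, of "z - x"] by (simp add: algebra_simps)
  show i: "integrable lborel (\<lambda>y. qk d (x - y) * qk d (z - y))"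
    using kernel_product_integrable[OF d d, of "qk d" "qk d" x z] unfolding m by simp
  have "(\<integral>y. \<bar>qk d (x - y) * qk d (z - y)\<bar> \<partial>lborel) \<le> (\<integral>y. pk d (x - y) / (pi * d) + pk d (z - y) / (pi * d) \<partial>lborel)"
  proof (rule integral_mono)
    show "\<bar>qk d (x - y) * qk d (z - y)\<bar> \<le> pk d (x - y) / (pi * d) + pk d (z - y) / (pi * d)" for y
      using abs_mult_le_squares[of "qk d (x - y)" "qk d (z - y)"] qk_square_le[OF d, of "x - y"]
        qk_square_le[OF d, of "z - y"] by linarith
  qed (use i pk_shift_integral[OF d] in auto)
  also have "\<dots> = 2 / (pi * d)" using pk_shift_integral[OF d] by simp
  finally show "(\<integral>y. \<bar>qk d (x - y) * qk d (z - y)\<bar> \<partial>lborel) \<le> 2 / (pi * d)" .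
qed

text \<open>Schur's test in its simplest form: |u(x) u(y)| is at most half the sum of the squares,
  and both marginals of the kernel have mass 1.\<close>

lemma pair_sesquilinear_le:
  fixes u :: "real \<Rightarrow> complex"
  assumes e: "e > 0" and [measurable]: "u \<in> borel_measurable borel" and u2: "integrable lborel (\<lambda>x. (norm (u x))\<^sup>2)"
  shows "norm (\<integral>p. of_real (pk e (snd p - fst p)) * (u (fst p) * cnj (u (snd p))) \<partial>(lborel \<Otimes>\<^sub>M lborel))
    \<le> (\<integral>x. (norm (u x))\<^sup>2 \<partial>lborel)"
proof -
  define h where "h p = (pk e (snd p - fst p) * (norm (u (fst p)))\<^sup>2 + pk e (snd p - fst p) * (norm (u (snd p)))\<^sup>2) / 2" for p
  have h: "integrable (lborel \<Otimes>\<^sub>M lborel) h" "(\<integral>p. h p \<partial>(lborel \<Otimes>\<^sub>M lborel)) = (\<integral>x. (norm (u x))\<^sup>2 \<partial>lborel)"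
    unfolding h_def using pk_pair_integrable[OF e u2] pk_pair_integral[OF e u2] by auto
  have b: "norm (of_real (pk e (snd p - fst p)) * (u (fst p) * cnj (u (snd p)))) \<le> h p" for p
  proof -
    have "2 * (norm (u (fst p)) * norm (u (snd p))) \<le> (norm (u (fst p)))\<^sup>2 + (norm (u (snd p)))\<^sup>2"
      using sum_squares_bound[of "norm (u (fst p))" "norm (u (snd p))"] by simp
    from mult_left_mono[OF this pk_nonneg[OF e, of "snd p - fst p"]]
    show ?thesis using pk_nonneg[OF e, of "snd p - fst p"] by (simp add: h_def norm_mult algebra_simps)
  qed
  have "norm (\<integral>p. of_real (pk e (snd p - fst p)) * (u (fst p) * cnj (u (snd p))) \<partial>(lborel \<Otimes>\<^sub>M lborel))
    \<le> (\<integral>p. h p \<partial>(lborel \<Otimes>\<^sub>M lborel))"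
    by (rule Bochner_Integration.integral_norm_bound_integral[OF _ h(1)])
       (use b in \<open>auto intro!: Bochner_Integration.integrable_bound[OF h(1)] order_trans[OF b] simp del: split_paired_All split_paired_all\<close>)
  then show ?thesis using h by simp
qed

text \<open>The square is expanded as a double integral and the output variable y is integrated
  first. The kernel left over is \<open>pk (2 * d)\<close>, to which Schur's test applies; this
  gives contractivity without a Fourier transform.\<close>

lemma Qop_L2_bound:
  assumes d: "d > 0" and u: "integrable lborel u" and u2: "integrable lborel (\<lambda>x. (norm (u x))\<^sup>2)"
  shows "integrable lborel (\<lambda>y. (norm (Qop d u y))\<^sup>2)"
    "(\<integral>y. (norm (Qop d u y))\<^sup>2 \<partial>lborel) \<le> (\<integral>x. (norm (u x))\<^sup>2 \<partial>lborel)"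
proof -
  have [measurable]: "u \<in> borel_measurable borel" using u by auto
  define G where "G p y = of_real (qk d (fst p - y) * qk d (snd p - y)) * (u (fst p) * cnj (u (snd p)))" for p y
  interpret pair_sigma_finite "lborel \<Otimes>\<^sub>M lborel :: (real \<times> real) measure" "lborel :: real measure" ..
  have Gm [measurable]: "case_prod G \<in> borel_measurable ((lborel \<Otimes>\<^sub>M lborel) \<Otimes>\<^sub>M lborel)"
    unfolding G_def by measurable
  have nG: "norm (G p y) = \<bar>qk d (fst p - y) * qk d (snd p - y)\<bar> * (norm (u (fst p)) * norm (u (snd p)))" for p y
    by (simp add: G_def norm_mult abs_mult)
  have Gi: "integrable ((lborel \<Otimes>\<^sub>M lborel) \<Otimes>\<^sub>M lborel) (case_prod G)"
  proof (rule Fubini_integrable)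
    have "integrable (lborel \<Otimes>\<^sub>M lborel) (\<lambda>p. norm (u (fst p)) * norm (u (snd p)))"
      by (rule lborel_pair.integrable_pair_mult) (use u in auto)
    then have *: "integrable (lborel \<Otimes>\<^sub>M lborel) (\<lambda>p. 2 / (pi * d) * (norm (u (fst p)) * norm (u (snd p))))"
      by (rule integrable_mult_right)
    show "integrable (lborel \<Otimes>\<^sub>M lborel) (\<lambda>p. \<integral>y. norm (case_prod G (p, y)) \<partial>lborel)"
    proof (rule Bochner_Integration.integrable_bound[OF *])
      have "(\<integral>y. norm (G p y) \<partial>lborel) \<le> 2 / (pi * d) * (norm (u (fst p)) * norm (u (snd p)))" for p
        unfolding nG using mult_right_mono[OF qk_square_integral(3)[OF d, of "fst p" "snd p"], of "norm (u (fst p)) * norm (u (snd p))"]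
        by (simp add: integral_mult_left_zero)
      then show "AE p in lborel \<Otimes>\<^sub>M lborel. norm (\<integral>y. norm (case_prod G (p, y)) \<partial>lborel) \<le> norm (2 / (pi * d) * (norm (u (fst p)) * norm (u (snd p))))"
        by (intro AE_I2) (simp only: case_prod_conv real_norm_def abs_of_nonneg[OF Bochner_Integration.integral_nonneg[OF norm_ge_zero]] order_trans[OF _ abs_ge_self])
    qed measurable
    show "AE p in lborel \<Otimes>\<^sub>M lborel. integrable lborel (\<lambda>y. case_prod G (p, y))"
      using qk_square_integral(2)[OF d] by (auto simp: G_def simp del: of_real_mult)
  qed simp
  have inner: "(\<integral>p. G p y \<partial>(lborel \<Otimes>\<^sub>M lborel)) = of_real ((norm (Qop d u y))\<^sup>2)" for y
  proof -
    define F where "F x = of_real (qk d (x - y)) * u x" for x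
    have Fi: "integrable lborel F" unfolding F_def by (rule qk_mult_integrable[OF d u])
    then have [measurable]: "F \<in> borel_measurable borel" by auto
    have GF: "G p y = F (fst p) * cnj (F (snd p))" for p by (simp add: G_def F_def)
    have "integrable (lborel \<Otimes>\<^sub>M lborel) (\<lambda>p. F (fst p) * cnj (F (snd p)))"
    proof (rule Bochner_Integration.integrable_bound)
      show "integrable (lborel \<Otimes>\<^sub>M lborel) (\<lambda>p. norm (F (fst p)) * norm (F (snd p)))"
        by (rule lborel_pair.integrable_pair_mult) (use Fi in auto)
    qed (auto simp: norm_mult)
    from lborel_pair.integral_fst'[OF this]
    have "(\<integral>p. G p y \<partial>(lborel \<Otimes>\<^sub>M lborel)) = integral\<^sup>L lborel F * cnj (integral\<^sup>L lborel F)"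
      using Fi by (simp add: GF)
    also have "integral\<^sup>L lborel F = Qop d u y" by (simp add: F_def[abs_def] Qop_def)
    finally show ?thesis by (simp add: complex_norm_square del: of_real_power)
  qed
  have "integrable lborel (\<lambda>y. complex_of_real ((norm (Qop d u y))\<^sup>2))"
    using integrable_snd[OF Gi] unfolding inner .
  then show "integrable lborel (\<lambda>y. (norm (Qop d u y))\<^sup>2)"
    by (simp only: complex_of_real_integrable_eq)
  have "(\<integral>y. complex_of_real ((norm (Qop d u y))\<^sup>2) \<partial>lborel) = (\<integral>p. (\<integral>y. G p y \<partial>lborel) \<partial>(lborel \<Otimes>\<^sub>M lborel))"
    using Fubini_integral[OF Gi] unfolding inner .
  also have "\<dots> = (\<integral>p. of_real (pk (2 * d) (snd p - fst p)) * (u (fst p) * cnj (u (snd p))) \<partial>(lborel \<Otimes>\<^sub>M lborel))"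
    unfolding G_def by (simp add: qk_square_integral(1)[OF d] integral_mult_left_zero integral_of_real del: of_real_mult)
  finally have "norm (complex_of_real (\<integral>y. (norm (Qop d u y))\<^sup>2 \<partial>lborel)) \<le> (\<integral>x. (norm (u x))\<^sup>2 \<partial>lborel)"
    using pair_sesquilinear_le[of "2 * d" u] d u2 by (simp add: integral_of_real del: of_real_power norm_of_real)
  then show "(\<integral>y. (norm (Qop d u y))\<^sup>2 \<partial>lborel) \<le> (\<integral>x. (norm (u x))\<^sup>2 \<partial>lborel)"
    by (simp only: norm_of_real)
qed

section \<open>Maximal inequalities\<close>

text \<open>Dyadic shells: k is the first index with |s| <= 2^k e. For k > 0 minimality gives |s| >
  2^(k-1) e, so s^2 exceeds 4^(k-1) e^2; the lost step is the factor 4.\<close>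

lemma pk_le_layer:
  assumes e: "e > 0"
  shows "\<exists>k. \<bar>s\<bar> \<le> 2 ^ k * e \<and> pk e s \<le> 4 / (pi * e * 4 ^ k)"
proof -
  have ex: "\<exists>k. \<bar>s\<bar> \<le> 2 ^ k * e"
  proof -
    obtain k where "\<bar>s\<bar> / e < 2 ^ k" using real_arch_pow[of 2 "\<bar>s\<bar> / e"] by auto
    then show ?thesis using e by (auto simp: field_simps intro: less_imp_le)
  qed
  define k where "k = (LEAST k. \<bar>s\<bar> \<le> 2 ^ k * e)"
  have k: "\<bar>s\<bar> \<le> 2 ^ k * e" unfolding k_def using ex by (rule LeastI_ex)
  have "pk e s \<le> 4 / (pi * e * 4 ^ k)"
  proof (cases k)
    case 0
    have "1 / (pi * e) \<le> 4 / (pi * e)" using e by (intro divide_right_mono) auto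
    then show ?thesis using pk_le[OF e, of s] 0 by simp
  next
    case (Suc j)
    have "2 ^ j * e < \<bar>s\<bar>"
      using not_less_Least[of j "\<lambda>k. \<bar>s\<bar> \<le> 2 ^ k * e"] Suc unfolding k_def by auto
    then have "(2 ^ j * e)\<^sup>2 \<le> \<bar>s\<bar>\<^sup>2" using e by (intro power_mono) auto
    then have "4 ^ j * e\<^sup>2 \<le> s\<^sup>2 + e\<^sup>2"
      using power_mult[of "2::real" 2 j] power_mult[of "2::real" j 2]
      by (simp add: power_mult_distrib mult.commute add_increasing2)
    then have "pi * (4 ^ j * e\<^sup>2) \<le> pi * (s\<^sup>2 + e\<^sup>2)" by (intro mult_left_mono) auto
    then have "pk e s \<le> e / (pi * (4 ^ j * e\<^sup>2))"
      unfolding pk_def using e by (intro divide_left_mono) (auto intro!: mult_pos_pos sum_squares_pos)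
    also have "\<dots> = 4 / (pi * e * 4 ^ k)" using e Suc by (simp add: power2_eq_square)
    finally show ?thesis .
  qed
  with k show ?thesis by blast
qed

text \<open>The kernel lies below a sum of multiples of ball indicators. The ball of radius 2^k e
  contributes (8 \<mu> / pi) 2^(-k), in total 16 \<mu> / pi, which is rounded up to 6 \<mu> by pi >
  3.\<close>

lemma poisson_le_of_averages:
  fixes w :: "real \<Rightarrow> ennreal"
  assumes e: "e > 0" and [measurable]: "w \<in> borel_measurable borel" and \<mu>: "\<mu> \<ge> 0"
    and avg: "\<And>r. r > 0 \<Longrightarrow> (\<integral>\<^sup>+x. w x * indicator (cball t r) x \<partial>lborel) \<le> ennreal (2 * r * \<mu>)"
  shows "(\<integral>\<^sup>+x. ennreal (pk e (x - t)) * w x \<partial>lborel) \<le> ennreal (6 * \<mu>)"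
proof -
  have [measurable]: "cball t r \<in> sets borel" for r by simp
  define c where "c k = 4 / (pi * e * 4 ^ k)" for k :: nat
  have c0: "c k \<ge> 0" for k using e by (simp add: c_def)
  have "ennreal (pk e (x - t)) * w x \<le> (\<Sum>k. ennreal (c k) * (w x * indicator (cball t (2 ^ k * e)) x))" for x
  proof -
    obtain k where k: "\<bar>x - t\<bar> \<le> 2 ^ k * e" "pk e (x - t) \<le> c k"
      using pk_le_layer[OF e, of "x - t"] unfolding c_def by blast
    have "ennreal (pk e (x - t)) * w x \<le> ennreal (c k) * (w x * indicator (cball t (2 ^ k * e)) x)"
      using k by (auto simp: dist_real_def abs_minus_commute indicator_def intro!: mult_right_mono ennreal_leI)
    also have "\<dots> \<le> (\<Sum>k. ennreal (c k) * (w x * indicator (cball t (2 ^ k * e)) x))"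
      using sum_le_suminf[of "\<lambda>k. ennreal (c k) * (w x * indicator (cball t (2 ^ k * e)) x)" "{k}"] by simp
    finally show ?thesis .
  qed
  then have "(\<integral>\<^sup>+x. ennreal (pk e (x - t)) * w x \<partial>lborel)
    \<le> (\<integral>\<^sup>+x. (\<Sum>k. ennreal (c k) * (w x * indicator (cball t (2 ^ k * e)) x)) \<partial>lborel)"
    by (intro nn_integral_mono)
  also have "\<dots> = (\<Sum>k. ennreal (c k) * (\<integral>\<^sup>+x. w x * indicator (cball t (2 ^ k * e)) x \<partial>lborel))"
    by (simp add: nn_integral_suminf nn_integral_cmult)
  also have "\<dots> \<le> (\<Sum>k. ennreal (8 * \<mu> / pi * (1 / 2) ^ k))"
  proof (rule suminf_le)
    fix k
    have "ennreal (c k) * (\<integral>\<^sup>+x. w x * indicator (cball t (2 ^ k * e)) x \<partial>lborel) \<le> ennreal (c k) * ennreal (2 * (2 ^ k * e) * \<mu>)"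
      using e by (intro mult_left_mono avg) auto
    also have "\<dots> = ennreal (c k * (2 * (2 ^ k * e) * \<mu>))" using c0 by (simp add: ennreal_mult')
    also have "c k * (2 * (2 ^ k * e) * \<mu>) = 8 * \<mu> / pi * (2 ^ k / 4 ^ k)"
      using e by (simp add: c_def)
    also have "(2::real) ^ k / 4 ^ k = (1 / 2) ^ k" by (simp add: power_divide[symmetric])
    finally show "ennreal (c k) * (\<integral>\<^sup>+x. w x * indicator (cball t (2 ^ k * e)) x \<partial>lborel) \<le> ennreal (8 * \<mu> / pi * (1 / 2) ^ k)" .
  qed auto
  also have "\<dots> = ennreal (8 * \<mu> / pi * 2)"
  proof (rule suminf_ennreal_eq)
    show "(\<lambda>k. 8 * \<mu> / pi * (1 / 2) ^ k) sums (8 * \<mu> / pi * 2)"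
      using sums_mult[OF geometric_sums[of "1/2::real"], of "8 * \<mu> / pi"] by simp
  qed (use \<mu> in auto)
  also have "\<dots> \<le> ennreal (6 * \<mu>)"
  proof (rule ennreal_leI)
    have "16 * \<mu> \<le> 6 * \<mu> * pi" using pi_gt3 \<mu> mult_left_mono[of 3 pi "6 * \<mu>"] by linarith
    then show "8 * \<mu> / pi * 2 \<le> 6 * \<mu>" by (simp add: divide_simps)
  qed
  finally show ?thesis .
qed

text \<open>The Hardy-Littlewood inequality. The exceptional set is the union of the enlarged Vitali
  balls rather than a superlevel set; as a countable union of closed balls it is Borel, so
  measurability of the maximal function never arises. The 5 is Vitali's enlargement factor.\<close>

lemma maximal_averages_weak_type:
  fixes w :: "real \<Rightarrow> real"
  assumes w: "integrable lborel w" and w0: "\<And>x. 0 \<le> w x" and \<mu>: "\<mu> > 0"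
  shows "\<exists>Z\<in>sets borel. emeasure lborel Z \<le> ennreal (5 / \<mu> * (\<integral>x. w x \<partial>lborel))
    \<and> (\<forall>t. t \<notin> Z \<longrightarrow> (\<forall>r>0. (\<integral>\<^sup>+x. ennreal (w x) * indicator (cball t r) x \<partial>lborel) \<le> ennreal (2 * r * \<mu>)))"
proof -
  have [measurable]: "w \<in> borel_measurable borel" using w by auto
  define I where "I = (\<integral>x. w x \<partial>lborel)"
  have I: "(\<integral>\<^sup>+x. ennreal (w x) \<partial>lborel) = ennreal I"
    unfolding I_def by (rule nn_integral_eq_integral) (use w w0 in auto)
  define N where "N = density lborel (\<lambda>x. ennreal (w x))"
  have sN [simp]: "sets N = sets borel" by (simp add: N_def)
  have N: "emeasure N A = (\<integral>\<^sup>+x. ennreal (w x) * indicator A x \<partial>lborel)" if "A \<in> sets borel" for A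
    using that unfolding N_def by (simp add: emeasure_density)
  have N_le: "emeasure N A \<le> ennreal I" if "A \<in> sets borel" for A
    unfolding N[OF that] I[symmetric] by (intro nn_integral_mono) (auto simp: indicator_def)
  define K where "K = {(t, r). r > 0 \<and> ennreal (2 * r * \<mu>) < emeasure N (cball t r)}"
  \<comment> \<open>The total mass I bounds the radii of all bad balls, as the covering lemma
    requires.\<close>
  have K: "0 < snd i \<and> snd i \<le> I / (2 * \<mu>)" if "i \<in> K" for i
  proof -
    from that have r: "snd i > 0" "ennreal (2 * snd i * \<mu>) < emeasure N (cball (fst i) (snd i))"
      by (auto simp: K_def)
    then have "ennreal (2 * snd i * \<mu>) < ennreal I" using N_le[of "cball (fst i) (snd i)"] by (auto intro: less_le_trans)
    then have "2 * snd i * \<mu> < I" using r \<mu> by (subst (asm) ennreal_less_iff) auto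
    then show ?thesis using \<mu> r by (simp add: field_simps)
  qed
  obtain C where C: "countable C" "C \<subseteq> K"
    "pairwise (\<lambda>i j. disjnt (cball (fst i) (snd i)) (cball (fst j) (snd j))) C"
    "(\<Union>i\<in>K. cball (fst i) (snd i)) \<subseteq> (\<Union>i\<in>C. cball (fst i) (5 * snd i))"
    by (rule Vitali_covering_lemma_cballs[where S="\<Union>i\<in>K. cball (fst i) (snd i)" and K=K and a=fst and r=snd]) (use K in auto)
  define Z where "Z = (\<Union>i\<in>C. cball (fst i) (5 * snd i))"
  have [measurable]: "cball t r \<in> sets borel" for t r :: real by simp
  have Z [measurable]: "Z \<in> sets borel" unfolding Z_def using C(1) by (intro sets.countable_UN') auto
  have "emeasure lborel Z = (\<integral>\<^sup>+x. indicator Z x \<partial>lborel)" by simp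
  \<comment> \<open>The sum over C is written as an integral against counting measure, so that it
    can be exchanged with the integral over x.\<close>
  also have "\<dots> \<le> (\<integral>\<^sup>+x. (\<integral>\<^sup>+i. indicator (cball (fst i) (5 * snd i)) x \<partial>count_space C) \<partial>lborel)"
  proof (rule nn_integral_mono)
    fix x
    show "indicator Z x \<le> (\<integral>\<^sup>+i. indicator (cball (fst i) (5 * snd i)) x \<partial>count_space C :: ennreal)"
    proof (cases "x \<in> Z")
      case True
      then obtain i where i: "i \<in> C" "x \<in> cball (fst i) (5 * snd i)" by (auto simp: Z_def)
      show ?thesis
        using nn_integral_ge_point[OF i(1), of "\<lambda>i. indicator (cball (fst i) (5 * snd i)) x"] i(2) True by simp
    qed simp
  qed
  also have "\<dots> = (\<integral>\<^sup>+i. (\<integral>\<^sup>+x. indicator (cball (fst i) (5 * snd i)) x \<partial>lborel) \<partial>count_space C)"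
    by (rule nn_integral_count_space_nn_integral) (use C(1) in auto)
  also have "\<dots> \<le> (\<integral>\<^sup>+i. ennreal (5 / \<mu>) * emeasure N (cball (fst i) (snd i)) \<partial>count_space C)"
  proof (rule nn_integral_mono)
    fix i assume "i \<in> space (count_space C)"
    then have r: "snd i > 0" "ennreal (2 * snd i * \<mu>) < emeasure N (cball (fst i) (snd i))"
      using C(2) by (auto simp: K_def)
    have "(\<integral>\<^sup>+x. indicator (cball (fst i) (5 * snd i)) x \<partial>lborel) = ennreal (10 * snd i)"
      using r by (simp add: cball_eq_atLeastAtMost)
    also have "\<dots> = ennreal (5 / \<mu>) * ennreal (2 * snd i * \<mu>)"
      using r \<mu> by (simp add: ennreal_mult[symmetric])
    also have "\<dots> \<le> ennreal (5 / \<mu>) * emeasure N (cball (fst i) (snd i))"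
      using r by (intro mult_left_mono) auto
    finally show "(\<integral>\<^sup>+x. indicator (cball (fst i) (5 * snd i)) x \<partial>lborel) \<le> ennreal (5 / \<mu>) * emeasure N (cball (fst i) (snd i))" .
  qed
  also have "\<dots> = ennreal (5 / \<mu>) * (\<integral>\<^sup>+i. emeasure N (cball (fst i) (snd i)) \<partial>count_space C)"
    by (simp add: nn_integral_cmult)
  also have "(\<integral>\<^sup>+i. emeasure N (cball (fst i) (snd i)) \<partial>count_space C) = emeasure N (\<Union>i\<in>C. cball (fst i) (snd i))"
    by (rule emeasure_UN_countable[symmetric])
       (use C in \<open>auto simp: disjoint_family_on_def pairwise_def disjnt_def\<close>)
  also have "ennreal (5 / \<mu>) * \<dots> \<le> ennreal (5 / \<mu>) * ennreal I"
    using C(1) by (intro mult_left_mono N_le sets.countable_UN') auto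
  also have "\<dots> = ennreal (5 / \<mu> * I)" using \<mu> by (intro ennreal_mult'[symmetric]) simp
  finally have mZ: "emeasure lborel Z \<le> ennreal (5 / \<mu> * I)" .
  have "emeasure N (cball t r) \<le> ennreal (2 * r * \<mu>)" if "t \<notin> Z" "r > 0" for t r
  proof (rule ccontr)
    assume "\<not> ?thesis"
    then have "(t, r) \<in> K" using that by (auto simp: K_def)
    then have "t \<in> (\<Union>i\<in>K. cball (fst i) (snd i))" using that by (intro UN_I[of "(t, r)"]) auto
    then show False using that C(4) unfolding Z_def by blast
  qed
  then show ?thesis
    using mZ Z by (intro bexI[of _ Z]) (auto simp: N[symmetric] I_def)
qed

text \<open>The averages are controlled at level \<alpha>/6 because passing to the Poisson kernel
  costs a factor 6; hence 30 = 5 * 6.\<close>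

lemma Pop_weak_type:
  fixes w :: "real \<Rightarrow> real" and \<alpha> :: real
  assumes w: "integrable lborel w" and w0: "\<And>x. 0 \<le> w x" and \<alpha>: "\<alpha> > 0"
  shows "\<exists>Z\<in>sets borel. emeasure lborel Z \<le> ennreal (30 / \<alpha> * (\<integral>x. w x \<partial>lborel))
    \<and> (\<forall>t. t \<notin> Z \<longrightarrow> (\<forall>e>0. Pop e w t \<le> \<alpha>))"
proof -
  have [measurable]: "w \<in> borel_measurable borel" using w by auto
  obtain Z where Z: "Z \<in> sets borel" "emeasure lborel Z \<le> ennreal (5 / (\<alpha> / 6) * (\<integral>x. w x \<partial>lborel))"
    and avg: "\<And>t r. t \<notin> Z \<Longrightarrow> r > 0 \<Longrightarrow> (\<integral>\<^sup>+x. ennreal (w x) * indicator (cball t r) x \<partial>lborel) \<le> ennreal (2 * r * (\<alpha> / 6))"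
    using maximal_averages_weak_type[OF w w0, of "\<alpha> / 6"] \<alpha> by auto
  have "Pop e w t \<le> \<alpha>" if "t \<notin> Z" "e > 0" for t e
  proof -
    have "ennreal (Pop e w t) = (\<integral>\<^sup>+x. ennreal (pk e (x - t) * w x) \<partial>lborel)"
      unfolding Pop_def using that w0 pk_nonneg pk_mult_integrable[OF that(2) w]
      by (intro nn_integral_eq_integral[symmetric]) auto
    also have "\<dots> = (\<integral>\<^sup>+x. ennreal (pk e (x - t)) * ennreal (w x) \<partial>lborel)"
      using that w0 pk_nonneg by (intro nn_integral_cong) (simp add: ennreal_mult)
    also have "\<dots> \<le> ennreal (6 * (\<alpha> / 6))"
      by (rule poisson_le_of_averages) (use that avg \<alpha> in auto)
    finally show ?thesis using \<alpha> by (simp add: ennreal_le_iff)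
  qed
  then show ?thesis using Z by (intro bexI[of _ Z]) auto
qed

text \<open>The base function \<open>Qop (d n) u\<close> controls only scales above
  \<open>d n\<close>. As \<open>d n\<close> tends to 0 the exceptional sets Z n need not be
  monotone, so they are combined by their set-theoretic lower limit, whose measure is still at most
  B. The weak type bound is applied to squares, hence the level
  \<open>\<alpha>\<^sup>2\<close>.\<close>

lemma Qop_maximal_weak_type:
  fixes \<alpha> :: real
  assumes u: "integrable lborel u" and u2: "integrable lborel (\<lambda>x. (norm (u x))\<^sup>2)" and \<alpha>: "\<alpha> > 0"
  shows "\<exists>Z\<in>sets borel. emeasure lborel Z \<le> ennreal (30 / \<alpha>\<^sup>2 * (\<integral>x. (norm (u x))\<^sup>2 \<partial>lborel))
    \<and> (\<forall>t. t \<notin> Z \<longrightarrow> (\<forall>e>0. norm (Qop e u t) \<le> \<alpha>))"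
proof -
  have [measurable]: "u \<in> borel_measurable borel" using u by auto
  define d where "d n = 1 / real (Suc n)" for n
  have d: "d n > 0" for n by (simp add: d_def)
  define B where "B = ennreal (30 / \<alpha>\<^sup>2 * (\<integral>x. (norm (u x))\<^sup>2 \<partial>lborel))"
  have "\<exists>Z\<in>sets borel. emeasure lborel Z \<le> B \<and> (\<forall>t. t \<notin> Z \<longrightarrow> (\<forall>e>0. norm (Qop (e + d n) u t) \<le> \<alpha>))" for n
  proof -
    let ?w = "\<lambda>y. (norm (Qop (d n) u y))\<^sup>2"
    note w = Qop_L2_bound[OF d u u2, of n]
    have "\<alpha>\<^sup>2 > 0" using \<alpha> by simp
    from Pop_weak_type[OF w(1) zero_le_power2 this]
    obtain Z where Z: "Z \<in> sets borel" "emeasure lborel Z \<le> ennreal (30 / \<alpha>\<^sup>2 * (\<integral>x. ?w x \<partial>lborel))"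
      and Z': "\<forall>t. t \<notin> Z \<longrightarrow> (\<forall>e>0. Pop e ?w t \<le> \<alpha>\<^sup>2)"
      by (elim bexE conjE)
    have "norm (Qop (e + d n) u t) \<le> \<alpha>" if "t \<notin> Z" "e > 0" for t e
    proof -
      have "(norm (Qop (e + d n) u t))\<^sup>2 \<le> (Pop e (\<lambda>y. norm (Qop (d n) u y)) t)\<^sup>2"
        by (rule power_mono[OF Qop_norm_le_Pop[OF that(2) d u]]) simp
      also have "\<dots> \<le> Pop e ?w t" by (rule Pop_square_le[OF that(2) _ w(1)]) simp
      also have "\<dots> \<le> \<alpha>\<^sup>2" using Z' that by simp
      finally show ?thesis by (rule power2_le_imp_le) (use \<alpha> in simp)
    qed
    moreover have "emeasure lborel Z \<le> B"
      unfolding B_def using w(2) \<alpha> by (intro order_trans[OF Z(2)] ennreal_leI mult_left_mono) auto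
    ultimately show ?thesis using Z(1) by (intro bexI[of _ Z]) simp_all
  qed
  then have "\<forall>n. \<exists>Z. Z \<in> sets borel \<and> emeasure lborel Z \<le> B \<and> (\<forall>t. t \<notin> Z \<longrightarrow> (\<forall>e>0. norm (Qop (e + d n) u t) \<le> \<alpha>))"
    by blast
  from choice[OF this] obtain Z where Z_all: "\<forall>n. Z n \<in> sets borel \<and> emeasure lborel (Z n) \<le> B
      \<and> (\<forall>t. t \<notin> Z n \<longrightarrow> (\<forall>e>0. norm (Qop (e + d n) u t) \<le> \<alpha>))" ..
  then have Z [measurable]: "\<And>n. Z n \<in> sets borel" and mZ: "\<And>n. emeasure lborel (Z n) \<le> B"
    and nZ: "\<And>n t e. t \<notin> Z n \<Longrightarrow> e > 0 \<Longrightarrow> norm (Qop (e + d n) u t) \<le> \<alpha>"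
    by blast+
  define W where "W n = (\<Inter>m\<in>{n..}. Z m)" for n
  have W: "W n \<in> sets borel" for n unfolding W_def by (rule sets.countable_INT') (auto simp: image_subset_iff Z)
  have W_mono: "W n \<subseteq> W m" if "n \<le> m" for n m
    unfolding W_def by (rule INT_anti_mono) (use that in auto)
  define Y where "Y = (\<Union>n. W n)"
  have Y: "Y \<in> sets borel" unfolding Y_def using W by blast
  have "emeasure lborel Y = (SUP n. emeasure lborel (W n))"
    unfolding Y_def by (rule SUP_emeasure_incseq[symmetric]) (use W W_mono in \<open>auto simp: incseq_def\<close>)
  also have "\<dots> \<le> B"
  proof (rule SUP_least)
    fix n
    have "W n \<subseteq> Z n" by (auto simp: W_def)
    then have "emeasure lborel (W n) \<le> emeasure lborel (Z n)" by (intro emeasure_mono) auto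
    then show "emeasure lborel (W n) \<le> B" using mZ[of n] by simp
  qed
  finally have "emeasure lborel Y \<le> B" .
  moreover have "norm (Qop e u t) \<le> \<alpha>" if tY: "t \<notin> Y" and "e > 0" for t e
  proof -
    \<comment> \<open>A point outside Y avoids Z m for arbitrarily large m, so m can be taken with
      \<open>d m < e\<close>.\<close>
    obtain n where n: "1 / real (Suc n) < e" using \<open>e > 0\<close> nat_approx_posE by blast
    obtain m where m: "m \<ge> n" "t \<notin> Z m" using tY by (auto simp: Y_def W_def)
    have "d m \<le> 1 / real (Suc n)" unfolding d_def using m by (intro divide_left_mono) auto
    then have "e - d m > 0" using n by simp
    from nZ[OF m(2) this] show ?thesis by simp
  qed
  ultimately show ?thesis using Y unfolding B_def by (intro bexI[of _ Y]) simp_all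
qed

section \<open>The truncated Hilbert kernel\<close>

definition hk :: "real \<Rightarrow> real \<Rightarrow> real" where
  "hk e s = (if \<bar>s\<bar> > e then 1 / (pi * s) else 0)"

definition Hop :: "real \<Rightarrow> (real \<Rightarrow> complex) \<Rightarrow> real \<Rightarrow> complex" where
  "Hop e u t = (\<integral>x. of_real (hk e (x - t)) * u x \<partial>lborel)"

lemma hk_measurable [measurable]: "hk e \<in> borel_measurable borel"
  unfolding hk_def[abs_def] by measurable

lemma Hop_measurable [measurable]:
  assumes [measurable]: "u \<in> borel_measurable borel"
  shows "Hop e u \<in> borel_measurable borel"
  unfolding Hop_def by measurable

text \<open>For |s| > e the difference has modulus (e/|s|) pk e s. For |s| <= e only
  \<open>qk e\<close> remains, and there its numerator |s| is at most the numerator e of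
  \<open>pk e\<close>.\<close>

lemma hk_qk_diff_le:
  assumes e: "e > 0"
  shows "\<bar>hk e s - qk e s\<bar> \<le> pk e s"
proof (cases "\<bar>s\<bar> > e")
  case True
  then have s: "s \<noteq> 0" using e by auto
  have p: "s\<^sup>2 + e\<^sup>2 > 0" using sum_squares_pos[OF e] .
  have "hk e s - qk e s = (1 / s - s / (s\<^sup>2 + e\<^sup>2)) / pi" using True by (simp add: hk_def qk_def diff_divide_distrib mult.commute)
  also have "1 / s - s / (s\<^sup>2 + e\<^sup>2) = e\<^sup>2 / (s * (s\<^sup>2 + e\<^sup>2))"
    using s p by (simp add: field_simps power2_eq_square)
  finally have "\<bar>hk e s - qk e s\<bar> = (e / \<bar>s\<bar>) * pk e s"
    using p e by (simp add: abs_mult pk_def power2_eq_square)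
  also have "\<dots> \<le> 1 * pk e s"
    using True e s pk_nonneg[OF e] by (intro mult_right_mono) auto
  finally show ?thesis by simp
next
  case False
  then show ?thesis using e sum_squares_pos[OF e, of s]
    by (auto simp: hk_def qk_def pk_def abs_mult intro!: divide_right_mono)
qed

lemma hk_le: assumes e: "e > 0" shows "\<bar>hk e s\<bar> \<le> 1 / (pi * e)"
proof (cases "\<bar>s\<bar> > e")
  case True
  then have "1 / (pi * \<bar>s\<bar>) \<le> 1 / (pi * e)" using e by (intro divide_left_mono) auto
  then show ?thesis using True by (simp add: hk_def abs_mult)
qed (use e in \<open>simp add: hk_def\<close>)

lemma hk_mult_integrable:
  fixes u :: "real \<Rightarrow> complex"
  assumes "e > 0" "integrable lborel u"
  shows "integrable lborel (\<lambda>x. of_real (hk e (x - t)) * u x)"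
proof (rule Bochner_Integration.integrable_bound)
  show "integrable lborel (\<lambda>x. 1 / (pi * e) * norm (u x))" using assms by simp
  show "(\<lambda>x. of_real (hk e (x - t)) * u x) \<in> borel_measurable lborel" using assms(2) by measurable
  show "AE x in lborel. norm (of_real (hk e (x - t)) * u x) \<le> norm (1 / (pi * e) * norm (u x))"
    using hk_le[OF assms(1)] assms(1)
    by (intro AE_I2) (auto simp: abs_mult norm_mult intro!: mult_right_mono simp del: times_divide_eq_left)
qed

lemma Hop_Qop_diff_le:
  assumes e: "e > 0" and u: "integrable lborel u"
  shows "norm (Hop e u t - Qop e u t) \<le> Pop e (\<lambda>x. norm (u x)) t"
proof -
  have "Hop e u t - Qop e u t = (\<integral>x. of_real (hk e (x - t) - qk e (x - t)) * u x \<partial>lborel)"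
    unfolding Hop_def Qop_def using hk_mult_integrable[OF e u] qk_mult_integrable[OF e u]
    by (simp add: left_diff_distrib)
  also have "norm \<dots> \<le> (\<integral>x. norm (of_real (hk e (x - t) - qk e (x - t)) * u x) \<partial>lborel)"
    by (rule integral_norm_bound)
  also have "\<dots> \<le> Pop e (\<lambda>x. norm (u x)) t"
    unfolding Pop_def
  proof (rule integral_mono)
    have "integrable lborel (\<lambda>x. of_real (hk e (x - t)) * u x - of_real (qk e (x - t)) * u x)"
      using hk_mult_integrable[OF e u] qk_mult_integrable[OF e u] by (rule Bochner_Integration.integrable_diff)
    then show "integrable lborel (\<lambda>x. norm (of_real (hk e (x - t) - qk e (x - t)) * u x))"
      by (simp add: left_diff_distrib)
    show "norm (of_real (hk e (x - t) - qk e (x - t)) * u x) \<le> pk e (x - t) * norm (u x)" for x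
      using hk_qk_diff_le[OF e] unfolding norm_mult norm_of_real by (intro mult_right_mono) auto
  qed (use pk_mult_integrable[OF e integrable_norm[OF u]] in auto)
  finally show ?thesis .
qed

text \<open>The exceptional sets for \<open>Qop\<close> and for the Poisson average of |u|^2 are
  united, which doubles 30 to 60. The Poisson bound stays in the conclusion because the convergence
  of \<open>Pop\<close> also relies on it.\<close>

lemma Hop_maximal_weak_type:
  fixes \<alpha> :: real
  assumes u: "integrable lborel u" and u2: "integrable lborel (\<lambda>x. (norm (u x))\<^sup>2)" and \<alpha>: "\<alpha> > 0"
  shows "\<exists>Z\<in>sets borel. emeasure lborel Z \<le> ennreal (60 / \<alpha>\<^sup>2 * (\<integral>x. (norm (u x))\<^sup>2 \<partial>lborel))
    \<and> (\<forall>t. t \<notin> Z \<longrightarrow> (\<forall>e>0. norm (Hop e u t) \<le> 2 * \<alpha> \<and> Pop e (\<lambda>x. norm (u x)) t \<le> \<alpha>))"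
proof -
  have [measurable]: "u \<in> borel_measurable borel" using u by auto
  define I where "I = (\<integral>x. (norm (u x))\<^sup>2 \<partial>lborel)"
  have I: "I \<ge> 0" by (simp add: I_def)
  obtain Z where Z [measurable]: "Z \<in> sets borel" and mZ: "emeasure lborel Z \<le> ennreal (30 / \<alpha>\<^sup>2 * I)"
    and nZ: "\<And>t e. t \<notin> Z \<Longrightarrow> e > 0 \<Longrightarrow> norm (Qop e u t) \<le> \<alpha>"
    using Qop_maximal_weak_type[OF u u2 \<alpha>] unfolding I_def by auto
  obtain Y where Y [measurable]: "Y \<in> sets borel" and mY: "emeasure lborel Y \<le> ennreal (30 / \<alpha>\<^sup>2 * I)"
    and nY: "\<And>t e. t \<notin> Y \<Longrightarrow> e > 0 \<Longrightarrow> Pop e (\<lambda>x. (norm (u x))\<^sup>2) t \<le> \<alpha>\<^sup>2"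
    using Pop_weak_type[OF u2, of "\<alpha>\<^sup>2"] \<alpha> unfolding I_def by auto
  have P: "Pop e (\<lambda>x. norm (u x)) t \<le> \<alpha>" if "t \<notin> Y" "e > 0" for t e
  proof (rule power2_le_imp_le)
    have "(Pop e (\<lambda>x. norm (u x)) t)\<^sup>2 \<le> Pop e (\<lambda>x. (norm (u x))\<^sup>2) t"
      by (rule Pop_square_le[OF that(2) _ u2]) simp
    then show "(Pop e (\<lambda>x. norm (u x)) t)\<^sup>2 \<le> \<alpha>\<^sup>2" using nY[OF that] by linarith
  qed (use \<alpha> in simp)
  have "norm (Hop e u t) \<le> 2 * \<alpha>" if "t \<notin> Z \<union> Y" "e > 0" for t e
    using Hop_Qop_diff_le[OF that(2) u, of t] P[of t e] nZ[of t e] that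
      norm_triangle_sub[of "Hop e u t" "Qop e u t"] by auto
  moreover have "emeasure lborel (Z \<union> Y) \<le> ennreal (60 / \<alpha>\<^sup>2 * I)"
  proof -
    have "emeasure lborel (Z \<union> Y) \<le> ennreal (30 / \<alpha>\<^sup>2 * I) + ennreal (30 / \<alpha>\<^sup>2 * I)"
      by (rule order_trans[OF emeasure_subadditive add_mono[OF mZ mY]]) auto
    also have "\<dots> = ennreal (60 / \<alpha>\<^sup>2 * I)" using I \<alpha> by (simp add: ennreal_plus[symmetric] del: ennreal_plus)
    finally show ?thesis .
  qed
  ultimately show ?thesis using P unfolding I_def by (intro bexI[of _ "Z \<union> Y"]) auto
qed

text \<open>The bound is uniform in e and stated for the nonnegative integral, ready for Fatou's
  lemma. By (a + b)^2 <= 2 a^2 + 2 b^2, the conjugate kernel and the Poisson error account for 2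
  each.\<close>

lemma Hop_L2_bound:
  assumes e: "e > 0" and u: "integrable lborel u" and u2: "integrable lborel (\<lambda>x. (norm (u x))\<^sup>2)"
  shows "(\<integral>\<^sup>+t. ennreal ((norm (Hop e u t))\<^sup>2) \<partial>lborel) \<le> ennreal (4 * (\<integral>x. (norm (u x))\<^sup>2 \<partial>lborel))"
proof -
  have [measurable]: "u \<in> borel_measurable borel" using u by auto
  define I where "I = (\<integral>x. (norm (u x))\<^sup>2 \<partial>lborel)"
  define g where "g t = 2 * (norm (Qop e u t))\<^sup>2 + 2 * Pop e (\<lambda>x. (norm (u x))\<^sup>2) t" for t
  have g0: "0 \<le> g t" for t unfolding g_def using Pop_nonneg[OF e, of "\<lambda>x. (norm (u x))\<^sup>2" t] by simp
  have gi: "integrable lborel g" "(\<integral>t. g t \<partial>lborel) \<le> 4 * I"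
    unfolding g_def using Qop_L2_bound[OF e u u2] Pop_integral[OF e u2] by (auto simp: I_def)
  have "(norm (Hop e u t))\<^sup>2 \<le> g t" for t
  proof -
    let ?a = "norm (Qop e u t)" and ?b = "Pop e (\<lambda>x. norm (u x)) t"
    have "norm (Hop e u t) \<le> ?a + ?b"
      using Hop_Qop_diff_le[OF e u, of t] norm_triangle_sub[of "Hop e u t" "Qop e u t"] by auto
    then have "(norm (Hop e u t))\<^sup>2 \<le> (?a + ?b)\<^sup>2" by (intro power_mono) auto
    also have "\<dots> \<le> 2 * ?a\<^sup>2 + 2 * ?b\<^sup>2" using sum_squares_bound[of ?a ?b] by (simp add: power2_sum)
    also have "?b\<^sup>2 \<le> Pop e (\<lambda>x. (norm (u x))\<^sup>2) t" by (rule Pop_square_le[OF e]) (use u2 in auto)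
    finally show ?thesis by (simp add: g_def)
  qed
  then have "(\<integral>\<^sup>+t. ennreal ((norm (Hop e u t))\<^sup>2) \<partial>lborel) \<le> (\<integral>\<^sup>+t. ennreal (g t) \<partial>lborel)"
    by (intro nn_integral_mono ennreal_leI)
  also have "\<dots> = ennreal (\<integral>t. g t \<partial>lborel)" by (rule nn_integral_eq_integral) (use gi g0 in auto)
  also have "\<dots> \<le> ennreal (4 * I)" using gi by (intro ennreal_leI)
  finally show ?thesis by (simp add: I_def)
qed

section \<open>Almost everywhere convergence\<close>

lemma additive_finite_disjoint_Union:
  fixes V :: "'a set \<Rightarrow> 'b::ab_group_add"
  assumes add: "\<And>A B. A \<in> sets M \<Longrightarrow> B \<in> sets M \<Longrightarrow> A \<inter> B = {} \<Longrightarrow> V (A \<union> B) = V A + V B"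
    and A: "disjoint_family (A :: nat \<Rightarrow> _)" "range A \<subseteq> sets M"
  shows "V (\<Union>k<n. A k) = (\<Sum>k<n. V (A k))"
proof (induction n)
  case 0
  show ?case using add[of "{}" "{}"] by simp
next
  case (Suc n)
  have "A k \<inter> A n = {}" if "k < n" for k using A(1) that by (simp add: disjoint_family_on_def)
  then have "(\<Union>k<n. A k) \<inter> A n = {}" by blast
  then have "V ((\<Union>k<n. A k) \<union> A n) = V (\<Union>k<n. A k) + V (A n)" using A(2) by (intro add) auto
  then show ?case using Suc by (simp add: lessThan_Suc Un_commute)
qed

text \<open>The sets \<open>A\<close> satisfying the conclusion form a Dynkin system: the maximal
  inequality makes the tails of a countable disjoint union negligible.\<close>

lemma AE_tendsto_zero_of_maximal:
  fixes V :: "'i \<Rightarrow> real set \<Rightarrow> real \<Rightarrow> 'b::real_normed_vector"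
  assumes ev: "eventually (\<lambda>i. i \<in> I) F"
    and add: "\<And>i A B t. i \<in> I \<Longrightarrow> A \<in> sets borel \<Longrightarrow> B \<in> sets borel \<Longrightarrow> A \<inter> B = {} \<Longrightarrow>
      V i ((A \<union> B) \<inter> \<Omega>) t = V i (A \<inter> \<Omega>) t + V i (B \<inter> \<Omega>) t"
    and \<Omega>: "\<Omega> \<in> sets borel" "emeasure lborel \<Omega> < \<infinity>"
    and interval: "\<And>a b. AE t in lborel. ((\<lambda>i. V i ({a<..<b} \<inter> \<Omega>) t) \<longlongrightarrow> 0) F"
    and whole: "AE t in lborel. ((\<lambda>i. V i \<Omega> t) \<longlongrightarrow> 0) F"
    and maximal: "\<And>B \<delta>. B \<in> sets borel \<Longrightarrow> B \<subseteq> \<Omega> \<Longrightarrow> 0 < \<delta> \<Longrightarrow> \<delta> \<le> 1 \<Longrightarrow>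
      \<exists>Z\<in>sets borel. emeasure lborel Z \<le> ennreal (C / \<delta>\<^sup>2 * measure lborel B) \<and>
        (\<forall>t. t \<notin> Z \<longrightarrow> (\<forall>i\<in>I. norm (V i B t) \<le> \<delta>))"
    and A: "A \<in> sets borel"
  shows "AE t in lborel. ((\<lambda>i. V i (A \<inter> \<Omega>) t) \<longlongrightarrow> 0) F"
proof -
  let ?G = "range (\<lambda>(a, b). {a<..<b::real})"
  have "Int_stable ?G"
  proof (rule Int_stableI)
    fix X Y assume "X \<in> ?G" "Y \<in> ?G"
    then obtain a b c d where "X = {a<..<b}" "Y = {c<..<d}" by auto
    then have "X \<inter> Y = (\<lambda>(a, b). {a<..<b}) (max a c, min b d)" by (auto simp: max_def min_def)
    then show "X \<inter> Y \<in> ?G" by blast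
  qed
  moreover have "?G \<subseteq> Pow UNIV" by simp
  moreover have bs: "sets borel = sigma_sets UNIV ?G"
    using arg_cong[OF borel_eq_box[where 'a=real], of sets] by (simp add: sets_measure_of box_real)
  with A have "A \<in> sigma_sets UNIV ?G" by simp
  ultimately show ?thesis
  proof (induction A rule: sigma_sets_induct_disjoint)
    case (basic A)
    then show ?case using interval by auto
  next
    case empty
    have "V i ({} \<inter> \<Omega>) t = 0" if "i \<in> I" for i t using add[OF that, of "{}" "{}"] by simp
    then have "((\<lambda>i. V i ({} \<inter> \<Omega>) t) \<longlongrightarrow> 0) F" for t
      using ev by (intro tendsto_eventually) (auto elim: eventually_mono)
    then show ?case by simp
  next
    case (compl A)
    from compl.IH whole show ?case
    proof eventually_elim
      case (elim t)
      have A: "A \<in> sets borel" using compl.hyps bs by simp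
      have "V i ((UNIV - A) \<inter> \<Omega>) t = V i \<Omega> t - V i (A \<inter> \<Omega>) t" if "i \<in> I" for i
      proof -
        have "(UNIV - A) \<union> A = UNIV" "(UNIV - A) \<inter> A = {}" by auto
        then show ?thesis using add[OF that, of "UNIV - A" A t] A by simp
      qed
      then have "\<forall>\<^sub>F i in F. V i \<Omega> t - V i (A \<inter> \<Omega>) t = V i ((UNIV - A) \<inter> \<Omega>) t"
        using ev by (auto elim: eventually_mono)
      then show ?case
        using tendsto_diff[OF elim(2,1)] by (auto intro: Lim_transform_eventually)
    qed
  next
    case (union A)
    have Am: "A k \<in> sets borel" for k using union.hyps bs by auto
    \<comment> \<open>The tails decrease to the empty set, and the finite measure of \<Omega> makes
      their measures tend to 0.\<close>
    define B where "B n = (\<Union>k\<in>{n..}. A k) \<inter> \<Omega>" for n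
    have B: "B n \<in> sets borel" for n unfolding B_def using Am \<Omega> by (intro sets.Int sets.countable_UN') auto
    have "(\<lambda>n. measure lborel (B n)) \<longlonglongrightarrow> measure lborel (\<Inter>n. B n)"
    proof (rule Lim_measure_decseq)
      have "B n \<subseteq> B m" if "m \<le> n" for m n
        unfolding B_def using that by (intro Int_mono UN_mono) auto
      then show "decseq B" by (simp add: decseq_def)
      have "emeasure lborel (B n) \<le> emeasure lborel \<Omega>" for n using \<Omega> by (intro emeasure_mono) (auto simp: B_def)
      then show "emeasure lborel (B n) \<noteq> \<infinity>" for n using \<Omega>(2) by (metis leD)
    qed (use B in auto)
    moreover have "(\<Inter>n. B n) = {}"
    proof -
      have "x \<notin> (\<Inter>n. B n)" for x
      proof
        assume x: "x \<in> (\<Inter>n. B n)"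
        then obtain j where j: "x \<in> A j" by (auto simp: B_def)
        from x have "x \<in> B (Suc j)" by blast
        then obtain k where "k \<ge> Suc j" "x \<in> A k" by (auto simp: B_def)
        moreover from this union.hyps(1) have "A j \<inter> A k = {}" by (simp add: disjoint_family_on_def)
        ultimately show False using j by blast
      qed
      then show ?thesis by blast
    qed
    ultimately have B0: "(\<lambda>n. measure lborel (B n)) \<longlonglongrightarrow> 0" by simp
    have small: "AE t in lborel. \<exists>n. \<forall>i\<in>I. norm (V i (B n) t) \<le> \<delta>" if \<delta>: "0 < \<delta>" "\<delta> \<le> 1" for \<delta>
    proof -
      have "\<forall>n. \<exists>Z. Z \<in> sets borel \<and> emeasure lborel Z \<le> ennreal (C / \<delta>\<^sup>2 * measure lborel (B n)) \<and>
        (\<forall>t. t \<notin> Z \<longrightarrow> (\<forall>i\<in>I. norm (V i (B n) t) \<le> \<delta>))"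
      proof
        fix n
        have "B n \<subseteq> \<Omega>" by (auto simp: B_def)
        from maximal[OF B this \<delta>] show "\<exists>Z. Z \<in> sets borel \<and> emeasure lborel Z \<le> ennreal (C / \<delta>\<^sup>2 * measure lborel (B n)) \<and>
          (\<forall>t. t \<notin> Z \<longrightarrow> (\<forall>i\<in>I. norm (V i (B n) t) \<le> \<delta>))" by blast
      qed
      from choice[OF this] obtain Z where Z_all: "\<forall>n. Z n \<in> sets borel \<and> emeasure lborel (Z n) \<le> ennreal (C / \<delta>\<^sup>2 * measure lborel (B n)) \<and>
        (\<forall>t. t \<notin> Z n \<longrightarrow> (\<forall>i\<in>I. norm (V i (B n) t) \<le> \<delta>))" ..
      then have Z: "\<And>n. Z n \<in> sets borel" by blast
      \<comment> \<open>N is null, as its measure is below the bound for every tail. A point outside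
        N avoids some Z n, and control of that single tail is enough.\<close>
      define N where "N = (\<Inter>n. Z n)"
      have N: "N \<in> sets borel" unfolding N_def using Z by (intro sets.countable_INT') auto
      have "(\<lambda>n. ennreal (C / \<delta>\<^sup>2 * measure lborel (B n))) \<longlonglongrightarrow> ennreal (C / \<delta>\<^sup>2 * 0)"
        by (intro tendsto_ennrealI tendsto_mult tendsto_const B0)
      moreover have "emeasure lborel N \<le> ennreal (C / \<delta>\<^sup>2 * measure lborel (B n))" for n
      proof -
        have "N \<subseteq> Z n" by (auto simp: N_def)
        then have "emeasure lborel N \<le> emeasure lborel (Z n)" using Z by (intro emeasure_mono) auto
        also have "\<dots> \<le> ennreal (C / \<delta>\<^sup>2 * measure lborel (B n))" using Z_all by blast
        finally show ?thesis .
      qed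
      ultimately have "emeasure lborel N \<le> ennreal (C / \<delta>\<^sup>2 * 0)"
        by (intro LIMSEQ_le_const) auto
      then have "N \<in> null_sets lborel" using N by (auto simp: null_sets_def)
      then have "AE t in lborel. t \<notin> N" by (rule AE_not_in)
      then show ?thesis
      proof eventually_elim
        case (elim t)
        then obtain n where "t \<notin> Z n" by (auto simp: N_def)
        then show ?case using Z_all by blast
      qed
    qed
    \<comment> \<open>Restricting to the countably many levels 1/(m+1) leaves a single null set for
      all tolerances.\<close>
    have "AE t in lborel. \<forall>m. \<exists>n. \<forall>i\<in>I. norm (V i (B n) t) \<le> 1 / real (Suc m)"
      unfolding AE_all_countable by (intro allI small) auto
    moreover have "AE t in lborel. \<forall>k. ((\<lambda>i. V i (A k \<inter> \<Omega>) t) \<longlongrightarrow> 0) F"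
      unfolding AE_all_countable using union.IH by blast
    ultimately show ?case
    proof eventually_elim
      case (elim t)
      show ?case
      proof (rule tendstoI)
        fix \<epsilon> :: real assume \<epsilon>: "\<epsilon> > 0"
        then obtain m where m: "1 / real (Suc m) < \<epsilon> / 2" using nat_approx_posE[of "\<epsilon> / 2"] by auto
        obtain n where n: "\<And>i. i \<in> I \<Longrightarrow> norm (V i (B n) t) \<le> 1 / real (Suc m)" using elim(1) by blast
        have "((\<lambda>i. \<Sum>k<n. V i (A k \<inter> \<Omega>) t) \<longlongrightarrow> (\<Sum>k<n. 0)) F"
          using elim(2) by (intro tendsto_sum) auto
        then have "((\<lambda>i. \<Sum>k<n. V i (A k \<inter> \<Omega>) t) \<longlongrightarrow> 0) F" by simp
        from tendstoD[OF this, of "\<epsilon> / 2"] \<epsilon>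
        have "\<forall>\<^sub>F i in F. norm (\<Sum>k<n. V i (A k \<inter> \<Omega>) t) < \<epsilon> / 2" by simp
        with ev show "\<forall>\<^sub>F i in F. dist (V i ((\<Union>k. A k) \<inter> \<Omega>) t) 0 < \<epsilon>"
        proof eventually_elim
          case (elim i)
          have "V i ((\<Union>k<n. A k) \<inter> \<Omega>) t = (\<Sum>k<n. V i (A k \<inter> \<Omega>) t)"
            using additive_finite_disjoint_Union[of borel "\<lambda>X. V i (X \<inter> \<Omega>) t" A n] add[OF elim(1)] union.hyps(1) Am
            by auto
          moreover have "V i (((\<Union>k<n. A k) \<union> (\<Union>k\<in>{n..}. A k)) \<inter> \<Omega>) t
            = V i ((\<Union>k<n. A k) \<inter> \<Omega>) t + V i ((\<Union>k\<in>{n..}. A k) \<inter> \<Omega>) t"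
          proof (rule add[OF elim(1)])
            have "A j \<inter> A k = {}" if "j < n" "k \<ge> n" for j k
              using union.hyps(1) that by (simp add: disjoint_family_on_def)
            then show "(\<Union>k<n. A k) \<inter> (\<Union>k\<in>{n..}. A k) = {}" by fastforce
          qed (use Am in auto)
          moreover have "(\<Union>k<n. A k) \<union> (\<Union>k\<in>{n..}. A k) = (\<Union>k. A k)"
          proof -
            have "{..<n} \<union> {n..} = (UNIV :: nat set)" by auto
            then show ?thesis by (metis UN_Un)
          qed
          ultimately have "V i ((\<Union>k. A k) \<inter> \<Omega>) t = (\<Sum>k<n. V i (A k \<inter> \<Omega>) t) + V i (B n) t"
            by (simp add: B_def)
          then have "norm (V i ((\<Union>k. A k) \<inter> \<Omega>) t) \<le> norm (\<Sum>k<n. V i (A k \<inter> \<Omega>) t) + norm (V i (B n) t)"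
            by (simp add: norm_triangle_ineq)
          then show ?case using elim(2) n[OF elim(1)] m by simp
        qed
      qed
    qed
  qed
qed

section \<open>Convergence criteria and indicators of intervals\<close>

lemma Cauchy_at_right_imp_tendsto:
  fixes H :: "real \<Rightarrow> complex"
  assumes C: "\<And>\<epsilon>. \<epsilon> > 0 \<Longrightarrow> \<exists>\<delta>>0. \<forall>e e'. 0 < e \<and> e < \<delta> \<and> 0 < e' \<and> e' < \<delta> \<longrightarrow> norm (H e - H e') \<le> \<epsilon>"
  shows "\<exists>l. (H \<longlongrightarrow> l) (at_right 0)"
proof -
  have inv: "\<forall>\<^sub>F n in sequentially. 1 / real (Suc n) < \<delta>" if "\<delta> > 0" for \<delta>
    using order_tendstoD(2)[OF LIMSEQ_inverse_real_of_nat that] by (simp add: inverse_eq_divide)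
  have "Cauchy (\<lambda>n. H (1 / real (Suc n)))"
  proof (rule metric_CauchyI)
    fix \<epsilon> :: real assume "\<epsilon> > 0"
    then obtain \<delta> where \<delta>: "\<delta> > 0" "\<And>e e'. 0 < e \<Longrightarrow> e < \<delta> \<Longrightarrow> 0 < e' \<Longrightarrow> e' < \<delta> \<Longrightarrow> norm (H e - H e') \<le> \<epsilon> / 2"
      using C[of "\<epsilon> / 2"] by auto
    obtain N where "\<And>n. n \<ge> N \<Longrightarrow> 1 / real (Suc n) < \<delta>"
      using inv[OF \<delta>(1)] by (auto simp: eventually_sequentially)
    then have N: "dist (H (1 / real (Suc m))) (H (1 / real (Suc n))) \<le> \<epsilon> / 2" if "m \<ge> N" "n \<ge> N" for m n
      using that \<delta>(2) by (auto simp: dist_norm)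
    then show "\<exists>M. \<forall>m\<ge>M. \<forall>n\<ge>M. dist (H (1 / real (Suc m))) (H (1 / real (Suc n))) < \<epsilon>"
    proof (intro exI[of _ N] allI impI)
      fix m n assume "m \<ge> N" "n \<ge> N"
      from N[OF this] show "dist (H (1 / real (Suc m))) (H (1 / real (Suc n))) < \<epsilon>" using \<open>\<epsilon> > 0\<close> by linarith
    qed
  qed
  then obtain l where l: "(\<lambda>n. H (1 / real (Suc n))) \<longlonglongrightarrow> l" by (auto simp: Cauchy_convergent_iff convergent_def)
  have "(H \<longlongrightarrow> l) (at_right 0)"
  proof (rule tendstoI)
    fix \<epsilon> :: real assume \<epsilon>: "\<epsilon> > 0"
    then obtain \<delta> where \<delta>: "\<delta> > 0" "\<And>e e'. 0 < e \<Longrightarrow> e < \<delta> \<Longrightarrow> 0 < e' \<Longrightarrow> e' < \<delta> \<Longrightarrow> norm (H e - H e') \<le> \<epsilon> / 2"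
      using C[of "\<epsilon> / 2"] by auto
    have "\<forall>\<^sub>F e in at_right 0. 0 < e \<and> e < \<delta>"
      using \<delta>(1) by (auto simp: eventually_at_right_field)
    then show "\<forall>\<^sub>F e in at_right 0. dist (H e) l < \<epsilon>"
    proof eventually_elim
      case (elim e)
      have "(\<lambda>n. norm (H e - H (1 / real (Suc n)))) \<longlonglongrightarrow> norm (H e - l)" by (intro tendsto_intros l)
      moreover have "\<forall>\<^sub>F n in sequentially. norm (H e - H (1 / real (Suc n))) \<le> \<epsilon> / 2"
        using inv[OF \<delta>(1)] by eventually_elim (use \<delta>(2) elim in auto)
      ultimately have "norm (H e - l) \<le> \<epsilon> / 2" by (intro tendsto_upperbound) auto
      then show ?case using \<epsilon> by (simp add: dist_norm)
    qed
  qed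
  then show ?thesis by blast
qed

lemma indicator_interval_locally_constant:
  assumes "t \<noteq> a" "t \<noteq> b"
  obtains \<delta> :: real where "\<delta> > 0" "\<And>x. \<bar>x - t\<bar> < \<delta> \<Longrightarrow> indicator {a<..<b} x = (indicator {a<..<b} t :: 'a::zero_neq_one)"
proof
  show "min \<bar>t - a\<bar> \<bar>t - b\<bar> > 0" using assms by auto
  show "indicator {a<..<b} x = (indicator {a<..<b} t :: 'a)" if "\<bar>x - t\<bar> < min \<bar>t - a\<bar> \<bar>t - b\<bar>" for x
    using that by (auto simp: indicator_def)
qed

lemma finite_interval_indicator_integrable:
  assumes [measurable]: "A \<in> sets borel"
  shows "integrable lborel (\<lambda>x. indicator (A \<inter> {-1<..<1::real}) x :: 'a::{real_normed_algebra_1,second_countable_topology,banach})"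
proof -
  have "integrable lborel (\<lambda>x. indicator (A \<inter> {-1<..<1::real}) x *\<^sub>R (1::'a))"
  proof (rule integrable_indicator)
    have "emeasure lborel (A \<inter> {-1<..<1}) \<le> emeasure lborel {-1<..<1::real}" by (intro emeasure_mono) auto
    also have "\<dots> < \<infinity>" by simp
    finally show "emeasure lborel (A \<inter> {-1<..<1}) < \<infinity>" .
  qed auto
  also have "(\<lambda>x. indicator (A \<inter> {-1<..<1::real}) x *\<^sub>R (1::'a)) = indicator (A \<inter> {-1<..<1::real})"
    by (auto simp: indicator_def)
  finally show ?thesis .
qed

text \<open>The difference of two truncated kernels is odd and lives within distance \<delta> of t,
  where u is constant. Reflection about t makes its integral vanish.\<close>

lemma Hop_interval_eventually_constant:
  fixes u :: "real \<Rightarrow> complex"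
  assumes u: "integrable lborel u" and loc: "\<And>x. \<bar>x - t\<bar> < \<delta> \<Longrightarrow> u x = u t"
    and e: "0 < e" "e < \<delta>" "0 < e'" "e' < \<delta>"
  shows "Hop e u t = Hop e' u t"
proof -
  define h where "h s = hk e s - hk e' s" for s
  have h: "h (- s) = - h s" for s by (auto simp: h_def hk_def)
  have h0: "h s = 0" if "\<bar>s\<bar> \<ge> \<delta>" for s using that e by (auto simp: h_def hk_def)
  have "Hop e u t - Hop e' u t = (\<integral>x. of_real (h (x - t)) * u x \<partial>lborel)"
    unfolding Hop_def h_def using hk_mult_integrable[OF e(1) u] hk_mult_integrable[OF e(3) u]
    by (simp add: left_diff_distrib)
  also have "\<dots> = (\<integral>x. of_real (h (x - t)) * u t \<partial>lborel)"
    using h0 loc by (intro Bochner_Integration.integral_cong refl) (metis linorder_not_less mult_zero_left of_real_0)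
  also have "\<dots> = of_real (\<integral>x. h (x - t) \<partial>lborel) * u t" by (simp add: integral_mult_left_zero)
  also have "(\<integral>x. h (x - t) \<partial>lborel) = 0"
  proof -
    have "(\<integral>x. h (x - t) \<partial>lborel) = (\<integral>x. h (- (x - t)) \<partial>lborel)"
      using lborel_integral_real_affine[of "-1" "\<lambda>x. h (x - t)" "2 * t"] by simp
    then show ?thesis unfolding h by simp
  qed
  finally show ?thesis by simp
qed

text \<open>Near t the factor w x - w t vanishes. At distance at least \<delta>, \<open>pk e\<close>
  is at most e (1 + 1/\<delta>^2) times the fixed probability density \<open>pk 1\<close>, because
  s^2 + 1 <= (1 + 1/\<delta>^2) s^2 there.\<close>

lemma Pop_interval_bound:
  fixes w :: "real \<Rightarrow> real"
  assumes w: "integrable lborel w" and loc: "\<And>x. \<bar>x - t\<bar> < \<delta> \<Longrightarrow> w x = w t" and \<delta>: "\<delta> > 0"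
    and w1: "\<And>x. 0 \<le> w x" "\<And>x. w x \<le> 1" and e: "e > 0"
  shows "\<bar>Pop e w t - w t\<bar> \<le> e * (1 + 1 / \<delta>\<^sup>2)"
proof -
  note i = pk_mult_integrable[OF e w, of t] pk_shift_integral[OF e, of t]
  have b: "\<bar>pk e (x - t) * (w x - w t)\<bar> \<le> e * (1 + 1 / \<delta>\<^sup>2) * pk 1 (x - t)" for x
  proof (cases "\<bar>x - t\<bar> < \<delta>")
    case True
    then show ?thesis using loc[OF True] e \<delta> pk_nonneg[of 1 "x - t"] by (simp add: add_nonneg_pos)
  next
    case False
    define s where "s = x - t"
    have s: "s\<^sup>2 \<ge> \<delta>\<^sup>2" using False \<delta> abs_le_square_iff[of \<delta> s] by (simp add: s_def)
    have s0: "s\<^sup>2 > 0" using s \<delta> by (meson less_le_trans zero_less_power)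
    have "s\<^sup>2 + 1 \<le> (1 + 1 / \<delta>\<^sup>2) * s\<^sup>2"
      using s \<delta> by (simp add: distrib_right)
    then have "e * (s\<^sup>2 + 1) \<le> e * ((1 + 1 / \<delta>\<^sup>2) * (s\<^sup>2 + e\<^sup>2))"
      using e by (intro mult_left_mono order_trans[OF _ mult_left_mono[of "s\<^sup>2" "s\<^sup>2 + e\<^sup>2"]]) auto
    then have "e / (s\<^sup>2 + e\<^sup>2) \<le> e * (1 + 1 / \<delta>\<^sup>2) / (s\<^sup>2 + 1)"
      using s0 by (simp add: frac_le_eq divide_le_eq pos_divide_le_eq pos_le_divide_eq add_pos_nonneg mult.assoc)
    then have pk: "pk e s \<le> e * (1 + 1 / \<delta>\<^sup>2) * pk 1 s"
      using divide_right_mono[of "e / (s\<^sup>2 + e\<^sup>2)" "e * (1 + 1 / \<delta>\<^sup>2) / (s\<^sup>2 + 1)" pi] by (simp add: pk_def mult.commute)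
    have "\<bar>w x - w t\<bar> \<le> 1" using w1(1)[of x] w1(2)[of x] w1(1)[of t] w1(2)[of t] by linarith
    then have "\<bar>pk e (x - t) * (w x - w t)\<bar> \<le> pk e (x - t) * 1"
      unfolding abs_mult using pk_nonneg[OF e, of "x - t"] by (intro mult_mono) auto
    then show ?thesis using pk by (simp add: s_def)
  qed
  have "Pop e w t - w t = (\<integral>x. pk e (x - t) * (w x - w t) \<partial>lborel)"
    using i by (simp add: Pop_def right_diff_distrib)
  also have "\<bar>\<dots>\<bar> \<le> (\<integral>x. \<bar>pk e (x - t) * (w x - w t)\<bar> \<partial>lborel)" by (rule integral_abs_bound)
  also have "\<dots> \<le> (\<integral>x. e * (1 + 1 / \<delta>\<^sup>2) * pk 1 (x - t) \<partial>lborel)"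
    by (rule integral_mono) (use b i pk_shift_integral[of 1 t] in \<open>auto simp: right_diff_distrib\<close>)
  also have "\<dots> = e * (1 + 1 / \<delta>\<^sup>2)" using pk_shift_integral[of 1 t] by simp
  finally show ?thesis .
qed

lemma indicator_measure_integral:
  assumes [measurable]: "B \<in> sets borel" and "B \<subseteq> {-1<..<1::real}"
  shows "integrable lborel (\<lambda>x. indicator B x :: complex)"
    "(\<lambda>x. (norm (indicator B x :: complex))\<^sup>2) = (indicator B :: real \<Rightarrow> real)"
    "(\<lambda>x. norm (indicator B x :: complex)) = (indicator B :: real \<Rightarrow> real)"
    "integrable lborel (indicator B :: real \<Rightarrow> real)"
    "(\<integral>x. indicator B x \<partial>lborel) = measure lborel B"
proof -
  have B: "B \<inter> {-1<..<1} = B" using assms(2) by blast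
  show "integrable lborel (\<lambda>x. indicator B x :: complex)" "integrable lborel (indicator B :: real \<Rightarrow> real)"
    using finite_interval_indicator_integrable[OF assms(1)] unfolding B by auto
  show "(\<integral>x. indicator B x \<partial>lborel) = measure lborel B" using assms(1) by simp
qed (auto simp: indicator_def fun_eq_iff)

lemma Hop_add:
  assumes "e > 0" "integrable lborel u" "integrable lborel v"
  shows "Hop e (\<lambda>x. u x + v x) t = Hop e u t + Hop e v t"
  unfolding Hop_def using hk_mult_integrable[OF assms(1,2)] hk_mult_integrable[OF assms(1,3)]
  by (simp add: distrib_left)

lemma Hop_cmult: "Hop e (\<lambda>x. c * u x) t = c * Hop e u t"
proof -
  have "Hop e (\<lambda>x. c * u x) t = (\<integral>x. c * (of_real (hk e (x - t)) * u x) \<partial>lborel)"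
    unfolding Hop_def by (intro Bochner_Integration.integral_cong) auto
  then show ?thesis unfolding Hop_def by simp
qed

lemma AE_Hop_indicator_convergent:
  assumes A: "A \<in> sets borel"
  shows "AE t in lborel. \<exists>l. ((\<lambda>e. Hop e (indicator (A \<inter> {-1<..<1})) t) \<longlongrightarrow> l) (at_right 0)"
proof -
  let ?\<Omega> = "{-1<..<1::real}"
  define F where "F = at_right (0::real) \<times>\<^sub>F at_right (0::real)"
  define I where "I = {p::real \<times> real. fst p > 0 \<and> snd p > 0}"
  \<comment> \<open>No candidate for the limit is known, so V compares two truncations; convergence
    to 0 along the product filter is the Cauchy condition.\<close>
  define V where "V p B t = Hop (fst p) (indicator B) t - Hop (snd p) (indicator B) t" for p B t
  have pos: "\<forall>\<^sub>F e in at_right (0::real). e > 0" by (simp add: eventually_at_right_less)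
  have interval: "AE t in lborel. ((\<lambda>p. V p ({a<..<b} \<inter> ?\<Omega>) t) \<longlongrightarrow> 0) F" for a b
  proof -
    let ?a = "max a (-1)" and ?b = "min b 1"
    have J: "{a<..<b} \<inter> ?\<Omega> = {?a<..<?b}" by auto
    have "AE t in lborel. t \<noteq> ?a \<and> t \<noteq> ?b"
      by (intro AE_conjI AE_lborel_singleton)
    then show ?thesis
    proof eventually_elim
      case (elim t)
      obtain \<delta> :: real where \<delta>: "\<delta> > 0" "\<And>x. \<bar>x - t\<bar> < \<delta> \<Longrightarrow> indicator {?a<..<?b} x = (indicator {?a<..<?b} t :: complex)"
        using indicator_interval_locally_constant[of t ?a ?b, where 'a=complex] elim by blast
      have i: "integrable lborel (indicator {?a<..<?b} :: real \<Rightarrow> complex)"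
        using J by (intro indicator_measure_integral(1)) auto
      have "\<forall>\<^sub>F e in at_right (0::real). 0 < e \<and> e < \<delta>"
        using \<delta>(1) by (auto simp: eventually_at_right_field)
      then have "\<forall>\<^sub>F p in F. (0 < fst p \<and> fst p < \<delta>) \<and> (0 < snd p \<and> snd p < \<delta>)"
        unfolding F_def eventually_prod_filter by fastforce
      then have "\<forall>\<^sub>F p in F. V p ({a<..<b} \<inter> ?\<Omega>) t = 0"
      proof eventually_elim
        case (elim p)
        have "Hop (fst p) (indicator {?a<..<?b}) t = Hop (snd p) (indicator {?a<..<?b}) t"
          by (rule Hop_interval_eventually_constant[OF i \<delta>(2)]) (use elim in auto)
        then show ?case unfolding J V_def by simp
      qed
      then show ?case by (rule tendsto_eventually)
    qed
  qed
  have "AE t in lborel. ((\<lambda>p. V p (A \<inter> ?\<Omega>) t) \<longlongrightarrow> 0) F"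
  proof (rule AE_tendsto_zero_of_maximal[where I=I and C=960])
    show "\<forall>\<^sub>F p in F. p \<in> I"
      unfolding F_def I_def eventually_prod_filter using pos by auto
    show "V p ((X \<union> Y) \<inter> ?\<Omega>) t = V p (X \<inter> ?\<Omega>) t + V p (Y \<inter> ?\<Omega>) t"
      if "p \<in> I" "X \<in> sets borel" "Y \<in> sets borel" "X \<inter> Y = {}" for p X Y t
    proof -
      have "indicator ((X \<union> Y) \<inter> ?\<Omega>) = (\<lambda>x. indicator (X \<inter> ?\<Omega>) x + indicator (Y \<inter> ?\<Omega>) x :: complex)"
        using that(4) by (auto simp: indicator_def fun_eq_iff)
      then show ?thesis
        using that finite_interval_indicator_integrable[OF that(2), where 'a=complex]
          finite_interval_indicator_integrable[OF that(3), where 'a=complex]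
        by (simp add: V_def Hop_add I_def)
    qed
    show "AE t in lborel. ((\<lambda>p. V p ({a<..<b} \<inter> ?\<Omega>) t) \<longlongrightarrow> 0) F" for a b by (rule interval)
    show "AE t in lborel. ((\<lambda>p. V p ?\<Omega> t) \<longlongrightarrow> 0) F" using interval[of "-1" 1] by simp
    fix B and \<delta> :: real assume B: "B \<in> sets borel" "B \<subseteq> ?\<Omega>" and \<delta>: "0 < \<delta>"
    note Bi = indicator_measure_integral[OF B]
    \<comment> \<open>Each of the two truncations is then at most 2 * (\<delta>/4), so their
      difference is at most \<delta>; hence 960 = 60 * 4^2.\<close>
    have "\<delta> / 4 > 0" using \<delta> by simp
    with Hop_maximal_weak_type[OF Bi(1), of "\<delta> / 4"] Bi
    obtain Z where Z: "Z \<in> sets borel" "emeasure lborel Z \<le> ennreal (60 / (\<delta> / 4)\<^sup>2 * measure lborel B)"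
      and b: "\<And>t e. t \<notin> Z \<Longrightarrow> e > 0 \<Longrightarrow> norm (Hop e (indicator B) t) \<le> 2 * (\<delta> / 4)" by auto
    have c: "60 / (\<delta> / 4)\<^sup>2 = 960 / \<delta>\<^sup>2" using \<delta> by (simp add: power_divide)
    show "\<exists>Z\<in>sets borel. emeasure lborel Z \<le> ennreal (960 / \<delta>\<^sup>2 * measure lborel B) \<and>
        (\<forall>t. t \<notin> Z \<longrightarrow> (\<forall>p\<in>I. norm (V p B t) \<le> \<delta>))"
    proof (intro bexI[of _ Z] conjI allI impI ballI)
      fix t p assume "t \<notin> Z" "p \<in> I"
      then show "norm (V p B t) \<le> \<delta>"
        using b[of t "fst p"] b[of t "snd p"] norm_triangle_ineq4[of "Hop (fst p) (indicator B) t" "Hop (snd p) (indicator B) t"]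
        by (simp add: I_def V_def)
    qed (use Z c in auto)
  qed (use A in auto)
  then show ?thesis
  proof eventually_elim
    case (elim t)
    let ?H = "\<lambda>e. Hop e (indicator (A \<inter> ?\<Omega>)) t"
    show ?case
    proof (rule Cauchy_at_right_imp_tendsto)
      fix \<epsilon> :: real assume "\<epsilon> > 0"
      from tendstoD[OF elim this] have "\<forall>\<^sub>F p in F. norm (?H (fst p) - ?H (snd p)) < \<epsilon>"
        by (simp add: V_def)
      then obtain P Q where PQ: "eventually P (at_right 0)" "eventually Q (at_right 0)"
        "\<And>e e'. P e \<Longrightarrow> Q e' \<Longrightarrow> norm (?H e - ?H e') < \<epsilon>"
        unfolding F_def eventually_prod_filter by auto
      from eventually_conj[OF PQ(1,2)] obtain \<delta> where "\<delta> > 0" "\<And>e. 0 < e \<Longrightarrow> e < \<delta> \<Longrightarrow> P e \<and> Q e"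
        unfolding eventually_at_right_field by auto
      then show "\<exists>\<delta>>0. \<forall>e e'. 0 < e \<and> e < \<delta> \<and> 0 < e' \<and> e' < \<delta> \<longrightarrow> norm (?H e - ?H e') \<le> \<epsilon>"
        using PQ(3) by (intro exI[of _ \<delta>]) (auto intro: less_imp_le)
    qed
  qed
qed

lemma AE_Pop_indicator_tendsto:
  assumes A: "A \<in> sets borel"
  shows "AE t in lborel. ((\<lambda>e. Pop e (indicator (A \<inter> {-1<..<1})) t) \<longlongrightarrow> indicator (A \<inter> {-1<..<1}) t) (at_right 0)"
proof -
  let ?\<Omega> = "{-1<..<1::real}"
  \<comment> \<open>Here the limit is known, so a single scale is compared with the indicator
    itself.\<close>
  define V where "V e B t = Pop e (indicator B) t - indicator B t" for e :: real and B t
  have interval: "AE t in lborel. ((\<lambda>e. V e ({a<..<b} \<inter> ?\<Omega>) t) \<longlongrightarrow> 0) (at_right 0)" for a b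
  proof -
    let ?a = "max a (-1)" and ?b = "min b 1"
    have J: "{a<..<b} \<inter> ?\<Omega> = {?a<..<?b}" by auto
    have "AE t in lborel. t \<noteq> ?a \<and> t \<noteq> ?b"
      by (intro AE_conjI AE_lborel_singleton)
    then show ?thesis
    proof eventually_elim
      case (elim t)
      obtain \<delta> :: real where \<delta>: "\<delta> > 0" "\<And>x. \<bar>x - t\<bar> < \<delta> \<Longrightarrow> indicator {?a<..<?b} x = (indicator {?a<..<?b} t :: real)"
        using indicator_interval_locally_constant[of t ?a ?b, where 'a=real] elim by blast
      have i: "integrable lborel (indicator {?a<..<?b} :: real \<Rightarrow> real)"
        using J by (intro indicator_measure_integral(4)) auto
      have "norm (V e ({a<..<b} \<inter> ?\<Omega>) t) \<le> e * (1 + 1 / \<delta>\<^sup>2)" if "e > 0" for e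
        unfolding J V_def real_norm_def by (rule Pop_interval_bound[OF i \<delta>(2,1) _ _ that]) (auto simp: indicator_def)
      then have ev: "\<forall>\<^sub>F e in at_right 0. norm (V e ({a<..<b} \<inter> ?\<Omega>) t) \<le> e * (1 + 1 / \<delta>\<^sup>2)"
        by (rule eventually_mono[OF eventually_at_right_less[of 0]])
      have "((\<lambda>e::real. e * (1 + 1 / \<delta>\<^sup>2)) \<longlongrightarrow> 0) (at_right 0)"
        by (intro tendsto_mult_left_zero tendsto_ident_at)
      with ev show ?case by (rule Lim_null_comparison)
    qed
  qed
  have "AE t in lborel. ((\<lambda>e. V e (A \<inter> ?\<Omega>) t) \<longlongrightarrow> 0) (at_right 0)"
  proof (rule AE_tendsto_zero_of_maximal[where I="{0<..}" and C=61])
    show "\<forall>\<^sub>F e in at_right 0. e \<in> {0::real<..}" by (simp add: eventually_at_right_less)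
    show "V e ((X \<union> Y) \<inter> ?\<Omega>) t = V e (X \<inter> ?\<Omega>) t + V e (Y \<inter> ?\<Omega>) t"
      if "e \<in> {0<..}" "X \<in> sets borel" "Y \<in> sets borel" "X \<inter> Y = {}" for e X Y t
    proof -
      have "indicator ((X \<union> Y) \<inter> ?\<Omega>) = (\<lambda>x. indicator (X \<inter> ?\<Omega>) x + indicator (Y \<inter> ?\<Omega>) x :: real)"
        using that(4) by (auto simp: indicator_def fun_eq_iff)
      moreover have "e > 0" using that by simp
      ultimately show ?thesis
        using pk_mult_integrable[OF \<open>e > 0\<close> finite_interval_indicator_integrable[OF that(2), where 'a=real], of t]
          pk_mult_integrable[OF \<open>e > 0\<close> finite_interval_indicator_integrable[OF that(3), where 'a=real], of t]
        by (simp add: V_def Pop_def distrib_left)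
    qed
    show "AE t in lborel. ((\<lambda>e. V e ({a<..<b} \<inter> ?\<Omega>) t) \<longlongrightarrow> 0) (at_right 0)" for a b by (rule interval)
    show "AE t in lborel. ((\<lambda>e. V e ?\<Omega> t) \<longlongrightarrow> 0) (at_right 0)" using interval[of "-1" 1] by simp
    fix B and \<delta> :: real assume B: "B \<in> sets borel" "B \<subseteq> ?\<Omega>" and \<delta>: "0 < \<delta>" "\<delta> \<le> 1"
    note Bi = indicator_measure_integral[OF B]
    obtain Z where Z: "Z \<in> sets borel" "emeasure lborel Z \<le> ennreal (60 / \<delta>\<^sup>2 * measure lborel B)"
      and b: "\<And>t e. t \<notin> Z \<Longrightarrow> e > 0 \<Longrightarrow> Pop e (indicator B) t \<le> \<delta>"
      using Hop_maximal_weak_type[OF Bi(1), of \<delta>] Bi \<delta> by auto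
    \<comment> \<open>B joins the exceptional set because the subtracted indicator equals 1 on it.
      Its measure is absorbed into |B|/\<delta>^2, which is where \<delta> <= 1 enters; hence 61 =
      60 + 1.\<close>
    have m: "emeasure lborel (Z \<union> B) \<le> ennreal (61 / \<delta>\<^sup>2 * measure lborel B)"
    proof -
      have "emeasure lborel B \<le> emeasure lborel ?\<Omega>" using B by (intro emeasure_mono) auto
      then have "emeasure lborel B = ennreal (measure lborel B)"
        by (intro emeasure_eq_ennreal_measure) (auto simp: top_unique)
      moreover have "emeasure lborel (Z \<union> B) \<le> emeasure lborel Z + emeasure lborel B"
        using Z B by (intro emeasure_subadditive) auto
      ultimately have "emeasure lborel (Z \<union> B) \<le> ennreal (60 / \<delta>\<^sup>2 * measure lborel B) + ennreal (measure lborel B)"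
        using Z(2) by (metis add_right_mono order_trans)
      also have "\<dots> = ennreal (60 / \<delta>\<^sup>2 * measure lborel B + measure lborel B)"
        using \<delta> by (intro ennreal_plus[symmetric]) auto
      also have "\<dots> \<le> ennreal (61 / \<delta>\<^sup>2 * measure lborel B)"
      proof (rule ennreal_leI)
        have "1 \<le> 1 / \<delta>\<^sup>2" using \<delta> by (simp add: power_le_one)
        from mult_right_mono[OF this measure_nonneg[of lborel B]]
        show "60 / \<delta>\<^sup>2 * measure lborel B + measure lborel B \<le> 61 / \<delta>\<^sup>2 * measure lborel B"
          using times_divide_eq_left[of 60 "\<delta>\<^sup>2" "measure lborel B"] times_divide_eq_left[of 61 "\<delta>\<^sup>2" "measure lborel B"]
          by (simp add: add_divide_distrib[symmetric] divide_simps)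
      qed
      finally show ?thesis .
    qed
    show "\<exists>Z\<in>sets borel. emeasure lborel Z \<le> ennreal (61 / \<delta>\<^sup>2 * measure lborel B) \<and>
        (\<forall>t. t \<notin> Z \<longrightarrow> (\<forall>e\<in>{0<..}. norm (V e B t) \<le> \<delta>))"
    proof (intro bexI[of _ "Z \<union> B"] conjI allI impI ballI)
      fix t and e :: real assume "t \<notin> Z \<union> B" "e \<in> {0<..}"
      then show "norm (V e B t) \<le> \<delta>"
        using b[of t e] Pop_nonneg[of e "indicator B" t] by (simp add: V_def)
    qed (use Z B m in auto)
  qed (use A in auto)
  then show ?thesis
    by eventually_elim (simp add: V_def LIM_zero_iff)
qed

lemma integral_dominated_convergence_at_right:
  fixes s :: "real \<Rightarrow> 'a \<Rightarrow> 'b::{banach, second_countable_topology}"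
  assumes "f \<in> borel_measurable M" "\<And>e. s e \<in> borel_measurable M" "integrable M w"
    and bound: "\<And>e. e > 0 \<Longrightarrow> AE x in M. norm (s e x) \<le> w x"
    and lim: "AE x in M. ((\<lambda>e. s e x) \<longlongrightarrow> f x) (at_right 0)"
  shows "((\<lambda>e. integral\<^sup>L M (s e)) \<longlongrightarrow> integral\<^sup>L M f) (at_right 0)"
  unfolding filterlim_at_right_to_top
proof (rule integral_dominated_convergence_at_top)
  show "\<forall>\<^sub>F e in at_top. AE x in M. norm (s (inverse e) x) \<le> w x"
    using eventually_gt_at_top[of "0::real"] by eventually_elim (simp add: bound)
  show "AE x in M. ((\<lambda>e. s (inverse e) x) \<longlongrightarrow> f x) at_top"
    using lim unfolding filterlim_at_right_to_top .
qed (use assms in auto)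

section \<open>The principal value\<close>

definition PV :: "(real \<Rightarrow> complex) \<Rightarrow> real \<Rightarrow> complex" where
  "PV u t = Lim (at_right 0) (\<lambda>e. Hop e u t)"

text \<open>The value \<open>Lim\<close> takes where the limit does not exist.\<close>

definition divergent_Lim :: complex where
  "divergent_Lim = (THE l. False)"

lemma PV_eqI: "((\<lambda>e. Hop e u t) \<longlongrightarrow> l) (at_right 0) \<Longrightarrow> PV u t = l"
  unfolding PV_def by (rule tendsto_Lim) auto

text \<open>\<open>Lim\<close> is a definite description. Without a limit its predicate is
  identically false, so the default value is one constant for all u and t.\<close>

lemma PV_divergent: "\<nexists>l. ((\<lambda>e. Hop e u t) \<longlongrightarrow> l) (at_right 0) \<Longrightarrow> PV u t = divergent_Lim"
  unfolding PV_def t2_space_class.Lim_def divergent_Lim_def by simp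

text \<open>The strict inequality in \<open>hk\<close> gives pointwise convergence at every s:
  parameters above e exclude |s| = e, exactly as e does.\<close>

lemma Hop_right_continuous:
  assumes e: "e > 0" and u: "integrable lborel u" and X: "X \<longlonglongrightarrow> e" "\<And>n. X n > e"
  shows "(\<lambda>n. Hop (X n) u t) \<longlonglongrightarrow> Hop e u t"
  unfolding Hop_def
proof (rule integral_dominated_convergence)
  have [measurable]: "u \<in> borel_measurable borel" using u by auto
  show "(\<lambda>x. of_real (hk e (x - t)) * u x) \<in> borel_measurable lborel" by measurable
  show "(\<lambda>x. of_real (hk (X n) (x - t)) * u x) \<in> borel_measurable lborel" for n by measurable
  show "integrable lborel (\<lambda>x. 1 / (pi * e) * norm (u x))" using u by simp
  have "(\<lambda>n. hk (X n) s) \<longlonglongrightarrow> hk e s" for s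
  proof (cases "\<bar>s\<bar> > e")
    case True
    have "\<forall>\<^sub>F n in sequentially. hk (X n) s = hk e s"
      using order_tendstoD(2)[OF X(1) True] by eventually_elim (use True in \<open>simp add: hk_def\<close>)
    then show ?thesis by (rule tendsto_eventually)
  next
    case False
    then have "hk (X n) s = hk e s" for n using X(2)[of n] by (simp add: hk_def)
    then show ?thesis by simp
  qed
  then show "AE x in lborel. (\<lambda>n. of_real (hk (X n) (x - t)) * u x) \<longlonglongrightarrow> of_real (hk e (x - t)) * u x"
    by (intro AE_I2 tendsto_mult tendsto_of_real tendsto_const)
  fix n
  have "\<bar>hk (X n) s\<bar> \<le> 1 / (pi * e)" for s
  proof -
    have "\<bar>hk (X n) s\<bar> \<le> 1 / (pi * X n)" using e X(2)[of n] by (intro hk_le) linarith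
    also have "\<dots> \<le> 1 / (pi * e)" using e X(2)[of n] by (intro divide_left_mono) auto
    finally show ?thesis .
  qed
  then show "AE x in lborel. norm (of_real (hk (X n) (x - t)) * u x) \<le> 1 / (pi * e) * norm (u x)"
    unfolding norm_mult norm_of_real by (intro AE_I2 mult_right_mono) auto
qed

text \<open>By right-continuity in the truncation parameter, convergence can be tested on rationals.\<close>

lemma Hop_Cauchy_of_rat:
  assumes u: "integrable lborel u"
    and C: "\<And>p q :: rat. 0 < p \<Longrightarrow> of_rat p < \<delta> \<Longrightarrow> 0 < q \<Longrightarrow> of_rat q < \<delta> \<Longrightarrow>
      norm (Hop (of_rat p) u t - Hop (of_rat q) u t) \<le> \<epsilon>"
    and e: "0 < e" "e < \<delta>" "0 < e'" "e' < \<delta>"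
  shows "norm (Hop e u t - Hop e' u t) \<le> \<epsilon>"
proof -
  have approx: "\<exists>X. (\<lambda>n. of_rat (X n) :: real) \<longlonglongrightarrow> e \<and> (\<forall>n. e < of_rat (X n) \<and> of_rat (X n) < \<delta>)"
    if "e < \<delta>" for e :: real
  proof -
    have "\<forall>n. \<exists>p. e < of_rat p \<and> of_rat p < min \<delta> (e + 1 / real (Suc n))"
      using that by (intro allI of_rat_dense) auto
    from choice[OF this] obtain X where X: "\<And>n. e < of_rat (X n)" "\<And>n. of_rat (X n) < min \<delta> (e + 1 / real (Suc n))"
      by blast
    have "(\<lambda>n. of_rat (X n) :: real) \<longlonglongrightarrow> e"
    proof (rule tendsto_sandwich[where f="\<lambda>_. e" and h="\<lambda>n. e + 1 / real (Suc n)"])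
      show "(\<lambda>n. e + 1 / real (Suc n)) \<longlonglongrightarrow> e"
        using tendsto_add[OF tendsto_const LIMSEQ_inverse_real_of_nat, of e] by (simp add: inverse_eq_divide)
    qed (use X in \<open>auto intro!: always_eventually less_imp_le\<close>)
    then show ?thesis using X by auto
  qed
  obtain X where X: "(\<lambda>n. of_rat (X n) :: real) \<longlonglongrightarrow> e" "\<And>n. e < of_rat (X n)" "\<And>n. of_rat (X n) < \<delta>"
    using approx[OF e(2)] by blast
  obtain Y where Y: "(\<lambda>n. of_rat (Y n) :: real) \<longlonglongrightarrow> e'" "\<And>n. e' < of_rat (Y n)" "\<And>n. of_rat (Y n) < \<delta>"
    using approx[OF e(4)] by blast
  have "(\<lambda>n. norm (Hop (of_rat (X n)) u t - Hop (of_rat (Y n)) u t)) \<longlonglongrightarrow> norm (Hop e u t - Hop e' u t)"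
    by (intro tendsto_intros Hop_right_continuous e u X Y)
  moreover have "norm (Hop (of_rat (X n)) u t - Hop (of_rat (Y n)) u t) \<le> \<epsilon>" for n
  proof (rule C)
    have "(0::real) < of_rat (X n)" "(0::real) < of_rat (Y n)"
      using X(2)[of n] Y(2)[of n] e by linarith+
    then show "0 < X n" "0 < Y n" by simp_all
  qed (use X Y in auto)
  ultimately show ?thesis by (intro LIMSEQ_le_const2) auto
qed

text \<open>The right-hand side quantifies only over naturals and rationals, so the set of points of
  convergence is Borel. This yields measurability of \<open>PV u\<close>.\<close>

lemma Hop_convergent_iff:
  assumes u: "integrable lborel u"
  shows "(\<exists>l. ((\<lambda>e. Hop e u t) \<longlongrightarrow> l) (at_right 0)) \<longleftrightarrow>
    (\<forall>m::nat. \<exists>k::nat. \<forall>p q :: rat. 0 < p \<and> of_rat p < 1 / real (Suc k) \<and> 0 < q \<and> of_rat q < 1 / real (Suc k) \<longrightarrow>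
      norm (Hop (of_rat p) u t - Hop (of_rat q) u t) \<le> 1 / real (Suc m))" (is "?L \<longleftrightarrow> ?R")
proof
  assume ?L
  then obtain l where l: "((\<lambda>e. Hop e u t) \<longlongrightarrow> l) (at_right 0)" ..
  show ?R
  proof
    fix m
    have "0 < 1 / real (Suc m) / 2" by simp
    from tendstoD[OF l this] obtain \<delta> where \<delta>: "\<delta> > 0"
      "\<And>e. 0 < e \<Longrightarrow> e < \<delta> \<Longrightarrow> dist (Hop e u t) l < 1 / real (Suc m) / 2"
      unfolding eventually_at_right_field by auto
    obtain k where k: "1 / real (Suc k) < \<delta>" using nat_approx_posE[OF \<delta>(1)] by blast
    have "norm (Hop (of_rat p) u t - Hop (of_rat q) u t) \<le> 1 / real (Suc m)"
      if "0 < p \<and> of_rat p < 1 / real (Suc k) \<and> 0 < q \<and> of_rat q < 1 / real (Suc k)" for p q :: rat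
    proof -
      have "dist (Hop (of_rat p) u t) l < 1 / real (Suc m) / 2" "dist (Hop (of_rat q) u t) l < 1 / real (Suc m) / 2"
        using that k by (intro \<delta>(2); simp)+
      then show ?thesis
        using dist_triangle2[of "Hop (of_rat p) u t" "Hop (of_rat q) u t" l] unfolding dist_norm by linarith
    qed
    then show "\<exists>k::nat. \<forall>p q :: rat. 0 < p \<and> of_rat p < 1 / real (Suc k) \<and> 0 < q \<and> of_rat q < 1 / real (Suc k) \<longrightarrow>
      norm (Hop (of_rat p) u t - Hop (of_rat q) u t) \<le> 1 / real (Suc m)" by blast
  qed
next
  assume R: ?R
  show ?L
  proof (rule Cauchy_at_right_imp_tendsto)
    fix \<epsilon> :: real assume "\<epsilon> > 0"
    then obtain m where m: "1 / real (Suc m) < \<epsilon>" using nat_approx_posE by blast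
    obtain k where k: "\<And>p q :: rat. 0 < p \<Longrightarrow> of_rat p < 1 / real (Suc k) \<Longrightarrow> 0 < q \<Longrightarrow> of_rat q < 1 / real (Suc k) \<Longrightarrow>
      norm (Hop (of_rat p) u t - Hop (of_rat q) u t) \<le> 1 / real (Suc m)" using R by blast
    have "norm (Hop e u t - Hop e' u t) \<le> \<epsilon>"
      if "0 < e \<and> e < 1 / real (Suc k) \<and> 0 < e' \<and> e' < 1 / real (Suc k)" for e e'
    proof -
      have "norm (Hop e u t - Hop e' u t) \<le> 1 / real (Suc m)"
        by (rule Hop_Cauchy_of_rat[OF u, where \<delta>="1 / real (Suc k)"]) (use k that in blast)+
      then show ?thesis using m by linarith
    qed
    then show "\<exists>\<delta>>0. \<forall>e e'. 0 < e \<and> e < \<delta> \<and> 0 < e' \<and> e' < \<delta> \<longrightarrow> norm (Hop e u t - Hop e' u t) \<le> \<epsilon>"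
      by (intro exI[of _ "1 / real (Suc k)"]) auto
  qed
qed

lemma LIMSEQ_of_at_right:
  assumes "(f \<longlongrightarrow> l) (at_right (0::real))"
  shows "(\<lambda>n. f (1 / real (Suc n))) \<longlonglongrightarrow> l"
proof (rule filterlim_compose[OF assms])
  show "LIM n sequentially. 1 / real (Suc n) :> at_right 0"
    unfolding filterlim_at using LIMSEQ_inverse_real_of_nat by (auto simp: inverse_eq_divide)
qed

lemma PV_cases:
  "(\<lambda>n. Hop (1 / real (Suc n)) u t) \<longlonglongrightarrow> PV u t \<or> PV u t = divergent_Lim"
proof (cases "\<exists>l. ((\<lambda>e. Hop e u t) \<longlongrightarrow> l) (at_right 0)")
  case True
  then obtain l where l: "((\<lambda>e. Hop e u t) \<longlongrightarrow> l) (at_right 0)" ..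
  show ?thesis using LIMSEQ_of_at_right[OF l] PV_eqI[OF l] by simp
qed (simp add: PV_divergent)

lemma PV_measurable:
  assumes u: "integrable lborel u"
  shows "PV u \<in> borel_measurable borel"
proof -
  have [measurable]: "u \<in> borel_measurable borel" using u by auto
  define C where "C = {t. \<forall>m::nat. \<exists>k::nat. \<forall>p q :: rat. 0 < p \<and> of_rat p < 1 / real (Suc k) \<and> 0 < q \<and> of_rat q < 1 / real (Suc k) \<longrightarrow>
      norm (Hop (of_rat p) u t - Hop (of_rat q) u t) \<le> 1 / real (Suc m)}"
  have [measurable]: "C \<in> sets borel" unfolding C_def by measurable
  have "PV u = (\<lambda>t. if t \<in> C then lim (\<lambda>n. Hop (1 / real (Suc n)) u t) else divergent_Lim)"
  proof
    fix t
    show "PV u t = (if t \<in> C then lim (\<lambda>n. Hop (1 / real (Suc n)) u t) else divergent_Lim)"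
    proof (cases "t \<in> C")
      case True
      then obtain l where l: "((\<lambda>e. Hop e u t) \<longlongrightarrow> l) (at_right 0)"
        unfolding C_def mem_Collect_eq Hop_convergent_iff[OF u, symmetric] ..
      show ?thesis using True PV_eqI[OF l] limI[OF LIMSEQ_of_at_right[OF l]] by simp
    next
      case False
      then have "\<nexists>l. ((\<lambda>e. Hop e u t) \<longlongrightarrow> l) (at_right 0)"
        unfolding C_def mem_Collect_eq Hop_convergent_iff[OF u, symmetric] .
      then show ?thesis using False PV_divergent by simp
    qed
  qed
  also have "\<dots> \<in> borel_measurable borel" by measurable
  finally show ?thesis .
qed

text \<open>Where the limit exists, Fatou's lemma along 1/(n+1) applies. Elsewhere the integrand is
  the constant \<open>(norm divergent_Lim)\<^sup>2\<close>, and the factor 2 in the extra term is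
  the length of the interval. No a.e. convergence is assumed, so the bound covers every unimodular
  multiple of phi.\<close>

lemma PV_L2_bound:
  assumes u: "integrable lborel u" and u2: "integrable lborel (\<lambda>x. (norm (u x))\<^sup>2)"
  shows "integrable lborel (\<lambda>t. indicator {-1<..<1} t * (norm (PV u t))\<^sup>2)"
    "(\<integral>t. indicator {-1<..<1} t * (norm (PV u t))\<^sup>2 \<partial>lborel) \<le> 4 * (\<integral>x. (norm (u x))\<^sup>2 \<partial>lborel) + 2 * (norm divergent_Lim)\<^sup>2"
proof -
  have [measurable]: "u \<in> borel_measurable borel" using u by auto
  note [measurable] = PV_measurable[OF u]
  define K where "K = 4 * (\<integral>x. (norm (u x))\<^sup>2 \<partial>lborel)"
  have K: "K \<ge> 0" unfolding K_def by simp
  define h where "h n t = ennreal ((norm (Hop (1 / real (Suc n)) u t))\<^sup>2)" for n t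
  have [measurable]: "h n \<in> borel_measurable borel" for n unfolding h_def[abs_def] by measurable
  define J where "J t = ennreal ((norm divergent_Lim)\<^sup>2) * indicator {-1<..<1::real} t" for t
  have [measurable]: "J \<in> borel_measurable borel" unfolding J_def[abs_def] by measurable
  have "ennreal (indicator {-1<..<1} t * (norm (PV u t))\<^sup>2) \<le> liminf (\<lambda>n. h n t) + J t" for t
    using PV_cases[of u t]
  proof
    assume "(\<lambda>n. Hop (1 / real (Suc n)) u t) \<longlonglongrightarrow> PV u t"
    then have "(\<lambda>n. h n t) \<longlonglongrightarrow> ennreal ((norm (PV u t))\<^sup>2)"
      unfolding h_def by (intro tendsto_intros)
    then have "liminf (\<lambda>n. h n t) = ennreal ((norm (PV u t))\<^sup>2)" by (intro lim_imp_Liminf) auto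
    then show ?thesis by (auto simp: indicator_def J_def add_increasing2)
  next
    assume "PV u t = divergent_Lim"
    then show ?thesis by (auto simp: J_def indicator_def add_increasing)
  qed
  then have "(\<integral>\<^sup>+t. ennreal (indicator {-1<..<1} t * (norm (PV u t))\<^sup>2) \<partial>lborel) \<le> (\<integral>\<^sup>+t. liminf (\<lambda>n. h n t) + J t \<partial>lborel)"
    by (intro nn_integral_mono)
  also have "\<dots> = (\<integral>\<^sup>+t. liminf (\<lambda>n. h n t) \<partial>lborel) + (\<integral>\<^sup>+t. J t \<partial>lborel)"
    by (rule nn_integral_add) measurable
  also have "(\<integral>\<^sup>+t. J t \<partial>lborel) = ennreal (2 * (norm divergent_Lim)\<^sup>2)"
    unfolding J_def by (subst nn_integral_cmult_indicator) (auto simp: ennreal_mult'' mult.commute)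
  also have "(\<integral>\<^sup>+t. liminf (\<lambda>n. h n t) \<partial>lborel) \<le> liminf (\<lambda>n. \<integral>\<^sup>+t. h n t \<partial>lborel)"
    by (rule nn_integral_liminf) measurable
  also have "liminf (\<lambda>n. \<integral>\<^sup>+t. h n t \<partial>lborel) \<le> liminf (\<lambda>n::nat. ennreal K)"
    unfolding h_def K_def by (intro Liminf_mono always_eventually allI Hop_L2_bound u u2) simp
  also have "\<dots> = ennreal K" by (simp add: Liminf_const)
  finally have b: "(\<integral>\<^sup>+t. ennreal (indicator {-1<..<1} t * (norm (PV u t))\<^sup>2) \<partial>lborel) \<le> ennreal (K + 2 * (norm divergent_Lim)\<^sup>2)"
    using K by (simp add: add_mono)
  show i: "integrable lborel (\<lambda>t. indicator {-1<..<1} t * (norm (PV u t))\<^sup>2)"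
    by (rule integrableI_bounded) (use le_less_trans[OF b] in \<open>auto simp: abs_mult\<close>)
  have "ennreal (\<integral>t. indicator {-1<..<1} t * (norm (PV u t))\<^sup>2 \<partial>lborel) \<le> ennreal (K + 2 * (norm divergent_Lim)\<^sup>2)"
    using b by (subst nn_integral_eq_integral[symmetric, OF i]) auto
  then show "(\<integral>t. indicator {-1<..<1} t * (norm (PV u t))\<^sup>2 \<partial>lborel) \<le> 4 * (\<integral>x. (norm (u x))\<^sup>2 \<partial>lborel) + 2 * (norm divergent_Lim)\<^sup>2"
    using K by (subst (asm) ennreal_le_iff) (auto simp: K_def)
qed

lemma finite_hilbert_eq_PV:
  assumes t: "t \<in> {-1<..<1}"
  shows "finite_hilbert f t = PV (\<lambda>x. indicator {-1<..<1} x * f x) t"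
proof -
  have eq: "complex_of_real (1 / pi) * (LINT x:({-1<..<t-e} \<union> {t+e<..<1})|lborel. f x / complex_of_real (x - t))
      = Hop e (\<lambda>x. indicator {-1<..<1} x * f x) t" if "e > 0" for e
  proof -
    have "of_real (1 / pi) * (indicator ({-1<..<t-e} \<union> {t+e<..<1}) x *\<^sub>R (f x / complex_of_real (x - t)))
        = of_real (hk e (x - t)) * (indicator {-1<..<1} x * f x)" for x
      using t that by (auto simp: hk_def indicator_def abs_if split: if_splits)
    then show ?thesis
      unfolding Hop_def set_lebesgue_integral_def by (subst integral_mult_right_zero[symmetric]) presburger
  qed
  have "\<forall>\<^sub>F e in at_right 0. complex_of_real (1 / pi) * (LINT x:({-1<..<t-e} \<union> {t+e<..<1})|lborel. f x / complex_of_real (x - t))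
      = Hop e (\<lambda>x. indicator {-1<..<1} x * f x) t"
    using eq by (rule eventually_mono[OF eventually_at_right_less[of 0]])
  \<comment> \<open>The truncated integrals agree for all e > 0 and so have the same limits.
    \<open>Lim\<close> depends on nothing else, so equality persists even where no limit
    exists.\<close>
  from tendsto_cong[OF this] show ?thesis
    unfolding finite_hilbert_def PV_def t2_space_class.Lim_def by simp
qed

lemma L2norm_finite_hilbert:
  "L2norm (finite_hilbert f) = sqrt (\<integral>t. indicator {-1<..<1} t * (norm (PV (\<lambda>x. indicator {-1<..<1} x * f x) t))\<^sup>2 \<partial>lborel)"
  unfolding L2norm_def set_lebesgue_integral_def
  by (intro arg_cong[where f=sqrt] Bochner_Integration.integral_cong refl)
     (auto simp: indicator_def finite_hilbert_eq_PV)

section \<open>Modulation\<close>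

text \<open>A factor vanishing linearly on the diagonal cancels the singularity. The integrand is
  dominated by (c/pi) |u|, so the limit exists at every t and is an ordinary integral.\<close>

lemma Hop_weighted_tendsto:
  fixes g :: "real \<Rightarrow> complex"
  assumes u: "integrable lborel u" and [measurable]: "g \<in> borel_measurable borel"
    and g: "\<And>s. norm (g s) \<le> c * \<bar>s\<bar>"
  shows "((\<lambda>e. Hop e (\<lambda>x. g (x - t) * u x) t) \<longlongrightarrow>
    (\<integral>x. g (x - t) / of_real (pi * (x - t)) * u x \<partial>lborel)) (at_right 0)"
  unfolding Hop_def
proof (rule integral_dominated_convergence_at_right)
  have [measurable]: "u \<in> borel_measurable borel" using u by auto
  show "(\<lambda>x. g (x - t) / of_real (pi * (x - t)) * u x) \<in> borel_measurable lborel" by measurable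
  show "(\<lambda>x. of_real (hk e (x - t)) * (g (x - t) * u x)) \<in> borel_measurable lborel" for e by measurable
  show "integrable lborel (\<lambda>x. c / pi * norm (u x))" using u by simp
  have c: "c \<ge> 0" using g[of 1] norm_ge_zero[of "g 1"] by linarith
  fix e :: real assume e: "e > 0"
  have "norm (of_real (hk e s) * g s) \<le> c / pi" for s
  proof (cases "\<bar>s\<bar> > e")
    case True
    then have "norm (of_real (hk e s) * g s) = norm (g s) / (pi * \<bar>s\<bar>)"
      by (simp add: hk_def norm_mult norm_divide abs_mult)
    also have "\<dots> \<le> c * \<bar>s\<bar> / (pi * \<bar>s\<bar>)" using g by (intro divide_right_mono) auto
    also have "\<dots> = c / pi" using True e by simp
    finally show ?thesis .
  qed (use c in \<open>simp add: hk_def\<close>)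
  then show "AE x in lborel. norm (of_real (hk e (x - t)) * (g (x - t) * u x)) \<le> c / pi * norm (u x)"
    unfolding mult.assoc[symmetric] norm_mult[of "_ * _" "u _"] by (intro AE_I2 mult_right_mono) auto
next
  have "((\<lambda>e. of_real (hk e s) * g s) \<longlongrightarrow> g s / of_real (pi * s)) (at_right 0)" for s
  proof (cases "s = 0")
    case False
    have "\<forall>\<^sub>F e in at_right 0. of_real (hk e s) * g s = g s / of_real (pi * s)"
      unfolding eventually_at_right_field using False
      by (intro exI[of _ "\<bar>s\<bar>"]) (auto simp: hk_def)
    then show ?thesis by (rule tendsto_eventually)
  \<comment> \<open>The growth bound forces g 0 = 0, so both sides vanish at s = 0.\<close>
  qed (use g[of 0] in simp)
  then show "AE x in lborel. ((\<lambda>e. of_real (hk e (x - t)) * (g (x - t) * u x)) \<longlongrightarrow> g (x - t) / of_real (pi * (x - t)) * u x) (at_right 0)"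
    unfolding mult.assoc[symmetric] by (intro AE_I2 tendsto_mult tendsto_const)
qed

lemma norm_cis_minus_one_le: "norm (cis s - 1) \<le> \<bar>s\<bar>"
proof -
  have "norm (cis s - 1) = 2 * \<bar>sin (s / 2)\<bar>"
    using dist_exp_i_1[of s] by (simp add: cis_conv_exp dist_norm)
  then show ?thesis using abs_sin_x_le_abs_x[of "s / 2"] by simp
qed

lemma cis_measurable [measurable]: "cis \<in> borel_measurable borel"
  by (intro borel_measurable_continuous_onI continuous_intros)

lemma cis_mult_integrable:
  assumes "integrable lborel u"
  shows "integrable lborel (\<lambda>x. cis (n * x) * u x)"
proof (rule Bochner_Integration.integrable_bound[OF assms])
  have [measurable]: "u \<in> borel_measurable borel" using assms by auto
  show "(\<lambda>x. cis (n * x) * u x) \<in> borel_measurable lborel" by measurable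
qed (simp add: norm_mult)

text \<open>Write cis(nx) = cis(nt) + cis(nt) (cis(n(x - t)) - 1): the second term vanishes linearly
  at x = t. Convergence thus passes from u to every modulation at the same t, and one null set
  serves all frequencies.\<close>

lemma Hop_modulated_convergent:
  assumes u: "integrable lborel u" and l: "((\<lambda>e. Hop e u t) \<longlongrightarrow> l) (at_right 0)"
  shows "\<exists>l'. ((\<lambda>e. Hop e (\<lambda>x. cis (n * x) * u x) t) \<longlongrightarrow> l') (at_right 0)"
proof -
  define g where "g s = cis (n * t) * (cis (n * s) - 1)" for s
  have g: "norm (g s) \<le> \<bar>n\<bar> * \<bar>s\<bar>" for s
    using norm_cis_minus_one_le[of "n * s"] by (simp add: g_def norm_mult abs_mult)
  have [measurable]: "g \<in> borel_measurable borel" unfolding g_def[abs_def] by measurable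
  have gu: "g (x - t) * u x = cis (n * x) * u x - cis (n * t) * u x" for x
  proof -
    have "cis (n * t) * cis (n * (x - t)) = cis (n * x)" by (simp add: cis_mult algebra_simps)
    then show ?thesis by (simp add: g_def algebra_simps)
  qed
  have gi: "integrable lborel (\<lambda>x. g (x - t) * u x)"
    unfolding gu using cis_mult_integrable[OF u] u by (intro Bochner_Integration.integrable_diff) auto
  from Hop_weighted_tendsto[OF u _ g, of t]
  obtain m where m: "((\<lambda>e. Hop e (\<lambda>x. g (x - t) * u x) t) \<longlongrightarrow> m) (at_right 0)" by auto
  have "((\<lambda>e. cis (n * t) * Hop e u t + Hop e (\<lambda>x. g (x - t) * u x) t) \<longlongrightarrow> cis (n * t) * l + m) (at_right 0)"
    by (intro tendsto_intros l m)
  moreover have "\<forall>\<^sub>F e in at_right 0. cis (n * t) * Hop e u t + Hop e (\<lambda>x. g (x - t) * u x) t = Hop e (\<lambda>x. cis (n * x) * u x) t"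
  proof (rule eventually_mono[OF eventually_at_right_less[of 0]])
    fix e :: real assume "e > 0"
    then have "Hop e (\<lambda>x. cis (n * t) * u x + g (x - t) * u x) t = cis (n * t) * Hop e u t + Hop e (\<lambda>x. g (x - t) * u x) t"
      using u gi by (subst Hop_add) (auto simp: Hop_cmult)
    then show "cis (n * t) * Hop e u t + Hop e (\<lambda>x. g (x - t) * u x) t = Hop e (\<lambda>x. cis (n * x) * u x) t"
      by (simp add: gu)
  qed
  ultimately show ?thesis by (blast intro: Lim_transform_eventually)
qed

text \<open>The value at 0 is the continuous extension, not the 0 that division by zero would give;
  this keeps the average over n correct at s = 0.\<close>

definition sk :: "real \<Rightarrow> real \<Rightarrow> real" where
  "sk n s = (if s = 0 then n / pi else sin (n * s) / (pi * s))"

lemma sk_le: assumes "n \<ge> 0" shows "\<bar>sk n s\<bar> \<le> n / pi"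
proof (cases "s = 0")
  case False
  have "\<bar>sin (n * s)\<bar> / (pi * \<bar>s\<bar>) \<le> n * \<bar>s\<bar> / (pi * \<bar>s\<bar>)"
    using abs_sin_x_le_abs_x[of "n * s"] assms by (intro divide_right_mono) (auto simp: abs_mult)
  then show ?thesis using False by (simp add: sk_def abs_mult)
qed (use assms in \<open>simp add: sk_def\<close>)

definition Dop :: "real \<Rightarrow> (real \<Rightarrow> complex) \<Rightarrow> real \<Rightarrow> complex" where
  "Dop n u t = (\<integral>x. of_real (sk n (x - t)) * u x \<partial>lborel)"

lemma Dop_measurable [measurable]:
  assumes [measurable]: "u \<in> borel_measurable borel"
  shows "Dop n u \<in> borel_measurable borel"
proof -
  have "(\<lambda>p. sk n (snd p - fst p)) \<in> borel_measurable (borel \<Otimes>\<^sub>M borel)"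
    unfolding sk_def by measurable
  then show ?thesis unfolding Dop_def by measurable
qed

lemma sk_mult_integrable:
  fixes u :: "real \<Rightarrow> complex"
  assumes "n \<ge> 0" "integrable lborel u"
  shows "integrable lborel (\<lambda>x. of_real (sk n (x - t)) * u x)"
proof (rule Bochner_Integration.integrable_bound)
  show "integrable lborel (\<lambda>x. n / pi * norm (u x))" using assms by simp
  have [measurable]: "u \<in> borel_measurable borel" using assms(2) by auto
  have "(\<lambda>x. sk n (x - t)) \<in> borel_measurable borel" unfolding sk_def by measurable
  then show "(\<lambda>x. of_real (sk n (x - t)) * u x) \<in> borel_measurable lborel" by measurable
  show "AE x in lborel. norm (of_real (sk n (x - t)) * u x) \<le> norm (n / pi * norm (u x))"
    using sk_le[OF assms(1)] assms(1)
    by (intro AE_I2) (auto simp: norm_mult abs_mult intro!: mult_right_mono simp del: times_divide_eq_left)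
qed

lemma Dop_norm_le:
  assumes "n \<ge> 0" "integrable lborel u"
  shows "norm (Dop n u t) \<le> n / pi * (\<integral>x. norm (u x) \<partial>lborel)"
proof -
  have "norm (Dop n u t) \<le> (\<integral>x. n / pi * norm (u x) \<partial>lborel)"
    unfolding Dop_def
    by (rule Bochner_Integration.integral_norm_bound_integral[OF sk_mult_integrable[OF assms]])
       (use assms sk_le[OF assms(1)] in \<open>auto simp: norm_mult intro!: mult_right_mono simp del: times_divide_eq_left\<close>)
  then show ?thesis by simp
qed

text \<open>Modulating by \<open>e\<^sup>i\<^sup>n\<^sup>x\<close> and \<open>e\<^sup>-\<^sup>i\<^sup>n\<^sup>x\<close> and taking the difference turns the Hilbert kernel into
  the Dirichlet kernel \<open>sin(ns)/(\<pi>s)\<close>, which is an approximate identity.\<close>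

lemma Dop_eq_modulated_PV:
  assumes u: "integrable lborel u" and l: "((\<lambda>e. Hop e u t) \<longlongrightarrow> l) (at_right 0)"
  shows "2 * \<i> * Dop n u t
    = cis (- (n * t)) * PV (\<lambda>x. cis (n * x) * u x) t - cis (n * t) * PV (\<lambda>x. cis (- n * x) * u x) t"
proof -
  obtain a where a: "((\<lambda>e. Hop e (\<lambda>x. cis (n * x) * u x) t) \<longlongrightarrow> a) (at_right 0)"
    using Hop_modulated_convergent[OF u l] by blast
  obtain b where b: "((\<lambda>e. Hop e (\<lambda>x. cis (- n * x) * u x) t) \<longlongrightarrow> b) (at_right 0)"
    using Hop_modulated_convergent[OF u l] by blast
  define g where "g s = 2 * \<i> * of_real (sin (n * s))" for s
  have g: "norm (g s) \<le> (2 * \<bar>n\<bar>) * \<bar>s\<bar>" for s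
    using abs_sin_x_le_abs_x[of "n * s"] by (simp add: g_def norm_mult abs_mult)
  have gm [measurable]: "g \<in> borel_measurable borel" unfolding g_def[abs_def] by measurable
  have gu: "g (x - t) * u x = cis (- (n * t)) * (cis (n * x) * u x) + (- cis (n * t)) * (cis (- n * x) * u x)" for x
  proof -
    \<comment> \<open>Euler's formula for 2i sin(n(x - t)). The result vanishes linearly at x = t,
      so the weighted limit above applies.\<close>
    have eq: "cis (- (n * t)) * cis (n * x) - cis (n * t) * cis (- n * x) = g (x - t)"
      by (simp add: cis_mult g_def complex_eq_iff cos_diff sin_diff algebra_simps)
    show ?thesis unfolding eq[symmetric] by (simp only: left_diff_distrib mult.assoc mult_minus_left) simp
  qed
  have "((\<lambda>e. cis (- (n * t)) * Hop e (\<lambda>x. cis (n * x) * u x) t + (- cis (n * t)) * Hop e (\<lambda>x. cis (- n * x) * u x) t)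
     \<longlongrightarrow> cis (- (n * t)) * a + (- cis (n * t)) * b) (at_right 0)"
    by (intro tendsto_intros a b)
  moreover have "\<forall>\<^sub>F e in at_right 0. cis (- (n * t)) * Hop e (\<lambda>x. cis (n * x) * u x) t + (- cis (n * t)) * Hop e (\<lambda>x. cis (- n * x) * u x) t
     = Hop e (\<lambda>x. g (x - t) * u x) t"
  proof (rule eventually_mono[OF eventually_at_right_less[of 0]])
    fix e :: real assume e: "e > 0"
    have "integrable lborel (\<lambda>x. cis (- (n * t)) * (cis (n * x) * u x))"
      "integrable lborel (\<lambda>x. (- cis (n * t)) * (cis (- n * x) * u x))"
      by (intro integrable_mult_right cis_mult_integrable u)+
    from Hop_add[OF e this] show "cis (- (n * t)) * Hop e (\<lambda>x. cis (n * x) * u x) t + (- cis (n * t)) * Hop e (\<lambda>x. cis (- n * x) * u x) t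
     = Hop e (\<lambda>x. g (x - t) * u x) t" unfolding gu Hop_cmult by simp
  qed
  ultimately have "((\<lambda>e. Hop e (\<lambda>x. g (x - t) * u x) t) \<longlongrightarrow> cis (- (n * t)) * a + (- cis (n * t)) * b) (at_right 0)"
    by (rule Lim_transform_eventually)
  from tendsto_unique[OF _ Hop_weighted_tendsto[OF u gm g, of t] this]
  have "(\<integral>x. g (x - t) / of_real (pi * (x - t)) * u x \<partial>lborel) = cis (- (n * t)) * a + (- cis (n * t)) * b" by simp
  moreover have "(\<integral>x. g (x - t) / of_real (pi * (x - t)) * u x \<partial>lborel) = (\<integral>x. 2 * \<i> * (of_real (sk n (x - t)) * u x) \<partial>lborel)"
  proof (rule integral_cong_AE)
    have [measurable]: "u \<in> borel_measurable borel" using u by auto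
    show "(\<lambda>x. g (x - t) / of_real (pi * (x - t)) * u x) \<in> borel_measurable lborel" by measurable
    have "(\<lambda>x. sk n (x - t)) \<in> borel_measurable borel" unfolding sk_def by measurable
    then show "(\<lambda>x. 2 * \<i> * (of_real (sk n (x - t)) * u x)) \<in> borel_measurable lborel" by measurable
    \<comment> \<open>At x = t the left side is 0 through division by zero, while
      \<open>sk n 0\<close> is n/pi; the two agree only almost everywhere.\<close>
    have "AE x in lborel. x \<noteq> t" by (rule AE_lborel_singleton)
    then show "AE x in lborel. g (x - t) / of_real (pi * (x - t)) * u x = 2 * \<i> * (of_real (sk n (x - t)) * u x)"
      by eventually_elim (simp add: g_def sk_def)
  qed
  ultimately show ?thesis
    unfolding PV_eqI[OF a] PV_eqI[OF b] Dop_def by simp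
qed

section \<open>The Poisson kernel as an exponential average of Dirichlet kernels\<close>

lemma exp_decay_at_top:
  assumes e: "(e::real) > 0"
  shows "((\<lambda>n. exp (- (e * n))) \<longlongrightarrow> 0) at_top" "((\<lambda>n. n * exp (- (e * n))) \<longlongrightarrow> 0) at_top"
proof -
  have t: "filterlim (\<lambda>n. e * n) at_top at_top"
    using e by (intro filterlim_tendsto_pos_mult_at_top[OF tendsto_const _ filterlim_ident])
  then have "filterlim (\<lambda>n. - (e * n)) at_bot at_top" by (simp add: filterlim_uminus_at_top)
  then show "((\<lambda>n. exp (- (e * n))) \<longlongrightarrow> 0) at_top" by (rule filterlim_compose[OF exp_at_bot])
  have "((\<lambda>n. (e * n) ^ 1 / exp (e * n) / e) \<longlongrightarrow> 0 / e) at_top"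
    using e by (intro tendsto_divide tendsto_const filterlim_compose[OF tendsto_power_div_exp_0 t]) auto
  moreover have "(e * n) ^ 1 / exp (e * n) / e = n * exp (- (e * n))" for n
    using e by (simp add: exp_minus field_simps)
  ultimately show "((\<lambda>n. n * exp (- (e * n))) \<longlongrightarrow> 0) at_top" by simp
qed

text \<open>The weight is the exponential density of mean 1/e. Its first moment is needed because
  the uniform bound n/pi on \<open>sk n\<close> is linear in n.\<close>

lemma exp_weight_integral:
  fixes e :: real
  assumes e: "e > 0"
  shows "integrable lborel (\<lambda>n. indicator {0<..} n * (e * exp (- (e * n))))"
    "(\<integral>n. indicator {0<..} n * (e * exp (- (e * n))) \<partial>lborel) = 1"
    "integrable lborel (\<lambda>n. indicator {0<..} n * (e * exp (- (e * n))) * n)"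
    "(\<integral>n. indicator {0<..} n * (e * exp (- (e * n))) * n \<partial>lborel) = 1 / e"
proof -
  note lim = exp_decay_at_top[OF e]
  have E: "einterval 0 \<infinity> = {0<..}" by (auto simp: einterval_def)
  have c: "((\<lambda>n::real. - exp (- (e * n))) \<longlongrightarrow> - exp (- (e * 0))) (at_right 0)"
    "((\<lambda>n::real. - (n * exp (- (e * n))) - exp (- (e * n)) / e) \<longlongrightarrow> - (0 * exp (- (e * 0))) - exp (- (e * 0)) / e) (at_right 0)"
    using e by (intro tendsto_intros; simp)+
  note 1 = interval_integral_FTC_nonneg[where a=0 and b=\<infinity> and F="\<lambda>n. - exp (- (e * n))"
      and f="\<lambda>n. e * exp (- (e * n))" and A="-1" and B=0]
  have "set_integrable lborel (einterval 0 \<infinity>) (\<lambda>n. e * exp (- (e * n)))" "(LBINT n=0..\<infinity>. e * exp (- (e * n))) = 0 - (-1)"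
    using c lim e tendsto_minus[OF lim(1)]
    by (intro 1; auto intro!: derivative_eq_intros continuous_intros simp: ereal_tendsto_simps1 zero_ereal_def)+
  then show "integrable lborel (\<lambda>n. indicator {0<..} n * (e * exp (- (e * n))))"
    "(\<integral>n. indicator {0<..} n * (e * exp (- (e * n))) \<partial>lborel) = 1"
    unfolding interval_lebesgue_integral_def set_lebesgue_integral_def set_integrable_def E real_scaleR_def by simp_all
  note 2 = interval_integral_FTC_nonneg[where a=0 and b=\<infinity> and F="\<lambda>n. - (n * exp (- (e * n))) - exp (- (e * n)) / e"
      and f="\<lambda>n. e * exp (- (e * n)) * n" and A="-(1/e)" and B=0]
  have "set_integrable lborel (einterval 0 \<infinity>) (\<lambda>n. e * exp (- (e * n)) * n)" "(LBINT n=0..\<infinity>. e * exp (- (e * n)) * n) = 0 - (-(1/e))"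
    using c lim e tendsto_diff[OF tendsto_minus[OF lim(2)] tendsto_divide[OF lim(1) tendsto_const, of e]]
    by (intro 2; auto intro!: derivative_eq_intros continuous_intros simp: ereal_tendsto_simps1 zero_ereal_def)+
  then show "integrable lborel (\<lambda>n. indicator {0<..} n * (e * exp (- (e * n))) * n)"
    "(\<integral>n. indicator {0<..} n * (e * exp (- (e * n))) * n \<partial>lborel) = 1 / e"
    unfolding interval_lebesgue_integral_def set_lebesgue_integral_def set_integrable_def E real_scaleR_def
    by (simp_all add: mult.assoc)
qed

lemma laplace_sk:
  assumes e: "e > 0"
  shows "(\<integral>n. indicator {0<..} n * (e * exp (- (e * n))) * sk n s \<partial>lborel) = pk e s"
proof (cases "s = 0")
  case True
  have "(\<integral>n. indicator {0<..} n * (e * exp (- (e * n))) * sk n s \<partial>lborel)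
    = (\<integral>n. indicator {0<..} n * (e * exp (- (e * n))) * n / pi \<partial>lborel)"
    using True by (simp add: sk_def)
  also have "\<dots> = 1 / e / pi" using exp_weight_integral(4)[OF e] by simp
  finally show ?thesis using e True by (simp add: pk_def power2_eq_square)
next
  case False
  \<comment> \<open>The antiderivative in n of e exp(-en) sin(ns)/(pi s). It vanishes at infinity,
    so the integral is -F 0.\<close>
  define F where "F n = - (e * exp (- (e * n)) * (e * sin (n * s) + s * cos (n * s)) / (e\<^sup>2 + s\<^sup>2) / (pi * s))" for n
  have p: "e\<^sup>2 + s\<^sup>2 > 0" using e by (simp add: add_pos_nonneg)
  have "(LBINT n=0..\<infinity>. e * exp (- (e * n)) * sk n s) = 0 - (- (e / ((e\<^sup>2 + s\<^sup>2) * pi)))"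
  proof (rule interval_integral_FTC_integrable[where F=F])
    fix n :: real
    have "(F has_real_derivative - ((e * (exp (- (e * n)) * (- e)) * (e * sin (n * s) + s * cos (n * s)) + e * exp (- (e * n)) * (e * (cos (n * s) * s) + s * (- sin (n * s) * s))) / (e\<^sup>2 + s\<^sup>2) / (pi * s))) (at n)"
      unfolding F_def using p False by (auto intro!: derivative_eq_intros)
    also have "- ((e * (exp (- (e * n)) * (- e)) * (e * sin (n * s) + s * cos (n * s)) + e * exp (- (e * n)) * (e * (cos (n * s) * s) + s * (- sin (n * s) * s))) / (e\<^sup>2 + s\<^sup>2) / (pi * s))
       = (e * exp (- (e * n)) * sin (n * s) * (e\<^sup>2 + s\<^sup>2)) / (e\<^sup>2 + s\<^sup>2) / (pi * s)"
      unfolding minus_divide_left by (rule arg_cong[where f="\<lambda>z. z / (e\<^sup>2 + s\<^sup>2) / (pi * s)"]) (simp add: algebra_simps power2_eq_square)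
    also have "\<dots> = e * exp (- (e * n)) * sk n s"
      using p False by (simp add: sk_def)
    finally show "(F has_vector_derivative e * exp (- (e * n)) * sk n s) (at n)"
      by (simp add: has_real_derivative_iff_has_vector_derivative)
    show "isCont (\<lambda>n. e * exp (- (e * n)) * sk n s) n"
      using False by (auto simp: sk_def intro!: continuous_intros)
  next
    show "set_integrable lborel (einterval 0 \<infinity>) (\<lambda>n. e * exp (- (e * n)) * sk n s)"
      unfolding set_integrable_def
    proof (rule Bochner_Integration.integrable_bound)
      show "integrable lborel (\<lambda>n. indicator {0<..} n * (e * exp (- (e * n))) * n / pi)"
        using exp_weight_integral(3)[OF e] by simp
      have "(\<lambda>n. sk n s) \<in> borel_measurable borel" unfolding sk_def by measurable
      then show "(\<lambda>n. indicator (einterval 0 \<infinity>) n *\<^sub>R (e * exp (- (e * n)) * sk n s)) \<in> borel_measurable lborel" by measurable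
      show "AE n in lborel. norm (indicator (einterval 0 \<infinity>) n *\<^sub>R (e * exp (- (e * n)) * sk n s)) \<le> norm (indicator {0<..} n * (e * exp (- (e * n))) * n / pi)"
      proof (rule AE_I2)
        fix n
        have "e * exp (- (e * n)) * \<bar>sk n s\<bar> \<le> e * exp (- (e * n)) * (n / pi)" if "n > 0"
          using that e by (intro mult_left_mono sk_le) auto
        then show "norm (indicator (einterval 0 \<infinity>) n *\<^sub>R (e * exp (- (e * n)) * sk n s)) \<le> norm (indicator {0<..} n * (e * exp (- (e * n))) * n / pi)"
          using e by (auto simp: indicator_def abs_mult einterval_def zero_ereal_def)
      qed
    qed
    have "(F \<longlongrightarrow> F 0) (at_right 0)"
      unfolding F_def using p False by (intro tendsto_intros) auto
    moreover have "F 0 = - (e / ((e\<^sup>2 + s\<^sup>2) * pi))" using False by (simp add: F_def)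
    ultimately show "((F \<circ> real_of_ereal) \<longlongrightarrow> - (e / ((e\<^sup>2 + s\<^sup>2) * pi))) (at_right 0)"
      by (simp add: ereal_tendsto_simps1 zero_ereal_def)
    have "((\<lambda>n. (e + \<bar>s\<bar>) * e * exp (- (e * n)) / (e\<^sup>2 + s\<^sup>2) / (pi * \<bar>s\<bar>)) \<longlongrightarrow> 0) at_top"
      using tendsto_mult_right_zero[OF exp_decay_at_top(1)[OF e], of "(e + \<bar>s\<bar>) * e / (e\<^sup>2 + s\<^sup>2) / (pi * \<bar>s\<bar>)"]
      by simp
    moreover have "norm (F n) \<le> (e + \<bar>s\<bar>) * e * exp (- (e * n)) / (e\<^sup>2 + s\<^sup>2) / (pi * \<bar>s\<bar>)" for n
    proof -
      have "\<bar>e * sin (n * s) + s * cos (n * s)\<bar> \<le> \<bar>e * sin (n * s)\<bar> + \<bar>s * cos (n * s)\<bar>" by (rule abs_triangle_ineq)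
      also have "\<dots> \<le> e * 1 + \<bar>s\<bar> * 1"
        unfolding abs_mult using e by (intro add_mono mult_mono) auto
      finally have "\<bar>e * sin (n * s) + s * cos (n * s)\<bar> \<le> e + \<bar>s\<bar>" by simp
      then have "e * exp (- (e * n)) * \<bar>e * sin (n * s) + s * cos (n * s)\<bar> \<le> e * exp (- (e * n)) * (e + \<bar>s\<bar>)"
        using e by (intro mult_left_mono) auto
      then have "e * exp (- (e * n)) * \<bar>e * sin (n * s) + s * cos (n * s)\<bar> / (e\<^sup>2 + s\<^sup>2) / (pi * \<bar>s\<bar>)
          \<le> e * exp (- (e * n)) * (e + \<bar>s\<bar>) / (e\<^sup>2 + s\<^sup>2) / (pi * \<bar>s\<bar>)"
        using p by (intro divide_right_mono) auto
      then show ?thesis using p e by (simp add: F_def abs_mult mult.commute mult.left_commute)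
    qed
    ultimately have "(F \<longlongrightarrow> 0) at_top" by (intro Lim_null_comparison[of F "\<lambda>n. (e + \<bar>s\<bar>) * e * exp (- (e * n)) / (e\<^sup>2 + s\<^sup>2) / (pi * \<bar>s\<bar>)"] always_eventually allI)
    then show "((F \<circ> real_of_ereal) \<longlongrightarrow> 0) (at_left \<infinity>)" by (simp add: ereal_tendsto_simps1)
  qed simp
  then show ?thesis
    by (simp add: interval_lebesgue_integral_def set_lebesgue_integral_def zero_ereal_def pk_def ac_simps)
qed

section \<open>The lower bound for simple functions\<close>

text \<open>\<open>\<phi>\<close> is measurable only relative to the interval. The cutoff replaces
  it by a Borel simple function on the whole line, to which the results on indicators apply
  termwise.\<close>

lemma simple_function_cutoff:
  fixes \<phi> :: "real \<Rightarrow> complex"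
  assumes "simple_function (restrict_space borel {-1<..<1}) \<phi>"
  obtains Y :: "complex set" and A :: "complex \<Rightarrow> real set" where "finite Y" "\<And>y. A y \<in> sets borel"
    "\<And>x. indicator {-1<..<1} x * \<phi> x = (\<Sum>y\<in>Y. y * indicator (A y \<inter> {-1<..<1}) x)"
proof
  let ?\<Omega> = "{-1<..<1::real}"
  have s: "space (restrict_space borel ?\<Omega>) = ?\<Omega>" by (simp add: space_restrict_space)
  show fin: "finite (\<phi> ` ?\<Omega>)" using assms s unfolding simple_function_def by simp
  define A where "A y = \<phi> -` {y} \<inter> ?\<Omega>" for y
  show "A y \<in> sets borel" for y
  proof (cases "y \<in> \<phi> ` ?\<Omega>")
    case True
    then obtain x where "x \<in> ?\<Omega>" "y = \<phi> x" by blast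
    then have "\<phi> -` {y} \<inter> ?\<Omega> \<in> sets (restrict_space borel ?\<Omega>)"
      using assms s unfolding simple_function_def by simp
    then show ?thesis by (simp add: A_def sets_restrict_space_iff)
  next
    case False
    then have "A y = {}" by (auto simp: A_def)
    then show ?thesis by simp
  qed
  show "indicator ?\<Omega> x * \<phi> x = (\<Sum>y\<in>\<phi> ` ?\<Omega>. y * indicator (A y \<inter> ?\<Omega>) x)" for x
  proof (cases "x \<in> ?\<Omega>")
    case True
    then have "(\<Sum>y\<in>\<phi> ` ?\<Omega>. y * indicator (A y \<inter> ?\<Omega>) x) = (\<Sum>y\<in>\<phi> ` ?\<Omega>. if y = \<phi> x then y else 0)"
      by (intro sum.cong) (auto simp: A_def indicator_def)
    also have "\<dots> = \<phi> x" using True by (simp add: sum.delta[OF fin])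
    finally show ?thesis using True by simp
  qed simp
qed

definition PopC :: "real \<Rightarrow> (real \<Rightarrow> complex) \<Rightarrow> real \<Rightarrow> complex" where
  "PopC e u t = (\<integral>x. of_real (pk e (x - t)) * u x \<partial>lborel)"

lemma PopC_measurable [measurable]:
  assumes [measurable]: "u \<in> borel_measurable borel"
  shows "PopC e u \<in> borel_measurable borel"
  unfolding PopC_def by measurable

lemma simple_sum_properties:
  assumes fin: "finite Y" and A: "\<And>y. A y \<in> sets borel"
    and u: "\<And>x. u x = (\<Sum>y\<in>Y. y * indicator (A y \<inter> {-1<..<1::real}) x :: complex)"
  shows "integrable lborel u" "\<And>x. norm (u x) \<le> (\<Sum>y\<in>Y. norm y)"
    "AE t in lborel. \<exists>l. ((\<lambda>e. Hop e u t) \<longlongrightarrow> l) (at_right 0)"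
    "AE t in lborel. ((\<lambda>e. PopC e u t) \<longlongrightarrow> u t) (at_right 0)"
proof -
  let ?I = "\<lambda>y. indicator (A y \<inter> {-1<..<1::real}) :: real \<Rightarrow> complex"
  have i: "integrable lborel (?I y)" for y
    using finite_interval_indicator_integrable[OF A[of y], where 'a=complex] by simp
  have ir: "integrable lborel (indicator (A y \<inter> {-1<..<1::real}) :: real \<Rightarrow> real)" for y
    using finite_interval_indicator_integrable[OF A[of y], where 'a=real] by simp
  have u': "u = (\<lambda>x. \<Sum>y\<in>Y. y * ?I y x)" using u by (simp add: fun_eq_iff)
  show "integrable lborel u"
    unfolding u' by (intro Bochner_Integration.integrable_sum integrable_mult_right i)
  show "norm (u x) \<le> (\<Sum>y\<in>Y. norm y)" for x
    unfolding u by (rule sum_norm_le) (auto simp: norm_mult indicator_def)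
  have "AE t in lborel. \<forall>y\<in>Y. \<exists>l. ((\<lambda>e. Hop e (?I y) t) \<longlongrightarrow> l) (at_right 0)"
    using fin A by (intro AE_finite_allI AE_Hop_indicator_convergent)
  then show "AE t in lborel. \<exists>l. ((\<lambda>e. Hop e u t) \<longlongrightarrow> l) (at_right 0)"
  proof eventually_elim
    case (elim t)
    from bchoice[OF elim] obtain l where l: "\<And>y. y \<in> Y \<Longrightarrow> ((\<lambda>e. Hop e (?I y) t) \<longlongrightarrow> l y) (at_right 0)" by blast
    have "((\<lambda>e. \<Sum>y\<in>Y. y * Hop e (?I y) t) \<longlongrightarrow> (\<Sum>y\<in>Y. y * l y)) (at_right 0)"
      by (intro tendsto_sum tendsto_mult tendsto_const l)
    moreover have "\<forall>\<^sub>F e in at_right 0. (\<Sum>y\<in>Y. y * Hop e (?I y) t) = Hop e u t"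
    proof (rule eventually_mono[OF eventually_at_right_less[of 0]])
      fix e :: real assume e: "e > 0"
      have "Hop e u t = (\<integral>x. (\<Sum>y\<in>Y. y * (of_real (hk e (x - t)) * ?I y x)) \<partial>lborel)"
        unfolding Hop_def u' by (intro Bochner_Integration.integral_cong refl) (simp add: sum_distrib_left mult.left_commute)
      also have "\<dots> = (\<Sum>y\<in>Y. \<integral>x. y * (of_real (hk e (x - t)) * ?I y x) \<partial>lborel)"
        by (intro Bochner_Integration.integral_sum integrable_mult_right hk_mult_integrable e i)
      finally show "(\<Sum>y\<in>Y. y * Hop e (?I y) t) = Hop e u t" by (simp add: Hop_def)
    qed
    ultimately show ?case by (blast intro: Lim_transform_eventually)
  qed
  have "AE t in lborel. \<forall>y\<in>Y. ((\<lambda>e. Pop e (indicator (A y \<inter> {-1<..<1})) t) \<longlongrightarrow> indicator (A y \<inter> {-1<..<1}) t) (at_right 0)"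
    using fin A by (intro AE_finite_allI AE_Pop_indicator_tendsto)
  then show "AE t in lborel. ((\<lambda>e. PopC e u t) \<longlongrightarrow> u t) (at_right 0)"
  proof eventually_elim
    case (elim t)
    have "((\<lambda>e. \<Sum>y\<in>Y. y * of_real (Pop e (indicator (A y \<inter> {-1<..<1})) t)) \<longlongrightarrow> (\<Sum>y\<in>Y. y * of_real (indicator (A y \<inter> {-1<..<1}) t))) (at_right 0)"
      using elim by (intro tendsto_sum tendsto_mult tendsto_const tendsto_of_real) auto
    moreover have "(\<Sum>y\<in>Y. y * of_real (indicator (A y \<inter> {-1<..<1}) t)) = u t"
      unfolding u by (intro sum.cong refl) (auto simp: indicator_def)
    moreover have "\<forall>\<^sub>F e in at_right 0. (\<Sum>y\<in>Y. y * of_real (Pop e (indicator (A y \<inter> {-1<..<1})) t)) = PopC e u t"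
    proof (rule eventually_mono[OF eventually_at_right_less[of 0]])
      fix e :: real assume e: "e > 0"
      have "PopC e u t = (\<integral>x. (\<Sum>y\<in>Y. y * of_real (pk e (x - t) * indicator (A y \<inter> {-1<..<1}) x)) \<partial>lborel)"
        unfolding PopC_def u' by (intro Bochner_Integration.integral_cong refl)
          (auto simp: sum_distrib_left indicator_def intro!: sum.cong)
      also have "\<dots> = (\<Sum>y\<in>Y. \<integral>x. y * of_real (pk e (x - t) * indicator (A y \<inter> {-1<..<1}) x) \<partial>lborel)"
        by (intro Bochner_Integration.integral_sum integrable_mult_right integrable_of_real pk_mult_integrable e ir)
      also have "\<dots> = (\<Sum>y\<in>Y. y * of_real (Pop e (indicator (A y \<inter> {-1<..<1})) t))"
        by (simp add: Pop_def integral_of_real del: of_real_mult)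
      finally show "(\<Sum>y\<in>Y. y * of_real (Pop e (indicator (A y \<inter> {-1<..<1})) t)) = PopC e u t" by simp
    qed
    ultimately show ?case by (auto intro: Lim_transform_eventually)
  qed
qed

lemma PopC_norm_le:
  assumes e: "e > 0" and u: "integrable lborel u" and M: "\<And>x. norm (u x) \<le> M"
  shows "norm (PopC e u t) \<le> M"
proof -
  have [measurable]: "u \<in> borel_measurable borel" using u by auto
  have "norm (PopC e u t) \<le> (\<integral>x. M * pk e (x - t) \<partial>lborel)"
    unfolding PopC_def
  proof (rule Bochner_Integration.integral_norm_bound_integral)
    show b: "norm (of_real (pk e (x - t)) * u x) \<le> M * pk e (x - t)" for x
      using mult_right_mono[OF M[of x] pk_nonneg[OF e, of "x - t"]] pk_nonneg[OF e, of "x - t"]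
      by (simp add: norm_mult mult.commute)
    show i: "integrable lborel (\<lambda>x. M * pk e (x - t))" using pk_shift_integral[OF e] by simp
    show "integrable lborel (\<lambda>x. of_real (pk e (x - t)) * u x)"
      by (rule Bochner_Integration.integrable_bound[OF i]) (auto intro!: AE_I2 order_trans[OF b] simp del: norm_mult)
  qed
  then show ?thesis using pk_shift_integral[OF e] by simp
qed

text \<open>Averaging the frequency \<open>n\<close> against \<open>\<epsilon> e\<^sup>-\<^sup>\<epsilon>\<^sup>n\<close> replaces the Dirichlet kernel by the Poisson kernel.\<close>

lemma poisson_pairing_le:
  assumes e: "e > 0" and u: "integrable lborel u"
    and K: "\<And>n. n > 0 \<Longrightarrow> Re (\<integral>t. Dop n u t * cnj (u t) \<partial>lborel) \<le> K"
  shows "Re (\<integral>t. PopC e u t * cnj (u t) \<partial>lborel) \<le> K"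
proof -
  have [measurable]: "u \<in> borel_measurable borel" using u by auto
  define w where "w n = indicator {0<..} n * (e * exp (- (e * n)))" for n :: real
  have [measurable]: "w \<in> borel_measurable borel" unfolding w_def[abs_def] by measurable
  have w0: "w n \<ge> 0" for n using e by (simp add: w_def)
  \<comment> \<open>The pair p holds the output and input variables (t, x), and n is the frequency.
    Integrating over p first gives the averaged Dirichlet pairings; integrating over n first gives
    the Poisson pairing.\<close>
  define G where "G p n = of_real (w n * sk n (snd p - fst p)) * (u (snd p) * cnj (u (fst p)))" for p n
  interpret pair_sigma_finite "lborel \<Otimes>\<^sub>M lborel :: (real \<times> real) measure" "lborel :: real measure" ..
  have [measurable]: "case_prod G \<in> borel_measurable ((lborel \<Otimes>\<^sub>M lborel) \<Otimes>\<^sub>M lborel)"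
    unfolding G_def sk_def by measurable
  have uu: "integrable (lborel \<Otimes>\<^sub>M lborel) (\<lambda>p. norm (u (fst p)) * norm (u (snd p)))"
    by (rule lborel_pair.integrable_pair_mult) (use u in auto)
  have Gi: "integrable ((lborel \<Otimes>\<^sub>M lborel) \<Otimes>\<^sub>M lborel) (case_prod G)"
  proof (rule Bochner_Integration.integrable_bound)
    show "integrable ((lborel \<Otimes>\<^sub>M lborel) \<Otimes>\<^sub>M lborel) (\<lambda>q. (norm (u (fst (fst q))) * norm (u (snd (fst q)))) * (w (snd q) * snd q / pi))"
      by (rule integrable_pair_mult[where f="\<lambda>p. norm (u (fst p)) * norm (u (snd p))" and g="\<lambda>n. w n * n / pi", OF uu])
         (use exp_weight_integral(3)[OF e] in \<open>simp add: w_def\<close>)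
    have b: "norm (G p n) \<le> norm ((norm (u (fst p)) * norm (u (snd p))) * (w n * n / pi))" for p n
    proof (cases "n > 0")
      case True
      have "norm (G p n) = (norm (u (fst p)) * norm (u (snd p))) * (w n * \<bar>sk n (snd p - fst p)\<bar>)"
        using w0[of n] by (simp add: G_def norm_mult abs_mult)
      also have "\<dots> \<le> (norm (u (fst p)) * norm (u (snd p))) * (w n * (n / pi))"
        using w0[of n] True by (intro mult_left_mono sk_le) auto
      finally show ?thesis unfolding real_norm_def by (intro order_trans[OF _ abs_ge_self]) simp
    qed (simp add: G_def w_def)
    show "AE q in (lborel \<Otimes>\<^sub>M lborel) \<Otimes>\<^sub>M lborel. norm (case_prod G q) \<le> norm ((norm (u (fst (fst q))) * norm (u (snd (fst q)))) * (w (snd q) * snd q / pi))"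
      using b by (intro AE_I2) (simp add: case_prod_beta)
  qed simp
  \<comment> \<open>Stated for any bounded kernel k, so that it serves both \<open>sk n\<close> and
    \<open>pk e\<close>.\<close>
  have pair_split: "(\<integral>p. of_real (k (snd p - fst p)) * (u (snd p) * cnj (u (fst p))) \<partial>(lborel \<Otimes>\<^sub>M lborel))
      = (\<integral>t. (\<integral>x. of_real (k (x - t)) * u x \<partial>lborel) * cnj (u t) \<partial>lborel)"
    if [measurable]: "k \<in> borel_measurable borel" and k: "\<And>s. \<bar>k s\<bar> \<le> c" for k and c :: real
  proof -
    have c: "c \<ge> 0" using k[of 0] by linarith
    have "integrable (lborel \<Otimes>\<^sub>M lborel) (\<lambda>p. of_real (k (snd p - fst p)) * (u (snd p) * cnj (u (fst p))))"
    proof (rule Bochner_Integration.integrable_bound)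
      show "integrable (lborel \<Otimes>\<^sub>M lborel) (\<lambda>p. c * (norm (u (fst p)) * norm (u (snd p))))"
        using uu by (rule integrable_mult_right)
      have "norm (of_real (k (snd p - fst p)) * (u (snd p) * cnj (u (fst p)))) \<le> norm (c * (norm (u (fst p)) * norm (u (snd p))))" for p
        using mult_right_mono[OF k[of "snd p - fst p"], of "norm (u (fst p)) * norm (u (snd p))"] c
        by (simp add: norm_mult mult.commute abs_mult)
      then show "AE p in lborel \<Otimes>\<^sub>M lborel. norm (of_real (k (snd p - fst p)) * (u (snd p) * cnj (u (fst p)))) \<le> norm (c * (norm (u (fst p)) * norm (u (snd p))))"
        by (rule AE_I2)
    qed measurable
    from lborel_pair.integral_fst'[OF this, symmetric] show ?thesis
      by (simp add: mult.assoc[symmetric])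
  qed
  have inner: "(\<integral>p. G p n \<partial>(lborel \<Otimes>\<^sub>M lborel)) = of_real (w n) * (\<integral>t. Dop n u t * cnj (u t) \<partial>lborel)" for n
  proof (cases "n > 0")
    case True
    have m: "sk n \<in> borel_measurable borel" unfolding sk_def[abs_def] by measurable
    have "(\<integral>p. G p n \<partial>(lborel \<Otimes>\<^sub>M lborel)) = of_real (w n) * (\<integral>p. of_real (sk n (snd p - fst p)) * (u (snd p) * cnj (u (fst p))) \<partial>(lborel \<Otimes>\<^sub>M lborel))"
      by (simp add: G_def mult.assoc)
    then show ?thesis using pair_split[OF m sk_le] True by (simp add: Dop_def)
  qed (simp add: G_def w_def)
  have "(\<integral>n. (\<integral>p. G p n \<partial>(lborel \<Otimes>\<^sub>M lborel)) \<partial>lborel) = (\<integral>p. (\<integral>n. G p n \<partial>lborel) \<partial>(lborel \<Otimes>\<^sub>M lborel))"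
    by (rule Fubini_integral[OF Gi])
  also have "\<dots> = (\<integral>p. of_real (pk e (snd p - fst p)) * (u (snd p) * cnj (u (fst p))) \<partial>(lborel \<Otimes>\<^sub>M lborel))"
    unfolding G_def using laplace_sk[OF e, folded w_def]
    by (simp add: integral_mult_left_zero integral_of_real del: of_real_mult)
  also have "\<dots> = (\<integral>t. PopC e u t * cnj (u t) \<partial>lborel)"
    using pair_split[of "pk e" "1 / (pi * e)"] pk_le[OF e] pk_nonneg[OF e] by (simp add: PopC_def)
  finally have eq: "(\<integral>t. PopC e u t * cnj (u t) \<partial>lborel) = (\<integral>n. of_real (w n) * (\<integral>t. Dop n u t * cnj (u t) \<partial>lborel) \<partial>lborel)"
    unfolding inner ..
  have i: "integrable lborel (\<lambda>n. of_real (w n) * (\<integral>t. Dop n u t * cnj (u t) \<partial>lborel))"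
    using integrable_snd[OF Gi] unfolding inner .
  have "Re (\<integral>t. PopC e u t * cnj (u t) \<partial>lborel) = (\<integral>n. Re (of_real (w n) * (\<integral>t. Dop n u t * cnj (u t) \<partial>lborel)) \<partial>lborel)"
    unfolding eq using i by (rule integral_Re[symmetric])
  also have "\<dots> \<le> (\<integral>n. w n * K \<partial>lborel)"
  proof (rule integral_mono)
    show "integrable lborel (\<lambda>n. Re (of_real (w n) * (\<integral>t. Dop n u t * cnj (u t) \<partial>lborel)))" using i by (rule integrable_Re)
    show "integrable lborel (\<lambda>n. w n * K)" using exp_weight_integral(1)[OF e] by (simp add: w_def)
    show "Re (of_real (w n) * (\<integral>t. Dop n u t * cnj (u t) \<partial>lborel)) \<le> w n * K" for n
    proof (cases "n > 0")
      case True
      then show ?thesis using mult_left_mono[OF K[OF True] w0[of n]] by simp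
    qed (simp add: w_def)
  qed
  also have "\<dots> = K" using exp_weight_integral(2)[OF e] by (simp add: w_def[abs_def])
  finally show ?thesis .
qed

text \<open>Pairing with u confines the integral to the interval, where S controls the transforms.
  With a, b the norms of the two modulated transforms and c = |u|, the integrand is at most (a + b)
  c / 2 <= (a^2 + b^2)/4 + c^2/2; the hypothesis on S is then used at n and at -n.\<close>

lemma Dop_pairing_le:
  assumes u: "integrable lborel u" and u2: "integrable lborel (\<lambda>x. (norm (u x))\<^sup>2)"
    and supp: "\<And>x. x \<notin> {-1<..<1} \<Longrightarrow> u x = 0"
    and conv: "AE t in lborel. \<exists>l. ((\<lambda>e. Hop e u t) \<longlongrightarrow> l) (at_right 0)"
    and S: "\<And>n. (\<integral>t. indicator {-1<..<1} t * (norm (PV (\<lambda>x. cis (n * x) * u x) t))\<^sup>2 \<partial>lborel) \<le> S\<^sup>2"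
    and n: "n > 0"
  shows "Re (\<integral>t. Dop n u t * cnj (u t) \<partial>lborel) \<le> (S\<^sup>2 + (\<integral>x. (norm (u x))\<^sup>2 \<partial>lborel)) / 2"
proof -
  have [measurable]: "u \<in> borel_measurable borel" using u by auto
  define v where "v n t = indicator {-1<..<1} t * (norm (PV (\<lambda>x. cis (n * x) * u x) t))\<^sup>2" for n t
  have vi: "integrable lborel (v n)" for n
    unfolding v_def[abs_def] by (rule PV_L2_bound(1)[OF cis_mult_integrable[OF u]]) (use u2 in \<open>simp add: norm_mult\<close>)
  define h where "h t = (v n t + v (- n) t) / 4 + (norm (u t))\<^sup>2 / 2" for t
  have hi: "integrable lborel h" unfolding h_def using vi u2 by simp
  have Di: "integrable lborel (\<lambda>t. Dop n u t * cnj (u t))"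
  proof (rule Bochner_Integration.integrable_bound)
    let ?c = "n / pi * (\<integral>x. norm (u x) \<partial>lborel)"
    show "integrable lborel (\<lambda>t. ?c * norm (u t))" using u by simp
    have "norm (Dop n u t * cnj (u t)) \<le> ?c * norm (u t)" for t
      unfolding norm_mult complex_mod_cnj using Dop_norm_le[OF _ u] n by (intro mult_right_mono) auto
    then show "AE t in lborel. norm (Dop n u t * cnj (u t)) \<le> norm (?c * norm (u t))"
      by (intro AE_I2) (simp only: real_norm_def order_trans[OF _ abs_ge_self])
  qed measurable
  have "Re (\<integral>t. Dop n u t * cnj (u t) \<partial>lborel) = (\<integral>t. Re (Dop n u t * cnj (u t)) \<partial>lborel)"
    using Di by (rule integral_Re[symmetric])
  also have "\<dots> \<le> (\<integral>t. h t \<partial>lborel)"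
  proof (rule integral_mono_AE[OF integrable_Re[OF Di] hi])
    from conv show "AE t in lborel. Re (Dop n u t * cnj (u t)) \<le> h t"
    proof eventually_elim
      case (elim t)
      show ?case
      proof (cases "t \<in> {-1<..<1}")
        case True
        let ?a = "norm (PV (\<lambda>x. cis (n * x) * u x) t)" and ?b = "norm (PV (\<lambda>x. cis (- n * x) * u x) t)" and ?c = "norm (u t)"
        from elim obtain l where "((\<lambda>e. Hop e u t) \<longlongrightarrow> l) (at_right 0)" ..
        from Dop_eq_modulated_PV[OF u this, of n]
        have "norm (2 * \<i> * Dop n u t) \<le> norm (cis (- (n * t)) * PV (\<lambda>x. cis (n * x) * u x) t) + norm (cis (n * t) * PV (\<lambda>x. cis (- n * x) * u x) t)"
          by (metis norm_triangle_ineq4)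
        then have "2 * norm (Dop n u t) \<le> ?a + ?b" by (simp add: norm_mult)
        from mult_right_mono[OF this norm_ge_zero[of "u t"]]
        have "2 * (norm (Dop n u t) * ?c) \<le> ?a * ?c + ?b * ?c" by (simp add: distrib_right mult.assoc)
        moreover have "?a * ?c \<le> (?a\<^sup>2 + ?c\<^sup>2) / 2" "?b * ?c \<le> (?b\<^sup>2 + ?c\<^sup>2) / 2"
          using sum_squares_bound[of ?a ?c] sum_squares_bound[of ?b ?c] by simp_all
        moreover have "Re (Dop n u t * cnj (u t)) \<le> norm (Dop n u t) * ?c"
          using complex_Re_le_cmod[of "Dop n u t * cnj (u t)"] by (simp add: norm_mult)
        moreover have "h t = (?a\<^sup>2 + ?b\<^sup>2) / 4 + ?c\<^sup>2 / 2" using True by (simp add: h_def v_def)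
        ultimately show ?thesis by (simp add: field_simps)
      next
        case False
        then show ?thesis using supp by (simp add: h_def v_def)
      qed
    qed
  qed
  also have "\<dots> = ((\<integral>t. v n t \<partial>lborel) + (\<integral>t. v (- n) t \<partial>lborel)) / 4 + (\<integral>x. (norm (u x))\<^sup>2 \<partial>lborel) / 2"
    unfolding h_def using vi u2 by simp
  also have "\<dots> \<le> (S\<^sup>2 + (\<integral>x. (norm (u x))\<^sup>2 \<partial>lborel)) / 2"
    using S[of n, folded v_def] S[of "- n", folded v_def] by (simp add: field_simps)
  finally show ?thesis .
qed

section \<open>The numerical constant and finiteness of the supremum\<close>

lemma fermi_integral_le_one: "(LINT l:{0<..}|lborel. 4 * l / (exp (pi * l) + 1)) \<le> 1"
proof -
  let ?f = "\<lambda>l::real. indicator {0<..} l * (4 * l / (exp (pi * l) + 1))"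
  let ?g = "\<lambda>l::real. 4 / pi * (indicator {0<..} l * (pi * exp (- (pi * l))) * l)"
  have g: "integrable lborel ?g" "(\<integral>l. ?g l \<partial>lborel) = 4 / pi * (1 / pi)"
    using integrable_mult_right[OF exp_weight_integral(3)[OF pi_gt_zero], of "4 / pi"]
    by (simp_all only: integral_mult_right_zero exp_weight_integral(4)[OF pi_gt_zero])
  have b: "\<bar>?f l\<bar> \<le> ?g l" for l
  proof (cases "l > 0")
    case True
    \<comment> \<open>Dropping the 1 from the denominator leaves 4/pi times the first-moment
      integrand of the exponential weight with parameter pi.\<close>
    then have "4 * l / (exp (pi * l) + 1) \<le> 4 * l / exp (pi * l)"
      by (intro divide_left_mono) (auto intro!: mult_pos_pos add_pos_pos)
    moreover have "?g l = 4 * l / exp (pi * l)" using True by (simp add: exp_minus divide_inverse)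
    moreover have "\<bar>?f l\<bar> = 4 * l / (exp (pi * l) + 1)" using True by (simp add: add_pos_pos)
    ultimately show ?thesis by (simp only:)
  qed simp
  have "(\<integral>l. ?f l \<partial>lborel) \<le> (\<integral>l. ?g l \<partial>lborel)"
  proof (rule integral_mono[OF _ g(1)])
    show "integrable lborel ?f"
    proof (rule Bochner_Integration.integrable_bound[OF g(1)])
      show "AE l in lborel. norm (?f l) \<le> norm (?g l)"
        unfolding real_norm_def by (intro AE_I2 order_trans[OF b abs_ge_self])
    qed measurable
    show "?f l \<le> ?g l" for l using b[of l] by linarith
  qed
  also have "\<dots> \<le> 1"
    unfolding g(2) using pi_gt3 mult_mono[of 3 pi 3 pi] by (simp add: divide_simps)
  finally show ?thesis by (simp add: set_lebesgue_integral_def)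
qed

lemma cis_unimodular: "(\<lambda>x. cis (n * x)) \<in> unimodular"
  unfolding unimodular_def by simp

text \<open>A real supremum can be compared with its members only if the set is bounded above. Since
  |\<theta> \<phi>| = |\<phi>| a.e. on the interval, the L^2 bound for \<open>PV\<close> does not
  depend on \<theta>.\<close>

lemma bdd_above_L2norm_finite_hilbert:
  fixes \<phi> :: "real \<Rightarrow> complex"
  assumes u: "integrable lborel (\<lambda>x. indicator {-1<..<1} x * \<phi> x)"
    and u2: "integrable lborel (\<lambda>x. (norm (indicator {-1<..<1} x * \<phi> x))\<^sup>2)"
  shows "bdd_above ((\<lambda>\<theta>. L2norm (finite_hilbert (\<lambda>x. \<theta> x * \<phi> x))) ` unimodular)"
proof (rule bdd_aboveI2)
  let ?u = "\<lambda>x. indicator {-1<..<1} x * \<phi> x"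
  fix \<theta> assume "\<theta> \<in> unimodular"
  then have [measurable]: "\<theta> \<in> borel_measurable borel"
    and \<theta>: "AE x in lborel. x \<in> {-1<..<1} \<longrightarrow> norm (\<theta> x) = 1" by (auto simp: unimodular_def)
  have um [measurable]: "?u \<in> borel_measurable borel" using u by auto
  have n: "AE x in lborel. norm (\<theta> x * ?u x) = norm (?u x)"
    using \<theta> by eventually_elim (auto simp: norm_mult indicator_def)
  have i: "integrable lborel (\<lambda>x. \<theta> x * ?u x)"
    by (rule Bochner_Integration.integrable_bound[OF u]) (use n in \<open>auto elim: eventually_mono\<close>)
  have e: "AE x in lborel. (norm (\<theta> x * ?u x))\<^sup>2 = (norm (?u x))\<^sup>2"
    using n by eventually_elim simp
  have i2: "integrable lborel (\<lambda>x. (norm (\<theta> x * ?u x))\<^sup>2)"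
    using u2 by (subst integrable_cong_AE[OF _ _ e]) measurable
  have "(\<integral>x. (norm (\<theta> x * ?u x))\<^sup>2 \<partial>lborel) = (\<integral>x. (norm (?u x))\<^sup>2 \<partial>lborel)"
    by (rule integral_cong_AE[OF _ _ e]) measurable
  with PV_L2_bound(2)[OF i i2]
  have "(\<integral>t. indicator {-1<..<1} t * (norm (PV (\<lambda>x. \<theta> x * ?u x) t))\<^sup>2 \<partial>lborel)
    \<le> 4 * (\<integral>x. (norm (?u x))\<^sup>2 \<partial>lborel) + 2 * (norm divergent_Lim)\<^sup>2" by simp
  then show "L2norm (finite_hilbert (\<lambda>x. \<theta> x * \<phi> x)) \<le> sqrt (4 * (\<integral>x. (norm (?u x))\<^sup>2 \<partial>lborel) + 2 * (norm divergent_Lim)\<^sup>2)"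
    unfolding L2norm_finite_hilbert mult.left_commute[of "indicator _ _" "\<theta> _"] by (rule real_sqrt_le_mono)
qed

theorem theorem5p2:
  fixes \<phi> :: "real \<Rightarrow> complex"
  assumes "simple_function (restrict_space borel {-1<..<1}) \<phi>"
  shows "sqrt (LINT l:{0<..}|lborel. 4 * l / (exp (pi * l) + 1)) * L2norm \<phi>
           \<le> (SUP \<theta>\<in>unimodular. L2norm (finite_hilbert (\<lambda>x. \<theta> x * \<phi> x)))"
proof -
  define u where "u x = indicator {-1<..<1} x * \<phi> x" for x
  obtain Y A where YA: "finite Y" "\<And>y. A y \<in> sets borel"
    "\<And>x. u x = (\<Sum>y\<in>Y. y * indicator (A y \<inter> {-1<..<1}) x)"
    using simple_function_cutoff[OF assms] unfolding u_def by blast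
  note simple = simple_sum_properties[OF YA]
  define M where "M = (\<Sum>y\<in>Y. norm y)"
  have M: "norm (u x) \<le> M" for x using simple(2) by (simp add: M_def)
  have ui: "integrable lborel u" by (rule simple(1))
  have [measurable]: "u \<in> borel_measurable borel" using ui by auto
  have u2: "integrable lborel (\<lambda>x. (norm (u x))\<^sup>2)"
  proof (rule Bochner_Integration.integrable_bound)
    show "integrable lborel (\<lambda>x. M * norm (u x))" using ui by simp
    have "(norm (u x))\<^sup>2 \<le> M * norm (u x)" for x
      unfolding power2_eq_square using M by (intro mult_right_mono) auto
    then show "AE x in lborel. norm ((norm (u x))\<^sup>2) \<le> norm (M * norm (u x))"
      by (intro AE_I2) (auto intro: order_trans[OF _ abs_ge_self])
  qed measurable
  define N where "N = (\<integral>x. (norm (u x))\<^sup>2 \<partial>lborel)"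
  have L2: "L2norm \<phi> = sqrt N"
    unfolding L2norm_def set_lebesgue_integral_def N_def u_def
    by (intro arg_cong[where f=sqrt] Bochner_Integration.integral_cong refl) (simp add: indicator_def)
  define S where "S = (SUP \<theta>\<in>unimodular. L2norm (finite_hilbert (\<lambda>x. \<theta> x * \<phi> x)))"
  have "bdd_above ((\<lambda>\<theta>. L2norm (finite_hilbert (\<lambda>x. \<theta> x * \<phi> x))) ` unimodular)"
    using ui u2 unfolding u_def[abs_def] by (rule bdd_above_L2norm_finite_hilbert)
  then have upper: "L2norm (finite_hilbert (\<lambda>x. cis (n * x) * \<phi> x)) \<le> S" for n
    unfolding S_def by (rule cSUP_upper2[OF _ cis_unimodular order_refl])
  \<comment> \<open>Comparison with the member of frequency 0 shows S >= 0, which is needed to take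
    square roots in N <= S^2.\<close>
  have "0 \<le> L2norm (finite_hilbert (\<lambda>x. cis (0 * x) * \<phi> x))"
    unfolding L2norm_finite_hilbert by (intro real_sqrt_ge_zero Bochner_Integration.integral_nonneg) simp
  then have S0: "S \<ge> 0" using upper[of 0] by linarith
  have S: "(\<integral>t. indicator {-1<..<1} t * (norm (PV (\<lambda>x. cis (n * x) * u x) t))\<^sup>2 \<partial>lborel) \<le> S\<^sup>2" for n
  proof -
    have "sqrt (\<integral>t. indicator {-1<..<1} t * (norm (PV (\<lambda>x. cis (n * x) * u x) t))\<^sup>2 \<partial>lborel) \<le> S"
      using upper[of n] unfolding L2norm_finite_hilbert u_def mult.left_commute[of "indicator _ _" "cis _"] .
    then show ?thesis by (rule sqrt_le_D)
  qed
  have supp: "u x = 0" if "x \<notin> {-1<..<1}" for x using that by (simp add: u_def)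
  have P: "Re (\<integral>t. PopC e u t * cnj (u t) \<partial>lborel) \<le> (S\<^sup>2 + N) / 2" if "e > 0" for e
    unfolding N_def by (rule poisson_pairing_le[OF that ui Dop_pairing_le[OF ui u2 supp simple(3) S]])
  have "((\<lambda>e. \<integral>t. PopC e u t * cnj (u t) \<partial>lborel) \<longlongrightarrow> (\<integral>t. u t * cnj (u t) \<partial>lborel)) (at_right 0)"
  proof (rule integral_dominated_convergence_at_right)
    show "integrable lborel (\<lambda>t. M * norm (u t))" using ui by simp
    show "AE t in lborel. norm (PopC e u t * cnj (u t)) \<le> M * norm (u t)" if "e > 0" for e
      unfolding norm_mult complex_mod_cnj by (intro AE_I2 mult_right_mono PopC_norm_le that ui M) auto
    show "AE t in lborel. ((\<lambda>e. PopC e u t * cnj (u t)) \<longlongrightarrow> u t * cnj (u t)) (at_right 0)"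
      using simple(4) by eventually_elim (intro tendsto_mult tendsto_const)
  qed measurable
  also have "(\<integral>t. u t * cnj (u t) \<partial>lborel) = of_real N"
    by (simp only: complex_norm_square[symmetric] N_def) (simp del: of_real_power)
  finally have "((\<lambda>e. Re (\<integral>t. PopC e u t * cnj (u t) \<partial>lborel)) \<longlongrightarrow> Re (of_real N)) (at_right 0)"
    by (rule tendsto_Re)
  moreover have "\<forall>\<^sub>F e in at_right 0. Re (\<integral>t. PopC e u t * cnj (u t) \<partial>lborel) \<le> (S\<^sup>2 + N) / 2"
    using P by (rule eventually_mono[OF eventually_at_right_less[of 0]])
  ultimately have "Re (of_real N) \<le> (S\<^sup>2 + N) / 2" by (intro tendsto_upperbound) auto
  \<comment> \<open>N is finite and occurs on the right with weight only 1/2, so it can be absorbed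
    on the left.\<close>
  then have "N \<le> S\<^sup>2" by simp
  then have "sqrt N \<le> S" using S0 by (rule real_le_lsqrt[OF _ _, rotated])
  have "sqrt (LINT l:{0<..}|lborel. 4 * l / (exp (pi * l) + 1)) * L2norm \<phi> \<le> 1 * L2norm \<phi>"
    using fermi_integral_le_one by (intro mult_right_mono) (auto simp: L2 N_def)
  also have "\<dots> \<le> S" using \<open>sqrt N \<le> S\<close> by (simp add: L2)
  finally show ?thesis by (simp add: S_def)
qed

end
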